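(* For all $n,k \in \mathbb{N}$ with $k \ge 2$ and every $\mu \vdash n$, \[ \lim_{q\to\infty} p_{k,\mu}(q) = \lim_{q\to\infty} p^\Box_{k,\mu}(q) = \frac{1}{z_\mu}, \] the limits taken over prime powers $q$.
   Context: For a prime power $q$, the cycle type of $g \in \mathrm{GL}_n\mathbb{F}_q$ is the partition of $n$ formed by the degrees of the irreducible factors (with multiplicity) of its characteristic polynomial, in weakly decreasing order; $\mathcal{T}_\mu(q)$ is the set of elements of cycle type $\mu$, so $\mathcal{T}_{(n)}(q)$ is the set of regular elliptic elements (irreducible characteristic polynomial). $g$ is regular semisimple if its characteristic polynomial has no repeated irreducible factor; $\mathcal{T}^\Box_\mu(q)$ is the set of regular semisimple elements of cycle type $\mu$. Define $p_{k,\mu}(q) = \#\{(t_1,\ldots,t_k)\in\mathcal{T}_{(n)}(q)^k : t_1\cdots t_k \in \mathcal{T}_\mu(q)\} / \#\mathcal{T}_{(n)}(q)^k$ and $p^\Box_{k,\mu}(q) = \#\{(t_1,\ldots,t_k)\in\mathcal{T}_{(n)}(q)^k : t_1\cdots t_k \in \mathcal{T}^\Box_\mu(q)\} / \#\mathcal{T}_{(n)}(q)^k$. $z_\mu = \prod_{i\ge1} i^{m_i(\mu)} m_i(\mu)!$, with $m_i(\mu)$ the multiplicity of $i$ in $\mu$. *)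

theory Defs
  imports
    "HOL-Algebra.Polynomial_Divisibility"
    "HOL-Number_Theory.Prime_Powers"
    "HOL-Combinatorics.Permutations"
    "Jordan_Normal_Form.Matrix"
begin

text \<open>
  The field varies inside the statement, so it is a HOL-Algebra ring record with an explicit
  carrier. Of the theory of matrices only the container type \<^typ>\<open>'a mat\<close> is
  used: the type-class operations on it do not apply here.
\<close>

definition mat_over :: "('a, 'b) ring_scheme \<Rightarrow> nat \<Rightarrow> 'a mat monoid" where
  "mat_over R n =
     \<lparr> carrier = {A \<in> carrier_mat n n. elements_mat A \<subseteq> carrier R},
       mult = (\<lambda>A B. mat n n (\<lambda>(i, j). \<Oplus>\<^bsub>R\<^esub>l\<in>{..<n}. A $$ (i, l) \<otimes>\<^bsub>R\<^esub> B $$ (l, j))),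
       one = mat n n (\<lambda>(i, j). if i = j then \<one>\<^bsub>R\<^esub> else \<zero>\<^bsub>R\<^esub>) \<rparr>"

definition GL :: "('a, 'b) ring_scheme \<Rightarrow> nat \<Rightarrow> 'a mat monoid" where
  "GL R n = units_of (mat_over R n)"

definition det_over :: "('a, 'b) ring_scheme \<Rightarrow> 'a mat \<Rightarrow> 'a" where
  "det_over R A =
     (\<Oplus>\<^bsub>R\<^esub>\<pi>\<in>{\<pi>. \<pi> permutes {..<dim_row A}}.
        let P = (\<Otimes>\<^bsub>R\<^esub>i\<in>{..<dim_row A}. A $$ (i, \<pi> i))
        in if evenperm \<pi> then P else \<ominus>\<^bsub>R\<^esub> P)"

definition charpoly_over :: "('a, 'b) ring_scheme \<Rightarrow> 'a mat \<Rightarrow> 'a list" where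
  "charpoly_over R A =
     det_over (poly_ring R)
       (mat (dim_row A) (dim_row A)
         (\<lambda>(i, j). (if i = j then X\<^bsub>R\<^esub> else \<zero>\<^bsub>poly_ring R\<^esub>)
                   \<ominus>\<^bsub>poly_ring R\<^esub> ring.poly_of_const R (A $$ (i, j))))"

text \<open>
  Partitions are multisets of positive parts. The lemma below shows that the definite description
  in the definition of the cycle type is well-defined.
\<close>

definition partition_of :: "nat \<Rightarrow> nat multiset \<Rightarrow> bool" where
  "partition_of n \<mu> \<longleftrightarrow> 0 \<notin># \<mu> \<and> \<Sum>\<^sub># \<mu> = n"

definition z_part :: "nat multiset \<Rightarrow> nat" where
  "z_part \<mu> = (\<Prod>i\<in>set_mset \<mu>. i ^ count \<mu> i * fact (count \<mu> i))"

lemma cycle_type_unique: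
  assumes "field R" and p: "p \<in> carrier (Ring_Divisibility.mult_of (poly_ring R))" "p \<notin> Units (Ring_Divisibility.mult_of (poly_ring R))"
  shows "\<exists>!\<mu>. \<exists>fs. set fs \<subseteq> carrier (Ring_Divisibility.mult_of (poly_ring R)) \<and>
                  factors (Ring_Divisibility.mult_of (poly_ring R)) fs p \<and>
                  \<mu> = mset (map (\<lambda>f. degree f) fs)"
proof -
  interpret field R by fact
  interpret UP: principal_domain "poly_ring R"
    by (rule univ_poly_is_principal[OF carrier_is_subfield])
  show ?thesis
  proof (rule ex_ex1I)
    show "\<exists>\<mu> fs. set fs \<subseteq> carrier (Ring_Divisibility.mult_of (poly_ring R)) \<and>
                  factors (Ring_Divisibility.mult_of (poly_ring R)) fs p \<and> \<mu> = mset (map (\<lambda>f. degree f) fs)"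
      using UP.mult_of.factors_exist[OF p] by blast
  next
    fix \<mu> \<nu>
    assume "\<exists>fs. set fs \<subseteq> carrier (Ring_Divisibility.mult_of (poly_ring R)) \<and>
                  factors (Ring_Divisibility.mult_of (poly_ring R)) fs p \<and> \<mu> = mset (map (\<lambda>f. degree f) fs)"
       "\<exists>fs. set fs \<subseteq> carrier (Ring_Divisibility.mult_of (poly_ring R)) \<and>
                  factors (Ring_Divisibility.mult_of (poly_ring R)) fs p \<and> \<nu> = mset (map (\<lambda>f. degree f) fs)"
    then obtain fs gs where fs: "set fs \<subseteq> carrier (Ring_Divisibility.mult_of (poly_ring R))" "factors (Ring_Divisibility.mult_of (poly_ring R)) fs p"
        "\<mu> = mset (map (\<lambda>f. degree f) fs)" and gs: "set gs \<subseteq> carrier (Ring_Divisibility.mult_of (poly_ring R))"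
        "factors (Ring_Divisibility.mult_of (poly_ring R)) gs p" "\<nu> = mset (map (\<lambda>f. degree f) gs)" by blast
    from UP.mult_of.factors_unique[OF fs(2) gs(2) p fs(1) gs(1)]
    obtain hs where hs: "mset fs = mset hs" "hs [\<sim>]\<^bsub>Ring_Divisibility.mult_of (poly_ring R)\<^esub> gs"
      by (auto simp: essentially_equal_def)
    have c: "set hs \<subseteq> carrier (Ring_Divisibility.mult_of (poly_ring R))" using hs(1) fs(1) by (metis set_mset_mset)
    have "list_all2 (\<lambda>a b. degree a = degree b) hs gs"
      using hs(2)
    proof (rule list.rel_mono_strong)
      fix a b assume ab: "a \<in> set hs" "b \<in> set gs" and as: "a \<sim>\<^bsub>Ring_Divisibility.mult_of (poly_ring R)\<^esub> b"
      have ca: "a \<in> carrier (poly_ring R)" "b \<in> carrier (poly_ring R)"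
        using ab c gs(1) by auto
      have "a \<sim>\<^bsub>poly_ring R\<^esub> b" using as ca unfolding associated_def factor_def by auto
      then show "degree a = degree b"
        using associated_polynomials_imp_same_length[OF carrier_is_subring ca] by simp
    qed 
    then have "map (\<lambda>f. degree f) hs = map (\<lambda>f. degree f) gs"
      by (induction rule: list_all2_induct) auto
    then show "\<mu> = \<nu>" using fs(3) gs(3) hs(1) by (metis mset_map)
  qed
qed

definition cycle_type :: "('a, 'b) ring_scheme \<Rightarrow> 'a mat \<Rightarrow> nat multiset" where
  "cycle_type R A =
     (THE \<mu>. \<exists>fs. set fs \<subseteq> carrier (Ring_Divisibility.mult_of (poly_ring R)) \<and>
                  factors (Ring_Divisibility.mult_of (poly_ring R)) fs (charpoly_over R A) \<and>
                  \<mu> = mset (map (\<lambda>f. degree f) fs))"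

definition regular_semisimple :: "('a, 'b) ring_scheme \<Rightarrow> 'a mat \<Rightarrow> bool" where
  "regular_semisimple R A \<longleftrightarrow>
     \<not> (\<exists>f \<in> carrier (poly_ring R). pirreducible\<^bsub>R\<^esub> (carrier R) f \<and>
            (f [^]\<^bsub>poly_ring R\<^esub> (2::nat)) pdivides\<^bsub>R\<^esub> charpoly_over R A)"

definition T_set :: "('a, 'b) ring_scheme \<Rightarrow> nat \<Rightarrow> nat multiset \<Rightarrow> 'a mat set" where
  "T_set R n \<mu> = {g \<in> carrier (GL R n). cycle_type R g = \<mu>}"

definition T_box_set :: "('a, 'b) ring_scheme \<Rightarrow> nat \<Rightarrow> nat multiset \<Rightarrow> 'a mat set" where
  "T_box_set R n \<mu> = {g \<in> T_set R n \<mu>. regular_semisimple R g}"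

definition product_prob ::
    "('a, 'b) ring_scheme \<Rightarrow> nat \<Rightarrow> nat \<Rightarrow> 'a mat set \<Rightarrow> real" where
  "product_prob R n k S =
     real (card {ts. length ts = k \<and> set ts \<subseteq> T_set R n {#n#} \<and>
                     foldr (\<otimes>\<^bsub>GL R n\<^esub>) ts \<one>\<^bsub>GL R n\<^esub> \<in> S}) /
     real (card (T_set R n {#n#})) ^ k"

definition p_prob :: "('a, 'b) ring_scheme \<Rightarrow> nat \<Rightarrow> nat \<Rightarrow> nat multiset \<Rightarrow> real" where
  "p_prob R n k \<mu> = product_prob R n k (T_set R n \<mu>)"

definition p_box_prob :: "('a, 'b) ring_scheme \<Rightarrow> nat \<Rightarrow> nat \<Rightarrow> nat multiset \<Rightarrow> real" where
  "p_box_prob R n k \<mu> = product_prob R n k (T_box_set R n \<mu>)"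

definition prime_powers_at_top :: "nat filter" where
  "prime_powers_at_top = inf at_top (principal {q. primepow q})"

end

theory Submission
  imports Defs
begin

text \<open>
  Let \<open>U\<close> be the group of matrices that differ from the identity only in the first column, below
  the diagonal. A matrix is called good if it is conjugate, by a matrix fixing the first coordinate
  functional, to a companion matrix. For a good \<open>h\<close> the characteristic polynomial of \<open>h w\<close> runs exactly
  once through all monic polynomials with the same constant term as that of \<open>h\<close> when \<open>w\<close> runs
  through \<open>U\<close>, and counting shows that all but a fraction \<open>1/q\<close> of the group is good. Hence for any
  set \<open>B\<close> of polynomials the deviation of the indicator of the event that the characteristic polynomial lies in
  \<open>B\<close> from its expectation given the determinant has small averages over translates of \<open>U\<close>.

  The nontrivial elements of \<open>U\<close> form a single conjugacy class, so a Cauchy-Schwarz argument (averaging over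
  conjugates of one factor by \<open>U\<close>) upgrades this to mixing: a product of two independent
  elements with bounded class-invariant densities has an almost uniform characteristic polynomial
  once its determinant is given. It remains to count polynomials: a double count of the pairs
  consisting of a polynomial and an irreducible divisor gives the number of irreducible polynomials with prescribed
  constant term, so the determinants of regular elliptic elements are almost uniform; the square-free
  polynomials of type \<open>\<mu>\<close> number about \<open>q\<^sup>n / z\<^sub>\<mu>\<close>, and the remaining ones are negligible.
\<close>

section \<open>Mixing in finite groups\<close>

text \<open>Equidistribution is available only along cosets \<open>h U\<close>, whereas the factors
  are spread over unions of conjugacy classes, which are unrelated to these cosets. The transfer
  goes through second moments: replacing \<open>t\<close> by its conjugates under \<open>U\<close>
  does not change its weight, and expanding the square of the sum over \<open>U\<close> leaves
  correlations that depend only on \<open>w2^-1 w1\<close>, again an element of \<open>U\<close>. As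
  the nontrivial elements are all conjugate, averaging over the conjugates of one of them amounts to
  averaging over the conjugates of all of \<open>U\<close>, where smallness is known. The terms with
  \<open>w1 = w2\<close> cost about \<open>1 / card U\<close>; for \<open>n = 1\<close>, where
  \<open>U\<close> is trivial, this gains nothing and a direct estimate is used instead. Mixing is
  applied to two factors only: the product of the other \<open>k - 1\<close> enters as a bounded
  weight that need not be a class function, so there is no induction on \<open>k\<close>. The
  determinant cannot be mixed in this way, because right multiplication by \<open>U\<close>
  preserves it. It is therefore removed by a conditional expectation and treated by
  counting.\<close>

context group
begin

lemma bij_betw_mult_right: "g \<in> carrier G \<Longrightarrow> bij_betw (\<lambda>h. h \<otimes> g) (carrier G) (carrier G)"
  by (rule bij_betw_byWitness[where f'="\<lambda>h. h \<otimes> inv g"]) (auto simp: m_assoc)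

lemma bij_betw_mult_left: "g \<in> carrier G \<Longrightarrow> bij_betw (\<lambda>h. g \<otimes> h) (carrier G) (carrier G)"
  by (rule bij_betw_byWitness[where f'="\<lambda>h. inv g \<otimes> h"]) (auto simp: m_assoc[symmetric])

lemma sum_mult_right: "g \<in> carrier G \<Longrightarrow> (\<Sum>h\<in>carrier G. f (h \<otimes> g)) = (\<Sum>h\<in>carrier G. f h)"
  by (rule sum.reindex_bij_betw[OF bij_betw_mult_right])

lemma sum_mult_left: "g \<in> carrier G \<Longrightarrow> (\<Sum>h\<in>carrier G. f (g \<otimes> h)) = (\<Sum>h\<in>carrier G. f h)"
  by (rule sum.reindex_bij_betw[OF bij_betw_mult_left])

lemma sum_conj:
  assumes g: "g \<in> carrier G"
  shows "(\<Sum>h\<in>carrier G. f (g \<otimes> h \<otimes> inv g)) = (\<Sum>h\<in>carrier G. f h)"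
proof -
  have "(\<Sum>h\<in>carrier G. f (g \<otimes> h \<otimes> inv g)) = (\<Sum>h\<in>carrier G. f (h \<otimes> inv g))"
    by (rule sum_mult_left[OF g, of "\<lambda>h. f (h \<otimes> inv g)"])
  also have "\<dots> = (\<Sum>h\<in>carrier G. f h)" using g by (intro sum_mult_right) auto
  finally show ?thesis .
qed

lemma inv_mult_cancel: "x \<in> carrier G \<Longrightarrow> y \<in> carrier G \<Longrightarrow> inv x \<otimes> (x \<otimes> y) = y"
  by (simp add: m_assoc[symmetric])

lemma mult_inv_cancel: "x \<in> carrier G \<Longrightarrow> y \<in> carrier G \<Longrightarrow> x \<otimes> (inv x \<otimes> y) = y"
  by (simp add: m_assoc[symmetric])

definition class_function :: "('a \<Rightarrow> 'c) \<Rightarrow> bool" where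
  "class_function f \<longleftrightarrow> (\<forall>h\<in>carrier G. \<forall>g\<in>carrier G. f (g \<otimes> h \<otimes> inv g) = f h)"

lemma class_functionD:
  "class_function f \<Longrightarrow> h \<in> carrier G \<Longrightarrow> g \<in> carrier G \<Longrightarrow> f (g \<otimes> h \<otimes> inv g) = f h"
  by (simp add: class_function_def)

lemma class_function_conj_eq:
  assumes "class_function f" "h \<in> carrier G" "g \<in> carrier G" "h' = g \<otimes> h \<otimes> inv g"
  shows "f h' = f h"
  using assms by (simp add: class_functionD)

lemma class_function_commute:
  assumes "class_function f" "h \<in> carrier G" "g \<in> carrier G"
  shows "f (h \<otimes> g) = f (g \<otimes> h)"
  by (rule class_function_conj_eq[OF assms(1), of _ h]) (use assms in \<open>auto simp: m_assoc\<close>)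

text \<open>Not normalised: \<open>card (carrier G)\<close> times the mean of
  \<open>R (h w')\<close> over the conjugates \<open>w'\<close> of \<open>w\<close>.\<close>

definition conj_avg :: "('a \<Rightarrow> real) \<Rightarrow> 'a \<Rightarrow> 'a \<Rightarrow> real" where
  "conj_avg R w h = (\<Sum>s\<in>carrier G. R (h \<otimes> (inv s \<otimes> w \<otimes> s)))"

lemma conj_avg_conj:
  assumes w: "w \<in> carrier G" and g: "g \<in> carrier G" and h: "h \<in> carrier G"
  shows "conj_avg R (g \<otimes> w \<otimes> inv g) h = conj_avg R w h"
proof -
  have "conj_avg R (g \<otimes> w \<otimes> inv g) h =
     (\<Sum>s\<in>carrier G. R (h \<otimes> (inv (inv g \<otimes> s) \<otimes> w \<otimes> (inv g \<otimes> s))))"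
    unfolding conj_avg_def using assms
    by (intro sum.cong refl arg_cong[where f=R]) (auto simp: m_assoc inv_mult_group)
  also have "\<dots> = conj_avg R w h"
    unfolding conj_avg_def using assms
    by (intro sum_mult_left[where f="\<lambda>s. R (h \<otimes> (inv s \<otimes> w \<otimes> s))"]) auto
  finally show ?thesis .
qed

text \<open>Expanding the square gives two conjugators. Writing the second one as \<open>t s\<close>
  and conjugating the arguments of \<open>R\<close> by \<open>s\<close> moves \<open>s\<close> into
  \<open>h\<close>, where the sum over \<open>h\<close> absorbs it; the free sum over
  \<open>s\<close> is the factor \<open>card (carrier G)\<close>.\<close>

lemma sum_conj_avg_square:
  fixes R :: "'a \<Rightarrow> real"
  assumes R: "class_function R" and w: "w \<in> carrier G"
  shows "(\<Sum>h\<in>carrier G. (conj_avg R w h)\<^sup>2) =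
     card (carrier G) * (\<Sum>h\<in>carrier G. \<Sum>t\<in>carrier G. R (h \<otimes> w) * R (h \<otimes> (inv t \<otimes> w \<otimes> t)))"
proof -
  have step: "(\<Sum>t\<in>carrier G. R (h \<otimes> (inv s \<otimes> w \<otimes> s)) * R (h \<otimes> (inv t \<otimes> w \<otimes> t))) =
       (\<Sum>t\<in>carrier G. R (s \<otimes> h \<otimes> inv s \<otimes> w) * R (s \<otimes> h \<otimes> inv s \<otimes> (inv t \<otimes> w \<otimes> t)))"
    if h: "h \<in> carrier G" and s: "s \<in> carrier G" for h s
  proof -
    have *: "R (h \<otimes> (inv s \<otimes> w \<otimes> s)) = R (s \<otimes> h \<otimes> inv s \<otimes> w)"
      by (rule class_function_conj_eq[OF R, of _ "inv s"])
         (use w h s in \<open>auto simp: m_assoc inv_mult_cancel mult_inv_cancel\<close>)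
    have **: "R (h \<otimes> (inv (t \<otimes> s) \<otimes> w \<otimes> (t \<otimes> s))) = R (s \<otimes> h \<otimes> inv s \<otimes> (inv t \<otimes> w \<otimes> t))"
      if "t \<in> carrier G" for t
      by (rule class_function_conj_eq[OF R, of _ "inv s"])
         (use w h s that in \<open>auto simp: m_assoc inv_mult_group inv_mult_cancel mult_inv_cancel\<close>)
    have "(\<Sum>t\<in>carrier G. R (h \<otimes> (inv s \<otimes> w \<otimes> s)) * R (h \<otimes> (inv t \<otimes> w \<otimes> t))) =
          (\<Sum>t\<in>carrier G. R (h \<otimes> (inv s \<otimes> w \<otimes> s)) * R (h \<otimes> (inv (t \<otimes> s) \<otimes> w \<otimes> (t \<otimes> s))))"
      by (rule sum_mult_right[OF s, symmetric])
    also have "\<dots> = (\<Sum>t\<in>carrier G. R (s \<otimes> h \<otimes> inv s \<otimes> w) * R (s \<otimes> h \<otimes> inv s \<otimes> (inv t \<otimes> w \<otimes> t)))"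
      by (intro sum.cong refl) (simp only: * **)
    finally show ?thesis .
  qed
  have "(\<Sum>h\<in>carrier G. (conj_avg R w h)\<^sup>2) =
      (\<Sum>h\<in>carrier G. \<Sum>s\<in>carrier G. \<Sum>t\<in>carrier G. R (h \<otimes> (inv s \<otimes> w \<otimes> s)) * R (h \<otimes> (inv t \<otimes> w \<otimes> t)))"
    unfolding conj_avg_def power2_eq_square sum_product ..
  also have "\<dots> = (\<Sum>h\<in>carrier G. \<Sum>s\<in>carrier G. \<Sum>t\<in>carrier G.
       R (s \<otimes> h \<otimes> inv s \<otimes> w) * R (s \<otimes> h \<otimes> inv s \<otimes> (inv t \<otimes> w \<otimes> t)))"
    by (intro sum.cong refl step)
  also have "\<dots> = (\<Sum>s\<in>carrier G. \<Sum>h\<in>carrier G. \<Sum>t\<in>carrier G.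
       R (s \<otimes> h \<otimes> inv s \<otimes> w) * R (s \<otimes> h \<otimes> inv s \<otimes> (inv t \<otimes> w \<otimes> t)))"
    by (rule sum.swap)
  also have "\<dots> = (\<Sum>s\<in>carrier G. \<Sum>h\<in>carrier G. \<Sum>t\<in>carrier G. R (h \<otimes> w) * R (h \<otimes> (inv t \<otimes> w \<otimes> t)))"
    by (intro sum.cong refl
        sum_conj[where f="\<lambda>h. \<Sum>t\<in>carrier G. R (h \<otimes> w) * R (h \<otimes> (inv t \<otimes> w \<otimes> t))"])
  finally show ?thesis by simp
qed

text \<open>
  Substituting \<open>h \<otimes> (w2 \<otimes> t \<otimes> inv w2)\<close> for \<open>h\<close> turns the two arguments into a group element and its
  product with a commutator of \<open>w\<close> and \<open>t\<close>; conjugation invariance then separates \<open>w\<close> from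
  its conjugate by \<open>t\<close>.
\<close>

lemma sum_correlation:
  fixes R :: "'a \<Rightarrow> real"
  assumes R: "class_function R" and w: "w1 \<in> carrier G" "w2 \<in> carrier G"
  defines "w \<equiv> inv w2 \<otimes> w1"
  shows "(\<Sum>h\<in>carrier G. \<Sum>t\<in>carrier G. R (h \<otimes> (w1 \<otimes> t \<otimes> inv w1)) * R (h \<otimes> (w2 \<otimes> t \<otimes> inv w2))) =
     (\<Sum>h\<in>carrier G. \<Sum>t\<in>carrier G. R (h \<otimes> w) * R (h \<otimes> (inv t \<otimes> w \<otimes> t)))"
proof -
  have wc: "w \<in> carrier G" using w unfolding w_def by auto
  have "(\<Sum>h\<in>carrier G. R (h \<otimes> (w1 \<otimes> t \<otimes> inv w1)) * R (h \<otimes> (w2 \<otimes> t \<otimes> inv w2))) =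
        (\<Sum>h\<in>carrier G. R (h \<otimes> w) * R (h \<otimes> (inv t \<otimes> w \<otimes> t)))" if t: "t \<in> carrier G" for t
  proof -
    define z where "z = w \<otimes> inv w1 \<otimes> (w2 \<otimes> inv t \<otimes> inv w2)"
    have z: "z \<in> carrier G" using w t wc unfolding z_def by auto
    have zz: "z = inv t \<otimes> inv w2" using w t unfolding z_def w_def by (simp add: m_assoc inv_mult_cancel mult_inv_cancel)
    have e1: "R (w1 \<otimes> h \<otimes> z \<otimes> (w1 \<otimes> t \<otimes> inv w1)) = R (h \<otimes> (inv t \<otimes> w \<otimes> t))"
      if h: "h \<in> carrier G" for h
      by (rule class_function_conj_eq[OF R, of _ w1])
         (use w t wc h in \<open>auto simp: zz w_def m_assoc inv_mult_cancel mult_inv_cancel\<close>)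
    have e2: "R (w1 \<otimes> h \<otimes> z \<otimes> (w2 \<otimes> t \<otimes> inv w2)) = R (h \<otimes> w)"
      if h: "h \<in> carrier G" for h
      by (rule class_function_conj_eq[OF R, of _ w1])
         (use w t wc h in \<open>auto simp: zz w_def m_assoc inv_mult_cancel mult_inv_cancel\<close>)
    have "(\<Sum>h\<in>carrier G. R (h \<otimes> (w1 \<otimes> t \<otimes> inv w1)) * R (h \<otimes> (w2 \<otimes> t \<otimes> inv w2))) =
      (\<Sum>h\<in>carrier G. R (h \<otimes> z \<otimes> (w1 \<otimes> t \<otimes> inv w1)) * R (h \<otimes> z \<otimes> (w2 \<otimes> t \<otimes> inv w2)))"
      by (rule sum_mult_right[OF z, symmetric])
    also have "\<dots> = (\<Sum>h\<in>carrier G. R (w1 \<otimes> h \<otimes> z \<otimes> (w1 \<otimes> t \<otimes> inv w1)) * R (w1 \<otimes> h \<otimes> z \<otimes> (w2 \<otimes> t \<otimes> inv w2)))"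
      by (rule sum_mult_left[OF w(1), symmetric])
    also have "\<dots> = (\<Sum>h\<in>carrier G. R (h \<otimes> (inv t \<otimes> w \<otimes> t)) * R (h \<otimes> w))"
      by (intro sum.cong refl) (simp only: e1 e2)
    finally show ?thesis by (simp add: mult.commute)
  qed
  then have "(\<Sum>t\<in>carrier G. \<Sum>h\<in>carrier G. R (h \<otimes> (w1 \<otimes> t \<otimes> inv w1)) * R (h \<otimes> (w2 \<otimes> t \<otimes> inv w2))) =
        (\<Sum>t\<in>carrier G. \<Sum>h\<in>carrier G. R (h \<otimes> w) * R (h \<otimes> (inv t \<otimes> w \<otimes> t)))"
    by (rule sum.cong[OF refl])
  then show ?thesis by (subst (1 2) sum.swap)
qed

text \<open>Here \<open>R\<close> stands for the deviation of an indicator from its conditional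
  mean, and \<open>a\<close>, \<open>b\<close> for the densities of the two factors;
  \<open>b\<close> is a class function because \<open>t\<close> is the factor that gets conjugated.
  With \<open>m = card U\<close> the kernel averaged over \<open>U\<close> has mean square at most
  \<open>m * (2 + \<beta> * m)\<close>; division by \<open>m^2\<close> and a square root give the
  bound.\<close>

lemma mixing:
  fixes R a b :: "'a \<Rightarrow> real" and \<beta> A B :: real
  assumes fin: "finite (carrier G)"
    and R: "class_function R" and R1: "\<And>h. h \<in> carrier G \<Longrightarrow> \<bar>R h\<bar> \<le> 1"
    and U: "subgroup U G" and U2: "card U \<ge> 2"
    and w0: "w0 \<in> carrier G"
    and conj: "\<And>w. w \<in> U \<Longrightarrow> w \<noteq> \<one> \<Longrightarrow> \<exists>s\<in>carrier G. w = s \<otimes> w0 \<otimes> inv s"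
    and small: "(\<Sum>h\<in>carrier G. \<bar>\<Sum>w\<in>U. R (h \<otimes> w)\<bar>) \<le> \<beta> * card (carrier G) * card U"
    and b: "class_function b" and bB: "\<And>t. t \<in> carrier G \<Longrightarrow> \<bar>b t\<bar> \<le> B"
    and aA: "\<And>t. t \<in> carrier G \<Longrightarrow> \<bar>a t\<bar> \<le> A"
  shows "\<bar>\<Sum>h\<in>carrier G. \<Sum>t\<in>carrier G. a h * b t * R (h \<otimes> t)\<bar>
     \<le> A * B * (real (card (carrier G)))\<^sup>2 * sqrt (\<beta> + 2 / card U)"
proof -
  let ?G = "carrier G"
  define N where "N = real (card ?G)"
  define m where "m = real (card U)"
  have U_sub: "U \<subseteq> ?G" using U by (rule subgroup.subset)
  have finU: "finite U" using U_sub fin by (rule finite_subset)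
  have N: "N > 0" using fin one_closed unfolding N_def by (auto simp: card_gt_0_iff)
  have m2: "m \<ge> 2" using U2 unfolding m_def by simp
  \<comment> \<open>The kernel that results from conjugating \<open>t\<close> by all of
    \<open>U\<close>; invariance of \<open>b\<close> lets it replace \<open>m\<close> copies of
    \<open>R\<close>.\<close>
  define K where "K h t = (\<Sum>w\<in>U. R (h \<otimes> (w \<otimes> t \<otimes> inv w)))" for h t
  let ?\<psi> = "conj_avg R w0"
  have psi_le: "\<bar>conj_avg R w h\<bar> \<le> N" if "h \<in> ?G" "w \<in> ?G" for w h
  proof -
    have "\<bar>conj_avg R w h\<bar> \<le> (\<Sum>s\<in>?G. \<bar>R (h \<otimes> (inv s \<otimes> w \<otimes> s))\<bar>)"
      unfolding conj_avg_def by (rule sum_abs)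
    also have "\<dots> \<le> (\<Sum>s\<in>?G. 1)" using that by (intro sum_mono R1) auto
    finally show ?thesis unfolding N_def by simp
  qed
  have psi_conj: "conj_avg R w h = ?\<psi> h" if "w \<in> U" "w \<noteq> \<one>" "h \<in> ?G" for w h
    using conj[OF that(1,2)] conj_avg_conj w0 that(3) by metis
  have psi_one: "conj_avg R \<one> h = N * R h" if "h \<in> ?G" for h
    unfolding conj_avg_def N_def using that by (simp add: l_inv)
  have oneU: "\<one> \<in> U" using U by (rule subgroup.one_closed)
  \<comment> \<open>The identity contributes \<open>N * R h\<close> and all other elements of
    \<open>U\<close> contribute the same value, so a bound for the sum over \<open>U\<close> is a
    bound for a single class.\<close>
  have psi_sum: "(\<Sum>w\<in>U. conj_avg R w h) = N * R h + (m - 1) * ?\<psi> h" if h: "h \<in> ?G" for h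
  proof -
    have "(\<Sum>w\<in>U. conj_avg R w h) = conj_avg R \<one> h + (\<Sum>w\<in>U - {\<one>}. conj_avg R w h)"
      using finU oneU by (rule sum.remove)
    also have "(\<Sum>w\<in>U - {\<one>}. conj_avg R w h) = (\<Sum>w\<in>U - {\<one>}. ?\<psi> h)"
      by (intro sum.cong refl psi_conj) (use h in auto)
    also have "\<dots> = (m - 1) * ?\<psi> h" using oneU finU U2 unfolding m_def by (simp add: of_nat_diff)
    finally show ?thesis using psi_one[OF h] by simp
  qed
  have sumU: "(\<Sum>h\<in>?G. \<bar>\<Sum>w\<in>U. conj_avg R w h\<bar>) \<le> \<beta> * N^2 * m"
  proof -
    have eq: "(\<Sum>w\<in>U. conj_avg R w h) = (\<Sum>s\<in>?G. \<Sum>w\<in>U. R (s \<otimes> h \<otimes> inv s \<otimes> w))" if h: "h \<in> ?G" for h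
    proof -
      have "R (h \<otimes> (inv s \<otimes> w \<otimes> s)) = R (s \<otimes> h \<otimes> inv s \<otimes> w)" if "w \<in> U" "s \<in> ?G" for w s
      proof -
        have "w \<in> ?G" using that U_sub by auto
        then show ?thesis
          by (intro class_function_conj_eq[OF R, of _ "inv s"])
             (use h that in \<open>auto simp: m_assoc inv_mult_cancel mult_inv_cancel\<close>)
      qed
      then show ?thesis unfolding conj_avg_def by (subst sum.swap) simp
    qed
    have "(\<Sum>h\<in>?G. \<bar>\<Sum>w\<in>U. conj_avg R w h\<bar>) \<le> (\<Sum>h\<in>?G. \<Sum>s\<in>?G. \<bar>\<Sum>w\<in>U. R (s \<otimes> h \<otimes> inv s \<otimes> w)\<bar>)"
      by (intro sum_mono) (simp add: eq sum_abs)
    also have "\<dots> = (\<Sum>s\<in>?G. \<Sum>h\<in>?G. \<bar>\<Sum>w\<in>U. R (s \<otimes> h \<otimes> inv s \<otimes> w)\<bar>)" by (rule sum.swap)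
    also have "\<dots> = (\<Sum>s\<in>?G. \<Sum>h\<in>?G. \<bar>\<Sum>w\<in>U. R (h \<otimes> w)\<bar>)"
      by (intro sum.cong refl sum_conj[where f="\<lambda>h. \<bar>\<Sum>w\<in>U. R (h \<otimes> w)\<bar>"])
    also have "\<dots> = N * (\<Sum>h\<in>?G. \<bar>\<Sum>w\<in>U. R (h \<otimes> w)\<bar>)" by (simp add: N_def)
    also have "\<dots> \<le> N * (\<beta> * N * m)"
      using small N unfolding N_def m_def by (intro mult_left_mono) auto
    finally show ?thesis by (simp add: power2_eq_square ac_simps)
  qed
  have psi_l1: "(m - 1) * (\<Sum>h\<in>?G. \<bar>?\<psi> h\<bar>) \<le> N^2 * (1 + \<beta> * m)"
  proof -
    have "(m - 1) * (\<Sum>h\<in>?G. \<bar>?\<psi> h\<bar>) = (\<Sum>h\<in>?G. \<bar>(m - 1) * ?\<psi> h\<bar>)"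
      using m2 by (simp add: sum_distrib_left abs_mult)
    also have "\<dots> \<le> (\<Sum>h\<in>?G. N + \<bar>\<Sum>w\<in>U. conj_avg R w h\<bar>)"
    proof (rule sum_mono)
      fix h assume h: "h \<in> ?G"
      have "\<bar>N * R h\<bar> \<le> N" using R1[OF h] N by (simp add: abs_mult)
      then show "\<bar>(m - 1) * ?\<psi> h\<bar> \<le> N + \<bar>\<Sum>w\<in>U. conj_avg R w h\<bar>" unfolding psi_sum[OF h] by linarith
    qed
    also have "\<dots> \<le> N * N + \<beta> * N^2 * m" using sumU by (simp add: sum.distrib N_def)
    finally show ?thesis by (simp add: power2_eq_square algebra_simps)
  qed
  have corr: "(\<Sum>h\<in>?G. \<Sum>t\<in>?G. R (h \<otimes> (w1 \<otimes> t \<otimes> inv w1)) * R (h \<otimes> (w2 \<otimes> t \<otimes> inv w2))) \<le>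
      (if w1 = w2 then N^2 else N^2 * (1 + \<beta> * m) / (m - 1))"
    if w: "w1 \<in> U" "w2 \<in> U" for w1 w2
  proof (cases "w1 = w2")
    case True
    have "(\<Sum>h\<in>?G. \<Sum>t\<in>?G. R (h \<otimes> (w1 \<otimes> t \<otimes> inv w1)) * R (h \<otimes> (w2 \<otimes> t \<otimes> inv w2))) \<le> (\<Sum>h\<in>?G. \<Sum>t\<in>?G. 1)"
    proof (intro sum_mono)
      fix h t assume ht: "h \<in> ?G" "t \<in> ?G"
      have "w1 \<in> ?G" using w U_sub by auto
      then have "\<bar>R (h \<otimes> (w1 \<otimes> t \<otimes> inv w1))\<bar> \<le> 1" using ht by (intro R1) auto
      then have "\<bar>R (h \<otimes> (w1 \<otimes> t \<otimes> inv w1)) * R (h \<otimes> (w2 \<otimes> t \<otimes> inv w2))\<bar> \<le> 1"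
        unfolding abs_mult True[symmetric] by (intro mult_le_one) auto
      then show "R (h \<otimes> (w1 \<otimes> t \<otimes> inv w1)) * R (h \<otimes> (w2 \<otimes> t \<otimes> inv w2)) \<le> 1" by linarith
    qed
    then show ?thesis using True by (simp add: N_def power2_eq_square)
  next
    case False
    have wc: "w1 \<in> ?G" "w2 \<in> ?G" using w U_sub by auto
    define w' where "w' = inv w2 \<otimes> w1"
    have w'U: "w' \<in> U" unfolding w'_def using U w by (auto intro: subgroup.m_closed subgroup.m_inv_closed)
    have w'1: "w' \<noteq> \<one>" using False wc unfolding w'_def by (metis inv_equality inv_inv inv_closed)
    have w'c: "w' \<in> ?G" using w'U U_sub by auto
    have "N * (\<Sum>h\<in>?G. \<Sum>t\<in>?G. R (h \<otimes> (w1 \<otimes> t \<otimes> inv w1)) * R (h \<otimes> (w2 \<otimes> t \<otimes> inv w2))) = (\<Sum>h\<in>?G. (conj_avg R w' h)\<^sup>2)"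
      unfolding sum_correlation[OF R wc] sum_conj_avg_square[OF R w'c] by (simp add: w'_def N_def)
    \<comment> \<open>Every nontrivial \<open>w'\<close> has the same second moment. Of its two
      factors, one is bounded by \<open>N\<close>, the other in mean by
      \<open>psi_l1\<close>.\<close>
    also have "\<dots> = (\<Sum>h\<in>?G. (?\<psi> h)\<^sup>2)" using psi_conj[OF w'U w'1] by simp
    also have "\<dots> \<le> (\<Sum>h\<in>?G. N * \<bar>?\<psi> h\<bar>)"
    proof (rule sum_mono)
      fix h assume h: "h \<in> ?G"
      have "(?\<psi> h)\<^sup>2 = \<bar>?\<psi> h\<bar> * \<bar>?\<psi> h\<bar>" by (simp add: power2_eq_square)
      also have "\<dots> \<le> N * \<bar>?\<psi> h\<bar>" using psi_le[OF h w0] by (intro mult_right_mono) auto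
      finally show "(?\<psi> h)\<^sup>2 \<le> N * \<bar>?\<psi> h\<bar>" .
    qed
    also have "\<dots> = N * (\<Sum>h\<in>?G. \<bar>?\<psi> h\<bar>)" by (simp add: sum_distrib_left)
    also have "\<dots> \<le> N * (N^2 * (1 + \<beta> * m) / (m - 1))"
      using psi_l1 m2 N by (intro mult_left_mono) (auto simp: field_simps)
    finally show ?thesis using N False by (simp add: mult_le_cancel_left_pos del: times_divide_eq_right)
  qed
  have K2: "(\<Sum>h\<in>?G. \<Sum>t\<in>?G. (K h t)\<^sup>2) \<le> m * N^2 * (2 + \<beta> * m)"
  proof -
    have "(\<Sum>h\<in>?G. \<Sum>t\<in>?G. (K h t)\<^sup>2) = (\<Sum>h\<in>?G. \<Sum>t\<in>?G. \<Sum>w1\<in>U. \<Sum>w2\<in>U.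
        R (h \<otimes> (w1 \<otimes> t \<otimes> inv w1)) * R (h \<otimes> (w2 \<otimes> t \<otimes> inv w2)))"
      unfolding K_def power2_eq_square sum_product ..
    also have "\<dots> = (\<Sum>w1\<in>U. \<Sum>w2\<in>U. \<Sum>h\<in>?G. \<Sum>t\<in>?G.
        R (h \<otimes> (w1 \<otimes> t \<otimes> inv w1)) * R (h \<otimes> (w2 \<otimes> t \<otimes> inv w2)))"
      by (simp add: sum.swap[of _ U ?G])
    also have "\<dots> \<le> (\<Sum>w1\<in>U. \<Sum>w2\<in>U. if w1 = w2 then N^2 else N^2 * (1 + \<beta> * m) / (m - 1))"
      by (intro sum_mono corr)
    also have "\<dots> = (\<Sum>w1\<in>U. N^2 + (m - 1) * (N^2 * (1 + \<beta> * m) / (m - 1)))"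
    proof (rule sum.cong[OF refl])
      fix w1 assume w1: "w1 \<in> U"
      have "(\<Sum>w2\<in>U. if w1 = w2 then N^2 else N^2 * (1 + \<beta> * m) / (m - 1)) =
          N^2 + (\<Sum>w2\<in>U-{w1}. if w1 = w2 then N^2 else N^2 * (1 + \<beta> * m) / (m - 1))"
        using finU w1 by (subst sum.remove[of _ w1]) auto
      also have "(\<Sum>w2\<in>U-{w1}. if w1 = w2 then N^2 else N^2 * (1 + \<beta> * m) / (m - 1)) =
           (\<Sum>w2\<in>U-{w1}. N^2 * (1 + \<beta> * m) / (m - 1))"
        by (intro sum.cong) auto
      also have "\<dots> = (m - 1) * (N^2 * (1 + \<beta> * m) / (m - 1))"
        using w1 finU U2 unfolding m_def by (simp add: of_nat_diff)
      finally show "(\<Sum>w2\<in>U. if w1 = w2 then N^2 else N^2 * (1 + \<beta> * m) / (m - 1)) =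
          N^2 + (m - 1) * (N^2 * (1 + \<beta> * m) / (m - 1))" .
    qed
    also have "\<dots> = m * (N^2 + N^2 * (1 + \<beta> * m))" using m2 by (simp add: m_def)
    finally show ?thesis by (simp add: algebra_simps)
  qed
  have \<beta>0: "0 \<le> \<beta>"
  proof -
    have "0 \<le> (\<Sum>h\<in>?G. \<bar>\<Sum>w\<in>U. R (h \<otimes> w)\<bar>)" by (intro sum_nonneg) auto
    then have "0 \<le> \<beta> * N * m" using small unfolding N_def m_def by linarith
    then show ?thesis using N m2 by (simp add: zero_le_mult_iff)
  qed
  have A0: "0 \<le> A" "0 \<le> B" using aA[OF one_closed] bB[OF one_closed] by linarith+
  have K1: "(\<Sum>h\<in>?G. \<Sum>t\<in>?G. \<bar>K h t\<bar>) \<le> m * N^2 * sqrt (\<beta> + 2 / m)"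
  proof -
    \<comment> \<open>Cauchy-Schwarz in the form \<open>|K| <= K^2 / (2 l) + l / 2\<close>;
      \<open>l\<close> is the bound for the root mean square of \<open>K\<close>, which balances the
      two terms.\<close>
    define l where "l = m * sqrt (\<beta> + 2 / m)"
    have l: "l > 0" using m2 \<beta>0 unfolding l_def by (intro mult_pos_pos) (auto intro: add_nonneg_pos)
    have l2: "l\<^sup>2 = m * (2 + \<beta> * m)"
      using m2 \<beta>0 unfolding l_def power_mult_distrib by (simp add: field_simps power2_eq_square)
    have le: "\<bar>K h t\<bar> \<le> (K h t)\<^sup>2 / (2 * l) + l / 2" for h t
    proof -
      have "0 \<le> (\<bar>K h t\<bar> - l)\<^sup>2" by simp
      then show ?thesis using l by (simp add: power2_diff field_simps power2_eq_square)
    qed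
    have "(\<Sum>h\<in>?G. \<Sum>t\<in>?G. \<bar>K h t\<bar>) \<le> (\<Sum>h\<in>?G. \<Sum>t\<in>?G. (K h t)\<^sup>2 / (2 * l) + l / 2)"
      by (intro sum_mono le)
    also have "\<dots> = (\<Sum>h\<in>?G. \<Sum>t\<in>?G. (K h t)\<^sup>2) / (2 * l) + N^2 * l / 2"
      by (simp add: sum.distrib sum_divide_distrib N_def power2_eq_square)
    also have "\<dots> \<le> N^2 * l\<^sup>2 / (2 * l) + N^2 * l / 2"
      using K2 l unfolding l2 by (intro add_right_mono divide_right_mono) (auto simp: ac_simps)
    also have "\<dots> = N^2 * l" using l by (simp add: power2_eq_square)
    finally show ?thesis unfolding l_def by (simp add: ac_simps)
  qed
  define S where "S = (\<Sum>h\<in>?G. \<Sum>t\<in>?G. a h * b t * R (h \<otimes> t))"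
  have "m * S = (\<Sum>w\<in>U. S)" by (simp add: m_def)
  also have "\<dots> = (\<Sum>w\<in>U. \<Sum>h\<in>?G. \<Sum>t\<in>?G. a h * b t * R (h \<otimes> (w \<otimes> t \<otimes> inv w)))"
  proof (rule sum.cong[OF refl])
    fix w assume "w \<in> U"
    then have w: "w \<in> ?G" using U_sub by auto
    have "(\<Sum>t\<in>?G. a h * b t * R (h \<otimes> t)) = (\<Sum>t\<in>?G. a h * b t * R (h \<otimes> (w \<otimes> t \<otimes> inv w)))" for h
    proof -
      have "(\<Sum>t\<in>?G. a h * b t * R (h \<otimes> t)) =
          (\<Sum>t\<in>?G. a h * b (w \<otimes> t \<otimes> inv w) * R (h \<otimes> (w \<otimes> t \<otimes> inv w)))"
        by (rule sum_conj[OF w, symmetric])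
      then show ?thesis by (simp add: class_functionD[OF b _ w])
    qed
    then show "S = (\<Sum>h\<in>?G. \<Sum>t\<in>?G. a h * b t * R (h \<otimes> (w \<otimes> t \<otimes> inv w)))" unfolding S_def by simp
  qed
  also have "\<dots> = (\<Sum>h\<in>?G. \<Sum>t\<in>?G. a h * b t * K h t)"
    unfolding K_def by (simp add: sum.swap[of _ U ?G] sum_distrib_left)
  finally have "\<bar>m * S\<bar> = \<bar>\<Sum>h\<in>?G. \<Sum>t\<in>?G. a h * b t * K h t\<bar>" by (rule arg_cong)
  also have "\<dots> \<le> (\<Sum>h\<in>?G. \<Sum>t\<in>?G. \<bar>a h * b t * K h t\<bar>)"
    by (rule order_trans[OF sum_abs sum_mono[OF sum_abs]])
  also have "\<dots> \<le> (\<Sum>h\<in>?G. \<Sum>t\<in>?G. (A * B) * \<bar>K h t\<bar>)"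
    unfolding abs_mult using aA bB A0 by (intro sum_mono mult_right_mono mult_mono) auto
  also have "\<dots> = A * B * (\<Sum>h\<in>?G. \<Sum>t\<in>?G. \<bar>K h t\<bar>)" by (simp add: sum_distrib_left)
  also have "\<dots> \<le> A * B * (m * N^2 * sqrt (\<beta> + 2 / m))" using K1 A0 by (intro mult_left_mono) auto
  finally have "m * \<bar>S\<bar> \<le> m * (A * B * N^2 * sqrt (\<beta> + 2 / m))" using m2 by (simp add: abs_mult ac_simps)
  then have "\<bar>S\<bar> \<le> A * B * N^2 * sqrt (\<beta> + 2 / m)" using m2 by simp
  then show ?thesis unfolding S_def N_def m_def .
qed

end

section \<open>Matrices and determinants over a commutative ring\<close>

lemma mat_over_carrier_iff:
  "A \<in> carrier (mat_over R n) \<longleftrightarrow>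
     dim_row A = n \<and> dim_col A = n \<and> (\<forall>i<n. \<forall>j<n. A $$ (i, j) \<in> carrier R)"
  unfolding mat_over_def carrier_mat_def elements_mat_def by (auto simp: image_subset_iff UN_subset_iff)

lemma mat_over_dim [simp]:
  "A \<in> carrier (mat_over R n) \<Longrightarrow> dim_row A = n" "A \<in> carrier (mat_over R n) \<Longrightarrow> dim_col A = n"
  by (simp_all only: mat_over_carrier_iff)

lemma mat_over_entry [simp, intro]:
  "A \<in> carrier (mat_over R n) \<Longrightarrow> i < n \<Longrightarrow> j < n \<Longrightarrow> A $$ (i, j) \<in> carrier R"
  by (simp only: mat_over_carrier_iff)

lemma mat_over_eqI:
  assumes "A \<in> carrier (mat_over R n)" "B \<in> carrier (mat_over R n)"
    and "\<And>i j. i < n \<Longrightarrow> j < n \<Longrightarrow> A $$ (i, j) = B $$ (i, j)"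
  shows "A = B"
  using assms by (intro eq_matI) auto

lemma mat_in_mat_over:
  "(\<And>i j. i < n \<Longrightarrow> j < n \<Longrightarrow> f (i, j) \<in> carrier R) \<Longrightarrow> mat n n f \<in> carrier (mat_over R n)"
  by (auto simp: mat_over_carrier_iff)

lemma mat_over_mult_def:
  "A \<otimes>\<^bsub>mat_over R n\<^esub> B = mat n n (\<lambda>(i, j). \<Oplus>\<^bsub>R\<^esub>l\<in>{..<n}. A $$ (i, l) \<otimes>\<^bsub>R\<^esub> B $$ (l, j))"
  by (simp add: mat_over_def)

lemma mat_over_one_def:
  "\<one>\<^bsub>mat_over R n\<^esub> = mat n n (\<lambda>(i, j). if i = j then \<one>\<^bsub>R\<^esub> else \<zero>\<^bsub>R\<^esub>)"
  by (simp add: mat_over_def)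

lemma mat_over_mult_entry [simp]:
  "i < n \<Longrightarrow> j < n \<Longrightarrow>
    (A \<otimes>\<^bsub>mat_over R n\<^esub> B) $$ (i, j) = (\<Oplus>\<^bsub>R\<^esub>l\<in>{..<n}. A $$ (i, l) \<otimes>\<^bsub>R\<^esub> B $$ (l, j))"
  by (simp add: mat_over_mult_def)

lemma mat_over_one_entry [simp]:
  "i < n \<Longrightarrow> j < n \<Longrightarrow> \<one>\<^bsub>mat_over R n\<^esub> $$ (i, j) = (if i = j then \<one>\<^bsub>R\<^esub> else \<zero>\<^bsub>R\<^esub>)"
  by (simp add: mat_over_one_def)

text \<open>Outside \<open>I\<close> the functions are the identity rather than
  \<open>undefined\<close>; with \<open>J = I\<close> the injective ones are then exactly the
  permutations in the sense of \<open>permutes\<close>.\<close>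

definition funs_into :: "'i set \<Rightarrow> 'i set \<Rightarrow> ('i \<Rightarrow> 'i) set" where
  "funs_into I J = {f. (\<forall>i\<in>I. f i \<in> J) \<and> (\<forall>i. i \<notin> I \<longrightarrow> f i = i)}"

lemma funs_into_empty: "funs_into {} J = {id}"
  by (auto simp: funs_into_def)

lemma funs_into_insert:
  "a \<notin> I \<Longrightarrow> funs_into (insert a I) J = (\<lambda>(j, f). f(a := j)) ` (J \<times> funs_into I J)"
proof (intro equalityI subsetI)
  fix f assume a: "a \<notin> I" and f: "f \<in> funs_into (insert a I) J"
  have "f(a := a) \<in> funs_into I J" "f a \<in> J" using f a by (auto simp: funs_into_def)
  then show "f \<in> (\<lambda>(j, f). f(a := j)) ` (J \<times> funs_into I J)"
    by (intro image_eqI[where x = "(f a, f(a := a))"]) auto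
qed (auto simp: funs_into_def)

lemma funs_into_insert_inj:
  "a \<notin> I \<Longrightarrow> inj_on (\<lambda>(j, f). f(a := j)) (J \<times> funs_into I J)"
proof (rule inj_onI, clarify)
  fix j f j' f' assume a: "a \<notin> I" and f: "f \<in> funs_into I J" "f' \<in> funs_into I J"
    and eq: "f(a := j) = f'(a := j')"
  have "f x = f' x" for x
    using fun_cong[OF eq, of x] f a by (cases "x = a") (auto simp: funs_into_def)
  moreover have "j = j'" using fun_cong[OF eq, of a] by simp
  ultimately show "j = j' \<and> f = f'" by auto
qed

lemma finite_funs_into: "finite I \<Longrightarrow> finite J \<Longrightarrow> finite (funs_into I J)"
  by (induction I rule: finite_induct) (auto simp: funs_into_empty funs_into_insert)

lemma funs_into_inj_permutes:
  assumes "finite I"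
  shows "{f \<in> funs_into I I. inj_on f I} = {f. f permutes I}"
proof (intro equalityI subsetI)
  fix f assume f: "f \<in> {f \<in> funs_into I I. inj_on f I}"
  have "f ` I = I" using f assms by (intro endo_inj_surj) (auto simp: funs_into_def)
  then have "bij_betw f I I" using f by (auto simp: bij_betw_def)
  then have "f permutes I" by (rule bij_imp_permutes) (use f in \<open>auto simp: funs_into_def\<close>)
  then show "f \<in> {f. f permutes I}" by simp
next
  fix f assume "f \<in> {f. f permutes I}"
  then have f: "f permutes I" by simp
  then show "f \<in> {f \<in> funs_into I I. inj_on f I}"
    by (auto simp: funs_into_def permutes_in_image permutes_not_in permutes_inj_on)
qed

section \<open>Leibniz determinants and their multiplicativity\<close>

context cring
begin

lemma finsum_cartesian:
  assumes "finite A" "finite B" and f: "\<And>a b. a \<in> A \<Longrightarrow> b \<in> B \<Longrightarrow> f a b \<in> carrier R"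
  shows "(\<Oplus>p\<in>A \<times> B. f (fst p) (snd p)) = (\<Oplus>a\<in>A. \<Oplus>b\<in>B. f a b)"
  using assms(1) f
proof (induction A rule: finite_induct)
  case empty then show ?case by simp
next
  case (insert a A)
  have "(\<Oplus>p\<in>insert a A \<times> B. f (fst p) (snd p)) =
      (\<Oplus>p\<in>({a} \<times> B) \<union> (A \<times> B). f (fst p) (snd p))"
    by (rule arg_cong[where f="\<lambda>S. finsum R _ S"]) auto
  also have "\<dots> = (\<Oplus>p\<in>{a} \<times> B. f (fst p) (snd p)) \<oplus> (\<Oplus>p\<in>A \<times> B. f (fst p) (snd p))"
    using insert assms(2) by (intro finsum_Un_disjoint) auto
  also have "(\<Oplus>p\<in>{a} \<times> B. f (fst p) (snd p)) = (\<Oplus>p\<in>Pair a ` B. f (fst p) (snd p))"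
    by (rule arg_cong[where f="\<lambda>S. finsum R _ S"]) auto
  also have "\<dots> = (\<Oplus>b\<in>B. f a b)"
    using insert by (subst finsum_reindex) (auto simp: inj_on_def)
  also have "(\<Oplus>p\<in>A \<times> B. f (fst p) (snd p)) = (\<Oplus>a\<in>A. \<Oplus>b\<in>B. f a b)"
    using insert by auto
  finally show ?case using insert by simp
qed

lemma finsum_swap:
  assumes "finite A" "finite B" and f: "\<And>a b. a \<in> A \<Longrightarrow> b \<in> B \<Longrightarrow> f a b \<in> carrier R"
  shows "(\<Oplus>a\<in>A. \<Oplus>b\<in>B. f a b) = (\<Oplus>b\<in>B. \<Oplus>a\<in>A. f a b)"
proof -
  have "(\<Oplus>a\<in>A. \<Oplus>b\<in>B. f a b) = (\<Oplus>p\<in>A \<times> B. f (fst p) (snd p))"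
    using assms by (intro finsum_cartesian[symmetric]) auto
  also have "\<dots> = (\<Oplus>p\<in>prod.swap ` (B \<times> A). f (fst p) (snd p))" by (simp only: product_swap)
  also have "\<dots> = (\<Oplus>p\<in>B \<times> A. f (snd p) (fst p))"
    using assms by (subst finsum_reindex) auto
  also have "\<dots> = (\<Oplus>b\<in>B. \<Oplus>a\<in>A. f a b)"
    using assms by (intro finsum_cartesian[where f="\<lambda>b a. f a b"]) auto
  finally show ?thesis .
qed

text \<open>Needed to expand the product over the rows of the entries of a matrix product.\<close>

lemma finprod_finsum:
  assumes "finite I" "finite J" and f: "\<And>i j. i \<in> I \<Longrightarrow> j \<in> J \<Longrightarrow> f i j \<in> carrier R"
  shows "(\<Otimes>i\<in>I. \<Oplus>j\<in>J. f i j) = (\<Oplus>g\<in>funs_into I J. \<Otimes>i\<in>I. f i (g i))"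
  using assms(1) f
proof (induction I rule: finite_induct)
  case empty then show ?case by (simp add: funs_into_empty)
next
  case (insert a I)
  note fin = finite_funs_into[OF insert(1) assms(2)]
  have g: "g i \<in> J" if "g \<in> funs_into I J" "i \<in> I" for g i using that by (auto simp: funs_into_def)
  have pc: "(\<Otimes>i\<in>I. f i (g i)) \<in> carrier R" if "g \<in> funs_into I J" for g
    using insert g[OF that] by (intro finprod_closed) auto
  have "(\<Otimes>i\<in>insert a I. \<Oplus>j\<in>J. f i j) = (\<Oplus>j\<in>J. f a j) \<otimes> (\<Otimes>i\<in>I. \<Oplus>j\<in>J. f i j)"
    using insert by (intro finprod_insert) auto
  also have "\<dots> = (\<Oplus>j\<in>J. f a j) \<otimes> (\<Oplus>g\<in>funs_into I J. \<Otimes>i\<in>I. f i (g i))"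
    using insert by simp
  also have "\<dots> = (\<Oplus>j\<in>J. f a j \<otimes> (\<Oplus>g\<in>funs_into I J. \<Otimes>i\<in>I. f i (g i)))"
    using insert pc assms(2) by (intro finsum_ldistr) auto
  also have "\<dots> = (\<Oplus>j\<in>J. \<Oplus>g\<in>funs_into I J. f a j \<otimes> (\<Otimes>i\<in>I. f i (g i)))"
    using insert pc fin by (intro finsum_cong' refl finsum_rdistr) auto
  also have "\<dots> = (\<Oplus>p\<in>J \<times> funs_into I J. f a (fst p) \<otimes> (\<Otimes>i\<in>I. f i (snd p i)))"
    using insert pc fin assms(2)
    by (intro finsum_cartesian[symmetric, where f="\<lambda>j g. f a j \<otimes> (\<Otimes>i\<in>I. f i (g i))"]) auto
  also have "\<dots> = (\<Oplus>p\<in>J \<times> funs_into I J. \<Otimes>i\<in>insert a I. f i (((\<lambda>(j, f). f(a := j)) p) i))"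
  proof (intro finsum_cong' refl)
    fix p assume p: "p \<in> J \<times> funs_into I J"
    have *: "(\<Otimes>i\<in>I. f i (((snd p)(a := fst p)) i)) = (\<Otimes>i\<in>I. f i (snd p i))"
      using insert p g by (intro finprod_cong') (auto simp: mem_Times_iff)
    show "f a (fst p) \<otimes> (\<Otimes>i\<in>I. f i (snd p i)) =
        (\<Otimes>i\<in>insert a I. f i (((\<lambda>(j, f). f(a := j)) p) i))"
      using insert p g by (subst finprod_insert) (auto simp: case_prod_unfold mem_Times_iff * simp del: fun_upd_apply, auto)
  qed (use insert g in \<open>auto intro!: finprod_closed\<close>)
  also have "\<dots> = (\<Oplus>h\<in>funs_into (insert a I) J. \<Otimes>i\<in>insert a I. f i (h i))"
    unfolding funs_into_insert[OF insert(2)]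
    using insert g by (subst finsum_reindex[OF _ funs_into_insert_inj[OF insert(2)]])
       (auto intro!: finprod_closed)
  finally show ?case .
qed

definition psgn :: "(nat \<Rightarrow> nat) \<Rightarrow> 'a" where
  "psgn p = (if evenperm p then \<one> else \<ominus> \<one>)"

lemma psgn_closed [simp]: "psgn p \<in> carrier R"
  by (simp add: psgn_def)

lemma psgn_comp:
  assumes "p permutes {..<n}" "q permutes {..<n}"
  shows "psgn (p \<circ> q) = psgn p \<otimes> psgn q"
proof -
  have "permutation p" "permutation q" using assms by (auto intro: permutation_permutes[THEN iffD2])
  from evenperm_comp[OF this] show ?thesis by (auto simp: psgn_def l_minus)
qed

lemma det_over_psgn:
  assumes A: "A \<in> carrier (mat_over R n)"
  shows "det_over R A = (\<Oplus>p\<in>{p. p permutes {..<n}}. psgn p \<otimes> (\<Otimes>i\<in>{..<n}. A $$ (i, p i)))"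
proof -
  have pc: "(\<Otimes>i\<in>{..<n}. A $$ (i, p i)) \<in> carrier R" if "p permutes {..<n}" for p
    using A permutes_in_image[OF that] by (intro finprod_closed) auto
  show ?thesis unfolding det_over_def Let_def using A pc
    by (auto simp: psgn_def l_minus intro!: finsum_cong')
qed

lemma permutes_prod_closed:
  assumes A: "A \<in> carrier (mat_over R n)" and p: "p permutes {..<n}"
    and f: "\<And>i. i < n \<Longrightarrow> f i < n"
  shows "(\<Otimes>i\<in>{..<n}. A $$ (f i, p i)) \<in> carrier R"
  using A f permutes_in_image[OF p] by (intro finprod_closed) auto

lemma det_over_closed [simp, intro]:
  assumes A: "A \<in> carrier (mat_over R n)"
  shows "det_over R A \<in> carrier R"
  unfolding det_over_psgn[OF A] using permutes_prod_closed[OF A, where f="\<lambda>i. i"]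
  by (intro finsum_closed) auto

text \<open>Reindexing by composition with \<open>f\<close> brings the rows back into order and
  costs the sign of \<open>f\<close>.\<close>

lemma det_rows_perm:
  assumes B: "B \<in> carrier (mat_over R n)" and f: "f permutes {..<n}"
  shows "(\<Oplus>p\<in>{p. p permutes {..<n}}. psgn p \<otimes> (\<Otimes>i\<in>{..<n}. B $$ (f i, p i))) =
     psgn f \<otimes> det_over R B"
proof -
  let ?P = "{p. p permutes {..<n}}"
  have fl: "i < n \<Longrightarrow> f i < n" for i using permutes_in_image[OF f] by auto
  have img: "(\<lambda>p. p \<circ> f) ` ?P = ?P"
  proof (intro equalityI subsetI)
    fix p assume "p \<in> ?P"
    then show "p \<in> (\<lambda>p. p \<circ> f) ` ?P" using f
      by (intro image_eqI[where x="p \<circ> inv_into UNIV f"])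
         (auto simp: o_assoc[symmetric] permutes_inv_o permutes_inv permutes_compose)
  qed (use f in \<open>auto intro: permutes_compose\<close>)
  have inj: "inj_on (\<lambda>p. p \<circ> f) ?P"
    using f by (auto simp: inj_on_def fun.inj_map_strong) (metis comp_assoc comp_id permutes_inv_o(1))
  have "(\<Oplus>p\<in>?P. psgn p \<otimes> (\<Otimes>i\<in>{..<n}. B $$ (f i, p i))) =
     (\<Oplus>p\<in>(\<lambda>p. p \<circ> f) ` ?P. psgn p \<otimes> (\<Otimes>i\<in>{..<n}. B $$ (f i, p i)))" unfolding img ..
  also have "\<dots> = (\<Oplus>p\<in>?P. psgn (p \<circ> f) \<otimes> (\<Otimes>i\<in>{..<n}. B $$ (f i, (p \<circ> f) i)))"
    using permutes_prod_closed[OF B _ fl] img by (intro finsum_reindex inj) auto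
  also have "\<dots> = (\<Oplus>p\<in>?P. psgn f \<otimes> (psgn p \<otimes> (\<Otimes>i\<in>{..<n}. B $$ (i, p i))))"
  proof (intro finsum_cong' refl)
    fix p assume "p \<in> ?P" then have p: "p permutes {..<n}" by simp
    have "(\<Otimes>i\<in>{..<n}. B $$ (i, p i)) = (\<Otimes>i\<in>f ` {..<n}. B $$ (i, p i))"
      using permutes_image[OF f] by simp
    also have "\<dots> = (\<Otimes>i\<in>{..<n}. B $$ (f i, (p \<circ> f) i))"
      unfolding o_def using permutes_inj_on[OF f] permutes_image[OF f] B permutes_in_image[OF p]
      by (subst finprod_reindex) auto
    finally have eq: "(\<Otimes>i\<in>{..<n}. B $$ (f i, (p \<circ> f) i)) = (\<Otimes>i\<in>{..<n}. B $$ (i, p i))" ..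
    show "psgn (p \<circ> f) \<otimes> (\<Otimes>i\<in>{..<n}. B $$ (f i, (p \<circ> f) i)) =
        psgn f \<otimes> (psgn p \<otimes> (\<Otimes>i\<in>{..<n}. B $$ (i, p i)))"
      unfolding eq psgn_comp[OF p f] using permutes_prod_closed[OF B p, of "\<lambda>i. i"] by (simp add: m_ac)
  qed (use permutes_prod_closed[OF B, of _ "\<lambda>i. i"] in auto)
  also have "\<dots> = psgn f \<otimes> det_over R B"
    unfolding det_over_psgn[OF B]
    using permutes_prod_closed[OF B, of _ "\<lambda>i. i"] finite_permutations[of "{..<n}"]
    by (intro finsum_rdistr[symmetric]) auto
  finally show ?thesis .
qed

text \<open>Composition with the transposition of two equal rows pairs even with odd permutations.\<close>

lemma det_rows_equal:
  assumes B: "B \<in> carrier (mat_over R n)" and f: "\<And>i. i < n \<Longrightarrow> f i < n"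
    and ab: "a < n" "b < n" "a \<noteq> b" "f a = f b"
  shows "(\<Oplus>p\<in>{p. p permutes {..<n}}. psgn p \<otimes> (\<Otimes>i\<in>{..<n}. B $$ (f i, p i))) = \<zero>"
proof -
  let ?P = "{p. p permutes {..<n}}"
  let ?E = "{p. p permutes {..<n} \<and> evenperm p}" and ?O = "{p. p permutes {..<n} \<and> \<not> evenperm p}"
  let ?t = "transpose a b"
  let ?X = "\<lambda>p. \<Otimes>i\<in>{..<n}. B $$ (f i, p i)"
  have t: "?t permutes {..<n}" using ab by (intro permutes_swap_id) auto
  have X: "?X p \<in> carrier R" if "p permutes {..<n}" for p
    using permutes_prod_closed[OF B that f] by auto
  have fin: "finite ?E" "finite ?O"
    by (rule finite_subset[OF _ finite_permutations[of "{..<n}"]]; auto)+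
  have even_t: "evenperm (p \<circ> ?t) \<longleftrightarrow> \<not> evenperm p" if "p permutes {..<n}" for p
    using evenperm_comp[of p ?t] permutation_permutes[THEN iffD2, of p] permutation_permutes[THEN iffD2, of ?t] that t
    by (auto simp: evenperm_swap ab)
  have XT: "?X (p \<circ> ?t) = ?X p" if p: "p permutes {..<n}" for p
  proof -
    have ft: "f (?t i) = f i" for i using ab(4) by (simp add: transpose_def)
    have "?X p = (\<Otimes>i\<in>?t ` {..<n}. B $$ (f i, p i))" using permutes_image[OF t] by simp
    also have "\<dots> = (\<Otimes>i\<in>{..<n}. B $$ (f (?t i), p (?t i)))"
      using permutes_inj_on[OF t] permutes_image[OF t] B f permutes_in_image[OF p] by (subst finprod_reindex) auto
    finally show ?thesis by (simp add: ft)
  qed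
  have tt: "p \<circ> ?t \<circ> ?t = p" for p :: "nat \<Rightarrow> nat" by (simp add: o_assoc[symmetric])
  have img: "(\<lambda>p. p \<circ> ?t) ` ?E = ?O"
  proof (intro equalityI subsetI)
    fix p assume "p \<in> ?O"
    then show "p \<in> (\<lambda>p. p \<circ> ?t) ` ?E"
      using t even_t by (intro image_eqI[where x="p \<circ> ?t"]) (auto simp: tt permutes_compose)
  qed (use t even_t in \<open>auto intro: permutes_compose\<close>)
  have inj: "inj_on (\<lambda>p. p \<circ> ?t) ?E" by (rule inj_onI) (metis tt)
  have "(\<Oplus>p\<in>?P. psgn p \<otimes> ?X p) = (\<Oplus>p\<in>?E \<union> ?O. psgn p \<otimes> ?X p)"
    by (rule arg_cong[where f="\<lambda>S. finsum R _ S"]) auto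
  also have "\<dots> = (\<Oplus>p\<in>?E. psgn p \<otimes> ?X p) \<oplus> (\<Oplus>p\<in>?O. psgn p \<otimes> ?X p)"
    using fin X by (intro finsum_Un_disjoint) auto
  also have "(\<Oplus>p\<in>?O. psgn p \<otimes> ?X p) = (\<Oplus>p\<in>?E. psgn (p \<circ> ?t) \<otimes> ?X (p \<circ> ?t))"
    unfolding img[symmetric] using X img by (intro finsum_reindex inj) auto
  also have "(\<Oplus>p\<in>?E. psgn p \<otimes> ?X p) \<oplus> (\<Oplus>p\<in>?E. psgn (p \<circ> ?t) \<otimes> ?X (p \<circ> ?t)) =
      (\<Oplus>p\<in>?E. psgn p \<otimes> ?X p \<oplus> psgn (p \<circ> ?t) \<otimes> ?X (p \<circ> ?t))"
    using X t by (intro finsum_addf[symmetric]) (auto simp: XT simp del: o_apply)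
  also have "\<dots> = (\<Oplus>p\<in>?E. \<zero>)"
    using X even_t XT by (intro finsum_cong') (auto simp: psgn_def l_minus r_neg simp del: o_apply)
  finally show ?thesis by simp
qed

lemma mat_over_mult_closed:
  assumes "A \<in> carrier (mat_over R n)" "B \<in> carrier (mat_over R n)"
  shows "A \<otimes>\<^bsub>mat_over R n\<^esub> B \<in> carrier (mat_over R n)"
  unfolding mat_over_mult_def using assms by (intro mat_in_mat_over) (auto intro!: finsum_closed)

text \<open>Each row of the product is a combination of rows of \<open>B\<close>, so the expansion
  runs over all functions \<open>f\<close> choosing one row of \<open>B\<close> for each row. If
  \<open>f\<close> is not injective, two chosen rows agree and the term vanishes; if
  \<open>f\<close> is a permutation, the term is the corresponding summand of
  \<open>det_over R A\<close> times \<open>det_over R B\<close>.\<close>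

theorem det_over_mult:
  assumes A: "A \<in> carrier (mat_over R n)" and B: "B \<in> carrier (mat_over R n)"
  shows "det_over R (A \<otimes>\<^bsub>mat_over R n\<^esub> B) = det_over R A \<otimes> det_over R B"
proof -
  let ?P = "{p. p permutes {..<n}}" and ?F = "funs_into {..<n} {..<n}"
  have F: "f i < n" if "f \<in> ?F" "i < n" for f i using that by (auto simp: funs_into_def)
  have finP: "finite ?P" and finF: "finite ?F" by (auto intro: finite_permutations finite_funs_into)
  have PF: "?P \<subseteq> ?F" using funs_into_inj_permutes[of "{..<n}"] by auto
  let ?a = "\<lambda>f. \<Otimes>i\<in>{..<n}. A $$ (i, f i)"
  let ?b = "\<lambda>f p. \<Otimes>i\<in>{..<n}. B $$ (f i, p i)"
  have a: "?a f \<in> carrier R" if "f \<in> ?F" for f using A F[OF that] by (intro finprod_closed) auto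
  have b: "?b f p \<in> carrier R" if "f \<in> ?F" "p \<in> ?P" for f p
    using that permutes_prod_closed[OF B _ F[OF that(1)]] by auto
  have "det_over R (A \<otimes>\<^bsub>mat_over R n\<^esub> B) =
     (\<Oplus>p\<in>?P. psgn p \<otimes> (\<Otimes>i\<in>{..<n}. \<Oplus>l\<in>{..<n}. A $$ (i, l) \<otimes> B $$ (l, p i)))"
    unfolding det_over_psgn[OF mat_over_mult_closed[OF A B]]
  proof (intro finsum_cong' refl)
    fix p assume p: "p \<in> ?P"
    show "psgn p \<otimes> (\<Otimes>i\<in>{..<n}. (A \<otimes>\<^bsub>mat_over R n\<^esub> B) $$ (i, p i)) =
      psgn p \<otimes> (\<Otimes>i\<in>{..<n}. \<Oplus>l\<in>{..<n}. A $$ (i, l) \<otimes> B $$ (l, p i))"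
      using p permutes_in_image[of p "{..<n}"] A B
      by (intro arg_cong[where f="\<lambda>x. psgn p \<otimes> x"] finprod_cong') (auto intro!: finsum_closed)
  qed (use A B permutes_in_image[of _ "{..<n}"] in \<open>auto intro!: finprod_closed finsum_closed\<close>)
  also have "\<dots> = (\<Oplus>p\<in>?P. \<Oplus>f\<in>?F. ?a f \<otimes> (psgn p \<otimes> ?b f p))"
  proof (intro finsum_cong' refl)
    fix p assume p: "p \<in> ?P"
    then have pl: "i < n \<Longrightarrow> p i < n" for i using permutes_in_image[of p "{..<n}"] by auto
    have "(\<Otimes>i\<in>{..<n}. \<Oplus>l\<in>{..<n}. A $$ (i, l) \<otimes> B $$ (l, p i)) =
        (\<Oplus>f\<in>?F. \<Otimes>i\<in>{..<n}. A $$ (i, f i) \<otimes> B $$ (f i, p i))"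
      using A B pl by (intro finprod_finsum) auto
    also have "\<dots> = (\<Oplus>f\<in>?F. ?a f \<otimes> ?b f p)"
      using A B pl F a b p by (intro finsum_cong' refl finprod_multf) auto
    finally have "psgn p \<otimes> (\<Otimes>i\<in>{..<n}. \<Oplus>l\<in>{..<n}. A $$ (i, l) \<otimes> B $$ (l, p i)) =
        psgn p \<otimes> (\<Oplus>f\<in>?F. ?a f \<otimes> ?b f p)" by simp
    also have "\<dots> = (\<Oplus>f\<in>?F. psgn p \<otimes> (?a f \<otimes> ?b f p))"
      using a b p finF by (intro finsum_rdistr) auto
    also have "\<dots> = (\<Oplus>f\<in>?F. ?a f \<otimes> (psgn p \<otimes> ?b f p))"
      using a b p by (intro finsum_cong' refl) (auto simp: m_lcomm)
    finally show "psgn p \<otimes> (\<Otimes>i\<in>{..<n}. \<Oplus>l\<in>{..<n}. A $$ (i, l) \<otimes> B $$ (l, p i)) =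
        (\<Oplus>f\<in>?F. ?a f \<otimes> (psgn p \<otimes> ?b f p))" .
  qed (use a b in \<open>auto intro!: finsum_closed\<close>)
  also have "\<dots> = (\<Oplus>f\<in>?F. \<Oplus>p\<in>?P. ?a f \<otimes> (psgn p \<otimes> ?b f p))"
    using a b finP finF by (intro finsum_swap) auto
  also have "\<dots> = (\<Oplus>f\<in>?F. ?a f \<otimes> (\<Oplus>p\<in>?P. psgn p \<otimes> ?b f p))"
    using a b finP by (intro finsum_cong' refl finsum_rdistr[symmetric]) (auto intro!: finsum_closed)
  also have "\<dots> = (\<Oplus>f\<in>?P. ?a f \<otimes> (\<Oplus>p\<in>?P. psgn p \<otimes> ?b f p))"
  proof (rule add.finprod_mono_neutral_cong_right[OF finF PF])
    fix f assume f: "f \<in> ?F - ?P"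
    then have "\<not> inj_on f {..<n}" using funs_into_inj_permutes[of "{..<n}"] by auto
    then obtain i j where ij: "i < n" "j < n" "i \<noteq> j" "f i = f j" by (auto simp: inj_on_def)
    have "(\<Oplus>p\<in>?P. psgn p \<otimes> ?b f p) = \<zero>" by (rule det_rows_equal[OF B _ ij]) (use F f in auto)
    then show "?a f \<otimes> (\<Oplus>p\<in>?P. psgn p \<otimes> ?b f p) = \<zero>" using a f by simp
  qed (use a b in \<open>auto intro!: finsum_closed\<close>)
  also have "\<dots> = (\<Oplus>f\<in>?P. (psgn f \<otimes> ?a f) \<otimes> det_over R B)"
  proof (intro finsum_cong' refl)
    fix f assume f: "f \<in> ?P"
    have "(\<Oplus>p\<in>?P. psgn p \<otimes> ?b f p) = psgn f \<otimes> det_over R B"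
      using f by (intro det_rows_perm[OF B]) auto
    then show "?a f \<otimes> (\<Oplus>p\<in>?P. psgn p \<otimes> ?b f p) = (psgn f \<otimes> ?a f) \<otimes> det_over R B"
      using a PF f B by (auto simp: m_ac subset_iff)
  qed (use a PF B in auto)
  also have "\<dots> = det_over R A \<otimes> det_over R B"
    unfolding det_over_psgn[OF A] using a PF B finP by (intro finsum_ldistr[symmetric]) auto
  finally show ?thesis .
qed

text \<open>Common core of the two triangular cases: every permutation other than the identity meets
  a zero entry.\<close>

lemma det_over_diag:
  assumes A: "A \<in> carrier (mat_over R n)"
    and z: "\<And>p. p permutes {..<n} \<Longrightarrow> p \<noteq> id \<Longrightarrow> \<exists>i<n. A $$ (i, p i) = \<zero>"
  shows "det_over R A = (\<Otimes>i\<in>{..<n}. A $$ (i, i))"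
proof -
  have pc: "psgn p \<otimes> (\<Otimes>i\<in>{..<n}. A $$ (i, p i)) \<in> carrier R" if "p permutes {..<n}" for p
    using permutes_prod_closed[OF A that, of "\<lambda>i. i"] by auto
  have "det_over R A = (\<Oplus>p\<in>{id}. psgn p \<otimes> (\<Otimes>i\<in>{..<n}. A $$ (i, p i)))"
    unfolding det_over_psgn[OF A]
  proof (rule add.finprod_mono_neutral_cong_right)
    show "finite {p. p permutes {..<n}}" by (rule finite_permutations) simp
    fix p assume "p \<in> {p. p permutes {..<n}} - {id}"
    then have p: "p permutes {..<n}" "p \<noteq> id" by auto
    then obtain i where i: "i < n" "A $$ (i, p i) = \<zero>" using z by blast
    have "(\<Otimes>i\<in>{..<n}. A $$ (i, p i)) = A $$ (i, p i) \<otimes> (\<Otimes>i\<in>{..<n}-{i}. A $$ (i, p i))"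
      using i(1) A permutes_in_image[OF p(1)] finprod_insert[of "{..<n}-{i}" i "\<lambda>i. A $$ (i, p i)"]
      by (auto simp: insert_absorb)
    moreover have "(\<Otimes>i\<in>{..<n}-{i}. A $$ (i, p i)) \<in> carrier R"
      using A permutes_in_image[OF p(1)] by (intro finprod_closed) auto
    ultimately show "psgn p \<otimes> (\<Otimes>i\<in>{..<n}. A $$ (i, p i)) = \<zero>" using i(2) by simp
  qed (use pc in \<open>auto simp: permutes_id\<close>)
  also have "\<dots> = (\<Otimes>i\<in>{..<n}. A $$ (i, i))"
    using A by (subst finsum_insert) (auto simp: psgn_def)
  finally show ?thesis .
qed

lemma det_over_lower_triangular:
  assumes "A \<in> carrier (mat_over R n)"
    and z: "\<And>i j. i < n \<Longrightarrow> j < n \<Longrightarrow> i < j \<Longrightarrow> A $$ (i, j) = \<zero>"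
  shows "det_over R A = (\<Otimes>i\<in>{..<n}. A $$ (i, i))"
proof (rule det_over_diag[OF assms(1)])
  fix p assume p: "p permutes {..<n}" "p \<noteq> id"
  then obtain i where i: "i < n" "\<not> p i \<le> i" using permutes_natset_le[of p "{..<n}"] by auto
  moreover have "p i < n" using permutes_in_image[OF p(1), of i] i(1) by simp
  ultimately show "\<exists>i<n. A $$ (i, p i) = \<zero>" using z[of i "p i"] by (intro exI[of _ i]) simp
qed

lemma det_over_upper_triangular:
  assumes "A \<in> carrier (mat_over R n)"
    and z: "\<And>i j. i < n \<Longrightarrow> j < n \<Longrightarrow> j < i \<Longrightarrow> A $$ (i, j) = \<zero>"
  shows "det_over R A = (\<Otimes>i\<in>{..<n}. A $$ (i, i))"
proof (rule det_over_diag[OF assms(1)])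
  fix p assume p: "p permutes {..<n}" "p \<noteq> id"
  then obtain i where i: "i < n" "\<not> p i \<ge> i" using permutes_natset_ge[of p "{..<n}"] by auto
  moreover have "p i < n" using permutes_in_image[OF p(1), of i] i(1) by simp
  ultimately show "\<exists>i<n. A $$ (i, p i) = \<zero>" using z[of i "p i"] by (intro exI[of _ i]) simp
qed

lemma finsum_delta:
  assumes "finite A" "j \<in> A" "\<And>l. l \<in> A \<Longrightarrow> f l \<in> carrier R"
  shows "(\<Oplus>l\<in>A. if l = j then f l else \<zero>) = f j"
  using assms add.finprod_singleton_swap[of j A f] by (simp add: Pi_iff)

lemma mat_over_one_closed: "\<one>\<^bsub>mat_over R n\<^esub> \<in> carrier (mat_over R n)"
  unfolding mat_over_one_def by (intro mat_in_mat_over) auto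

lemma mat_over_l_one:
  assumes A: "A \<in> carrier (mat_over R n)"
  shows "\<one>\<^bsub>mat_over R n\<^esub> \<otimes>\<^bsub>mat_over R n\<^esub> A = A"
proof (rule mat_over_eqI[OF mat_over_mult_closed[OF mat_over_one_closed A] A])
  fix i j assume ij: "i < n" "j < n"
  have "(\<one>\<^bsub>mat_over R n\<^esub> \<otimes>\<^bsub>mat_over R n\<^esub> A) $$ (i, j) =
      (\<Oplus>l\<in>{..<n}. if l = i then A $$ (l, j) else \<zero>)"
    using ij A by (auto intro!: finsum_cong')
  then show "(\<one>\<^bsub>mat_over R n\<^esub> \<otimes>\<^bsub>mat_over R n\<^esub> A) $$ (i, j) = A $$ (i, j)"
    using finsum_delta[of "{..<n}" i "\<lambda>l. A $$ (l, j)"] ij A by simp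
qed

lemma mat_over_r_one:
  assumes A: "A \<in> carrier (mat_over R n)"
  shows "A \<otimes>\<^bsub>mat_over R n\<^esub> \<one>\<^bsub>mat_over R n\<^esub> = A"
proof (rule mat_over_eqI[OF mat_over_mult_closed[OF A mat_over_one_closed] A])
  fix i j assume ij: "i < n" "j < n"
  have "(A \<otimes>\<^bsub>mat_over R n\<^esub> \<one>\<^bsub>mat_over R n\<^esub>) $$ (i, j) =
      (\<Oplus>l\<in>{..<n}. if l = j then A $$ (i, l) else \<zero>)"
    using ij A by (auto intro!: finsum_cong')
  then show "(A \<otimes>\<^bsub>mat_over R n\<^esub> \<one>\<^bsub>mat_over R n\<^esub>) $$ (i, j) = A $$ (i, j)"
    using finsum_delta[of "{..<n}" j "\<lambda>l. A $$ (i, l)"] ij A by simp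
qed

lemma mat_over_assoc:
  assumes A: "A \<in> carrier (mat_over R n)" and B: "B \<in> carrier (mat_over R n)"
    and C: "C \<in> carrier (mat_over R n)"
  shows "A \<otimes>\<^bsub>mat_over R n\<^esub> B \<otimes>\<^bsub>mat_over R n\<^esub> C = A \<otimes>\<^bsub>mat_over R n\<^esub> (B \<otimes>\<^bsub>mat_over R n\<^esub> C)"
proof (rule mat_over_eqI)
  fix i j assume ij: "i < n" "j < n"
  have "(A \<otimes>\<^bsub>mat_over R n\<^esub> B \<otimes>\<^bsub>mat_over R n\<^esub> C) $$ (i, j) =
     (\<Oplus>l\<in>{..<n}. \<Oplus>m\<in>{..<n}. A $$ (i, m) \<otimes> B $$ (m, l) \<otimes> C $$ (l, j))"
    using ij A B C by (auto intro!: finsum_cong' finsum_ldistr)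
  also have "\<dots> = (\<Oplus>m\<in>{..<n}. \<Oplus>l\<in>{..<n}. A $$ (i, m) \<otimes> B $$ (m, l) \<otimes> C $$ (l, j))"
    using ij A B C by (intro finsum_swap) auto
  also have "\<dots> = (\<Oplus>m\<in>{..<n}. A $$ (i, m) \<otimes> (\<Oplus>l\<in>{..<n}. B $$ (m, l) \<otimes> C $$ (l, j)))"
  proof (intro finsum_cong' refl)
    fix m assume m: "m \<in> {..<n}"
    have "(\<Oplus>l\<in>{..<n}. A $$ (i, m) \<otimes> B $$ (m, l) \<otimes> C $$ (l, j)) =
        (\<Oplus>l\<in>{..<n}. A $$ (i, m) \<otimes> (B $$ (m, l) \<otimes> C $$ (l, j)))"
      using ij A B C m by (intro finsum_cong' refl) (auto simp: m_assoc)
    then show "(\<Oplus>l\<in>{..<n}. A $$ (i, m) \<otimes> B $$ (m, l) \<otimes> C $$ (l, j)) =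
        A $$ (i, m) \<otimes> (\<Oplus>l\<in>{..<n}. B $$ (m, l) \<otimes> C $$ (l, j))"
      using ij A B C m finsum_rdistr[of "{..<n}" "A $$ (i, m)" "\<lambda>l. B $$ (m, l) \<otimes> C $$ (l, j)"] by auto
  qed (use ij A B C in \<open>auto intro!: finsum_closed\<close>)
  also have "\<dots> = (A \<otimes>\<^bsub>mat_over R n\<^esub> (B \<otimes>\<^bsub>mat_over R n\<^esub> C)) $$ (i, j)"
    using ij A B C by (auto intro!: finsum_cong' finsum_closed)
  finally show "(A \<otimes>\<^bsub>mat_over R n\<^esub> B \<otimes>\<^bsub>mat_over R n\<^esub> C) $$ (i, j) =
     (A \<otimes>\<^bsub>mat_over R n\<^esub> (B \<otimes>\<^bsub>mat_over R n\<^esub> C)) $$ (i, j)" .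
qed (use A B C in \<open>auto intro!: mat_over_mult_closed\<close>)

lemma monoid_mat_over: "monoid (mat_over R n)"
  by (rule monoidI) (auto intro: mat_over_mult_closed mat_over_one_closed
      simp: mat_over_assoc mat_over_l_one mat_over_r_one)

lemma group_GL: "group (GL R n)"
  unfolding GL_def by (rule monoid.units_group[OF monoid_mat_over])

lemma det_over_one: "det_over R \<one>\<^bsub>mat_over R n\<^esub> = \<one>"
proof -
  have "det_over R \<one>\<^bsub>mat_over R n\<^esub> = (\<Otimes>i\<in>{..<n}. \<one>\<^bsub>mat_over R n\<^esub> $$ (i, i))"
    by (rule det_over_lower_triangular[OF mat_over_one_closed]) auto
  also have "\<dots> = (\<Otimes>i\<in>{..<n}. \<one>)" by (rule finprod_cong') auto
  finally show ?thesis by simp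
qed

end

text \<open>Used for two homomorphisms: the embedding of constants into polynomials, and evaluation
  at zero, which reads off the constant term of a characteristic polynomial.\<close>

lemma (in ring_hom_cring) det_over_hom:
  assumes A: "A \<in> carrier (mat_over R n)"
  shows "h (det_over R A) = det_over S (mat n n (\<lambda>ij. h (A $$ ij)))"
proof -
  have B: "mat n n (\<lambda>ij. h (A $$ ij)) \<in> carrier (mat_over S n)"
    using A by (intro mat_in_mat_over) auto
  have pc: "R.psgn p \<otimes> (\<Otimes>i\<in>{..<n}. A $$ (i, p i)) \<in> carrier R" if "p permutes {..<n}" for p
    using R.permutes_prod_closed[OF A that, of "\<lambda>i. i"] by auto
  have hs: "h (R.psgn p) = S.psgn p" for p by (simp add: R.psgn_def S.psgn_def)
  show ?thesis
    unfolding R.det_over_psgn[OF A] S.det_over_psgn[OF B]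
  proof (subst hom_finsum)
    show "(\<Oplus>\<^bsub>S\<^esub>p\<in>{p. p permutes {..<n}}. (h \<circ> (\<lambda>p. R.psgn p \<otimes> (\<Otimes>i\<in>{..<n}. A $$ (i, p i)))) p) =
       (\<Oplus>\<^bsub>S\<^esub>p\<in>{p. p permutes {..<n}}. S.psgn p \<otimes>\<^bsub>S\<^esub> (\<Otimes>\<^bsub>S\<^esub>i\<in>{..<n}. mat n n (\<lambda>ij. h (A $$ ij)) $$ (i, p i)))"
    proof (intro S.finsum_cong' refl)
      fix p assume "p \<in> {p. p permutes {..<n}}"
      then have p: "p permutes {..<n}" by simp
      have "h (\<Otimes>i\<in>{..<n}. A $$ (i, p i)) = (\<Otimes>\<^bsub>S\<^esub>i\<in>{..<n}. (h \<circ> (\<lambda>i. A $$ (i, p i))) i)"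
        using A permutes_in_image[OF p] by (subst hom_finprod) (auto simp: o_def)
      also have "\<dots> = (\<Otimes>\<^bsub>S\<^esub>i\<in>{..<n}. mat n n (\<lambda>ij. h (A $$ ij)) $$ (i, p i))"
        using A permutes_in_image[OF p] by (intro S.finprod_cong') auto
      finally show "(h \<circ> (\<lambda>p. R.psgn p \<otimes> (\<Otimes>i\<in>{..<n}. A $$ (i, p i)))) p =
          S.psgn p \<otimes>\<^bsub>S\<^esub> (\<Otimes>\<^bsub>S\<^esub>i\<in>{..<n}. mat n n (\<lambda>ij. h (A $$ ij)) $$ (i, p i))"
        using R.permutes_prod_closed[OF A p, of "\<lambda>i. i"] by (simp add: hs)
    qed (use S.permutes_prod_closed[OF B, of _ "\<lambda>i. i"] in auto)
  qed (use pc in \<open>auto simp: o_def\<close>)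
qed

section \<open>Monic polynomials over a finite field\<close>

context ring
begin

text \<open>Coefficient lists start with the leading coefficient, so entry \<open>0\<close> is one
  and entry \<open>d\<close> is the constant term.\<close>

definition monics :: "nat \<Rightarrow> 'a list set" where
  "monics d = {p. length p = Suc d \<and> hd p = \<one> \<and> set p \<subseteq> carrier R}"

end

context domain
begin

lemma monicsD:
  assumes "p \<in> monics d"
  shows "length p = Suc d" "p ! 0 = \<one>" "\<And>i. i \<le> d \<Longrightarrow> p ! i \<in> carrier R" "p \<noteq> []"
    "p \<in> carrier (poly_ring R)" "set p \<subseteq> carrier R" "hd p = \<one>"
proof -
  show l: "length p = Suc d" and s: "set p \<subseteq> carrier R" and hd: "hd p = \<one>"
    using assms by (auto simp: monics_def)
  show ne: "p \<noteq> []" using l by auto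
  show "p ! 0 = \<one>" using hd ne by (simp add: hd_conv_nth)
  show "p ! i \<in> carrier R" if "i \<le> d" for i using that l s nth_mem[of i p] by auto
  show "p \<in> carrier (poly_ring R)" using s hd ne by (auto simp: univ_poly_carrier[symmetric] polynomial_def)
qed

lemma monics_iff:
  "p \<in> monics d \<longleftrightarrow> p \<in> carrier (poly_ring R) \<and> p \<noteq> [] \<and> hd p = \<one> \<and> degree p = d"
proof
  assume "p \<in> carrier (poly_ring R) \<and> p \<noteq> [] \<and> hd p = \<one> \<and> degree p = d"
  then show "p \<in> monics d"
    by (cases p) (auto simp: monics_def univ_poly_carrier[symmetric] polynomial_def)
qed (use monicsD in auto)

lemma const_term_monic:
  assumes "p \<in> monics d" shows "const_term p = p ! d"
  using const_term_eq_last[of "butlast p" "last p"] monicsD[OF assms]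
  by (metis append_butlast_last_id diff_Suc_1 in_set_butlastD last_conv_nth last_in_set subsetD subsetI)

end

locale polynomial_field = field R for R (structure)
begin

abbreviation PR where "PR \<equiv> poly_ring R"
abbreviation pmult (infixl \<open>\<star>\<close> 70) where "pmult \<equiv> monoid.mult PR"

sublocale P: principal_domain PR by (rule univ_poly_is_principal[OF carrier_is_subfield])

end

locale finite_field = polynomial_field +
  assumes fin: "finite (carrier R)"
begin

abbreviation q where "q \<equiv> card (carrier R)"

lemma q2: "q \<ge> 2"
proof -
  have "card {\<zero>, \<one>} \<le> q" using fin by (intro card_mono) auto
  then show ?thesis by simp
qed

lemma card_monics: "card (monics d) = q ^ d"
proof -
  have "monics d = Cons \<one> ` {xs. set xs \<subseteq> carrier R \<and> length xs = d}"
  proof (intro equalityI subsetI)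
    fix p assume "p \<in> monics d"
    then show "p \<in> Cons \<one> ` {xs. set xs \<subseteq> carrier R \<and> length xs = d}" by (cases p) (auto simp: monics_def)
  qed (auto simp: monics_def)
  then show ?thesis using card_lists_length_eq[OF fin, of d] by (simp add: card_image)
qed

lemma finite_monics [simp]: "finite (monics d)"
  by (rule finite_subset[OF _ finite_lists_length_eq[OF fin, of "Suc d"]]) (auto simp: monics_def)

lemma card_monics_const:
  assumes "d \<ge> 1" "c \<in> carrier R"
  shows "card {p \<in> monics d. const_term p = c} = q ^ (d - 1)"
proof -
  let ?L = "{xs. set xs \<subseteq> carrier R \<and> length xs = d - 1}"
  have "{p \<in> monics d. const_term p = c} = (\<lambda>xs. \<one> # xs @ [c]) ` ?L"
  proof (intro equalityI subsetI)
    fix p assume p: "p \<in> {p \<in> monics d. const_term p = c}"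
    then have pm: "p \<in> monics d" and pc: "p ! d = c" using const_term_monic by auto
    note pp = monicsD[OF pm]
    obtain ys where y: "p = \<one> # ys" using pp by (cases p) auto
    have yn: "ys \<noteq> []" using y pp assms by auto
    then obtain xs z where xz: "ys = xs @ [z]" by (cases ys rule: rev_cases) auto
    then have "z = c" using y pp pc by (auto simp: nth_append)
    then show "p \<in> (\<lambda>xs. \<one> # xs @ [c]) ` ?L" using y xz pp by auto
  next
    fix p assume "p \<in> (\<lambda>xs. \<one> # xs @ [c]) ` ?L"
    then obtain xs where x: "p = \<one> # xs @ [c]" "set xs \<subseteq> carrier R" "length xs = d - 1" by auto
    then have pm: "p \<in> monics d" using assms by (auto simp: monics_def)
    moreover have "p ! d = c" using x assms by (cases d) (auto simp: nth_append)
    ultimately show "p \<in> {p \<in> monics d. const_term p = c}" using const_term_monic by auto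
  qed
  then show ?thesis using card_lists_length_eq[OF fin, of "d - 1"] by (simp add: card_image inj_on_def)
qed

lemma monics_mult:
  assumes p: "p \<in> monics a" and r: "r \<in> monics b"
  shows "p \<star> r \<in> monics (a + b)"
proof -
  note pp = monicsD[OF p] and rr = monicsD[OF r]
  have pol: "polynomial (carrier R) p" "polynomial (carrier R) r"
    using pp(5) rr(5) by (simp_all add: univ_poly_carrier)
  have ne: "p \<star> r \<noteq> []" using P.integral[of p r] pp rr by (auto simp: univ_poly_zero)
  show ?thesis
    unfolding monics_iff
    using ne pp rr poly_mult_degree_eq[OF carrier_is_subring pol] poly_mult_lead_coeff[OF carrier_is_subring pol]
    by (auto simp: univ_poly_mult[symmetric, of R "carrier R"])
qed

lemma monic_cofactor:
  assumes p: "p \<in> monics a" and pr: "p \<star> r \<in> monics b" and r: "r \<in> carrier PR"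
  shows "a \<le> b" "r \<in> monics (b - a)"
proof -
  note pp = monicsD[OF p] and prr = monicsD[OF pr]
  have pol: "polynomial (carrier R) p" "polynomial (carrier R) r"
    using pp(5) r by (simp_all add: univ_poly_carrier)
  have ne: "r \<noteq> []" using prr pp by (auto simp: univ_poly_zero[symmetric, of R "carrier R"])
  have "hd r \<in> carrier R" using pol(2) ne by (cases r) (auto simp: polynomial_def)
  then have deg: "b = a + degree r" and lc: "hd r = \<one>"
    using ne pp prr poly_mult_degree_eq[OF carrier_is_subring pol] poly_mult_lead_coeff[OF carrier_is_subring pol]
    by (auto simp: univ_poly_mult[symmetric, of R "carrier R"])
  show "a \<le> b" using deg by simp
  show "r \<in> monics (b - a)" unfolding monics_iff using r ne lc deg by simp
qed

lemma monic_associated_eq: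
  assumes p: "p \<in> monics a" and r: "r \<in> monics b" and as: "p \<sim>\<^bsub>PR\<^esub> r"
  shows "p = r"
proof -
  note pp = monicsD[OF p] and rr = monicsD[OF r]
  obtain k where k: "k \<in> carrier R - {\<zero>}" "p = [k] \<star> r"
    using associated_polynomials_iff[OF carrier_is_subfield pp(5) rr(5)] as by auto
  have "polynomial (carrier R) r" using rr(5) by (simp add: univ_poly_carrier)
  from poly_mult_const(1)[OF carrier_is_subring this k(1)]
  have pm: "p = map (\<lambda>b. k \<otimes> b) r" using k(2) by (simp add: univ_poly_mult)
  then have "k = \<one>" using pp rr k(1) by (cases r) auto
  then show ?thesis using pm rr by (auto intro!: map_idI)
qed

lemma ex_monic_associate:
  assumes f: "f \<in> carrier PR" "f \<noteq> []"
  shows "\<exists>k\<in>carrier R - {\<zero>}. [k] \<star> f \<in> monics (degree f)"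
proof -
  have pol: "polynomial (carrier R) f" using f(1) by (simp add: univ_poly_carrier)
  have lc: "hd f \<in> carrier R - {\<zero>}" using pol f by (cases f) (auto simp: polynomial_def)
  then have u: "hd f \<in> Units R" using field_Units by auto
  define k where "k = inv (hd f)"
  have k: "k \<in> carrier R - {\<zero>}" using u Units_inv_Units[OF u] field_Units unfolding k_def by auto
  have e: "[k] \<star> f = map (\<lambda>b. k \<otimes> b) f"
    using poly_mult_const(1)[OF carrier_is_subring pol k] by (simp add: univ_poly_mult)
  have "map (\<lambda>b. k \<otimes> b) f \<in> monics (degree f)"
    unfolding monics_def using f pol k u by (cases f) (auto simp: k_def polynomial_def)
  then show ?thesis using k e by (intro bexI[of _ k]) simp_all
qed

lemma monic_lcancel:
  assumes "p \<in> monics d" "a \<in> carrier PR" "b \<in> carrier PR" "p \<star> a = p \<star> b"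
  shows "a = b"
  using P.m_lcancel[of p a b] assms monicsD(4,5)[OF assms(1)] by (simp add: univ_poly_zero)

text \<open>Monic representatives turn association into equality, so irreducible divisors can be
  collected in plain sets.\<close>

definition irrs :: "'a list set" where
  "irrs = {p. pirreducible (carrier R) p \<and> (\<exists>d. p \<in> monics d)}"

definition irr :: "nat \<Rightarrow> 'a list set" where
  "irr d = {p \<in> monics d. pirreducible (carrier R) p}"

lemma irrsD:
  assumes "p \<in> irrs"
  shows "p \<in> carrier PR" "p \<noteq> []" "pirreducible (carrier R) p" "p \<in> monics (degree p)" "p \<in> irr (degree p)"
    "degree p \<ge> 1" "p \<notin> Units PR"
proof -
  obtain d where d: "p \<in> monics d" and i: "pirreducible (carrier R) p" using assms by (auto simp: irrs_def)
  then show c: "p \<in> carrier PR" "p \<noteq> []" "pirreducible (carrier R) p" "p \<in> monics (degree p)" "p \<in> irr (degree p)"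
    using monicsD[OF d] by (auto simp: irr_def)
  show "degree p \<ge> 1" using pirreducible_degree[OF carrier_is_subfield c(1) i] .
  show "p \<notin> Units PR" using pirreducibleE(2)[OF carrier_is_subring c(1) i] .
qed

lemma irrD:
  assumes "p \<in> irr d"
  shows "p \<in> irrs" "degree p = d" "p \<in> monics d"
  using assms monicsD by (auto simp: irr_def irrs_def)

lemma irr_subset: "irr d \<subseteq> monics d" by (auto simp: irr_def)

lemma finite_irr [simp]: "finite (irr d)" by (rule finite_subset[OF irr_subset]) simp

lemma card_irr_le: "card (irr d) \<le> q ^ d"
  using card_mono[OF finite_monics irr_subset[of d]] by (simp add: card_monics)

lemma irr_prime:
  assumes "p \<in> irrs" "a \<in> carrier PR" "b \<in> carrier PR" "p pdivides (a \<star> b)"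
  shows "p pdivides a \<or> p pdivides b"
  using pprimeE(3)[OF carrier_is_subfield] pprime_iff_pirreducible[OF carrier_is_subfield] irrsD[OF assms(1)] assms
  by blast

lemma pdividesE:
  assumes "p pdivides f" obtains g where "g \<in> carrier PR" "f = p \<star> g"
  using assms unfolding pdivides_def factor_def by auto

lemma pdividesI: "g \<in> carrier PR \<Longrightarrow> p pdivides (p \<star> g)"
  unfolding pdivides_def factor_def by auto

lemma irr_pdivides_irr:
  assumes p: "p \<in> irrs" and r: "r \<in> irrs" and d: "p pdivides r"
  shows "p = r"
proof -
  obtain g where g: "g \<in> carrier PR" "r = p \<star> g" using d by (rule pdividesE)
  have "g \<in> Units PR"
    using pirreducibleE(3)[OF carrier_is_subring irrsD(1,3)[OF r] irrsD(1)[OF p] g] irrsD(7)[OF p] by auto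
  then have "r \<sim>\<^bsub>PR\<^esub> p"
    using P.ring_associated_iff[OF irrsD(1)[OF r] irrsD(1)[OF p]] g irrsD(1)[OF p] P.m_comm by auto
  then show ?thesis using monic_associated_eq[OF irrsD(4)[OF r] irrsD(4)[OF p]] by simp
qed

lemma irr_not_pdivides_one:
  assumes "p \<in> irrs" shows "\<not> p pdivides \<one>\<^bsub>PR\<^esub>"
  using irrsD(7)[OF assms] P.divides_one[OF irrsD(1)[OF assms]] by (simp add: pdivides_def)

lemma ex_irr_associate:
  assumes b: "b \<in> carrier PR" "pirreducible (carrier R) b"
  shows "\<exists>k\<in>carrier R - {\<zero>}. [k] \<star> b \<in> irrs"
proof -
  have bne: "b \<noteq> []" using pirreducibleE(1)[OF carrier_is_subring b] .
  obtain k where k: "k \<in> carrier R - {\<zero>}" and m: "[k] \<star> b \<in> monics (degree b)"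
    using ex_monic_associate[OF b(1) bne] by auto
  have ku: "[k] \<in> Units PR" using k univ_poly_carrier_units by auto
  let ?k' = "inv\<^bsub>PR\<^esub> [k]"
  have k'u: "?k' \<in> Units PR" using ku by auto
  have c: "[k] \<in> carrier PR" "?k' \<in> carrier PR" using ku k'u by auto
  have bb: "b = ?k' \<star> ([k] \<star> b)"
    using ku b c by (simp add: P.m_assoc[symmetric])
  have "pirreducible (carrier R) ([k] \<star> b)"
  proof (rule pirreducibleI[OF carrier_is_subring])
    show "[k] \<star> b \<in> carrier PR" "[k] \<star> b \<noteq> []" using monicsD[OF m] by auto
    show "[k] \<star> b \<notin> Units PR"
      using pirreducibleE(2)[OF carrier_is_subring b] bb k'u P.Units_m_closed by metis
    fix u v assume uv: "u \<in> carrier PR" "v \<in> carrier PR" "[k] \<star> b = u \<star> v"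
    have "b = (?k' \<star> u) \<star> v" using bb uv c by (simp add: P.m_assoc)
    then have "?k' \<star> u \<in> Units PR \<or> v \<in> Units PR"
      using pirreducibleE(3)[OF carrier_is_subring b] uv c by auto
    moreover have "u = [k] \<star> (?k' \<star> u)" using ku uv c by (simp add: P.m_assoc[symmetric])
    ultimately show "u \<in> Units PR \<or> v \<in> Units PR" using ku P.Units_m_closed by metis
  qed
  then show ?thesis using k m by (auto simp: irrs_def)
qed

lemma ex_irr_pdivides:
  assumes f: "f \<in> monics d" "d \<ge> 1"
  shows "\<exists>p\<in>irrs. p pdivides f"
proof -
  note ff = monicsD[OF f(1)]
  have fU: "f \<notin> Units PR" using univ_poly_units'[OF carrier_is_subfield, of f] ff(1) f(2) by simp
  have "f \<in> carrier PR - {\<zero>\<^bsub>PR\<^esub>}" using ff(4,5) by (simp add: univ_poly_zero)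
  from P.exists_irreducible_divisor[OF this fU]
  obtain b where b: "b \<in> carrier PR" "pirreducible (carrier R) b" "b divides\<^bsub>PR\<^esub> f" .
  obtain k where k: "k \<in> carrier R - {\<zero>}" "[k] \<star> b \<in> irrs" using ex_irr_associate[OF b(1,2)] by auto
  have ku: "[k] \<in> Units PR" using k univ_poly_carrier_units by auto
  obtain g where g: "g \<in> carrier PR" "f = b \<star> g" using b(3) unfolding factor_def by auto
  have "f = ([k] \<star> b) \<star> (inv\<^bsub>PR\<^esub> [k] \<star> g)"
  proof -
    have c: "[k] \<in> carrier PR" "inv\<^bsub>PR\<^esub> [k] \<in> carrier PR" using ku by auto
    have "([k] \<star> b) \<star> (inv\<^bsub>PR\<^esub> [k] \<star> g) = ([k] \<star> inv\<^bsub>PR\<^esub> [k]) \<star> (b \<star> g)"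
      using c b g by (simp add: P.m_ac)
    then show ?thesis using ku g b by simp
  qed
  then have "([k] \<star> b) pdivides f" using ku g pdividesI[of "inv\<^bsub>PR\<^esub> [k] \<star> g" "[k] \<star> b"] by simp
  then show ?thesis using k by auto
qed

abbreviation pprod where "pprod A \<equiv> (\<Otimes>\<^bsub>PR\<^esub>p\<in>A. p)"

lemma pprod_closed: "A \<subseteq> irrs \<Longrightarrow> pprod A \<in> carrier PR"
  using irrsD(1) by (intro P.finprod_closed) auto

lemma pprod_insert: "finite A \<Longrightarrow> p \<notin> A \<Longrightarrow> insert p A \<subseteq> irrs \<Longrightarrow> pprod (insert p A) = p \<star> pprod A"
  using irrsD(1) by (intro P.finprod_insert) auto

lemma pprod_monic:
  assumes "finite A" "A \<subseteq> irrs"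
  shows "pprod A \<in> monics (\<Sum>p\<in>A. degree p)"
  using assms
proof (induction A rule: finite_induct)
  case empty
  then show ?case by (auto simp: univ_poly_one monics_def)
next
  case (insert p A)
  then show ?case
    using monics_mult[OF irrsD(4)[of p], of "pprod A" "\<Sum>p\<in>A. degree p"] pprod_insert[of A p] by auto
qed

lemma irr_pdivides_pprod:
  assumes "finite A" "A \<subseteq> irrs" "r \<in> irrs" "r pdivides pprod A"
  shows "r \<in> A"
  using assms
proof (induction A rule: finite_induct)
  case empty then show ?case using irr_not_pdivides_one[of r] by simp
next
  case (insert p A)
  then have "r pdivides (p \<star> pprod A)" using pprod_insert[of A p] by auto
  then have "r pdivides p \<or> r pdivides pprod A"
    using insert irrsD(1)[of p] pprod_closed[of A] by (intro irr_prime) auto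
  then show ?case using insert irr_pdivides_irr[of r p] by auto
qed

text \<open>Distinct monic irreducibles do not divide each other; a new \<open>p\<close> is prime
  and does not divide the product so far, hence it divides the cofactor.\<close>

lemma pprod_pdivides:
  assumes "finite A" "A \<subseteq> irrs" "f \<in> carrier PR" "\<And>p. p \<in> A \<Longrightarrow> p pdivides f"
  shows "\<exists>g\<in>carrier PR. f = pprod A \<star> g"
  using assms
proof (induction A rule: finite_induct)
  case empty then show ?case by auto
next
  case (insert p A)
  then obtain g where g: "g \<in> carrier PR" "f = pprod A \<star> g" by auto
  have A: "pprod A \<in> carrier PR" "p \<in> irrs" "p \<in> carrier PR" using insert pprod_closed irrsD(1) by auto
  have "p pdivides pprod A \<or> p pdivides g" using insert g A by (intro irr_prime) auto
  then have "p pdivides g" using irr_pdivides_pprod[of A p] insert by auto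
  then obtain k where k: "k \<in> carrier PR" "g = p \<star> k" by (rule pdividesE)
  have "f = pprod (insert p A) \<star> k"
    unfolding pprod_insert[OF insert(1,2,4)] using g k A by (simp add: P.m_ac)
  then show ?case using k by auto
qed

section \<open>Irreducible divisors and square-free polynomials\<close>

definition irr_divs :: "'a list \<Rightarrow> 'a list set" where
  "irr_divs f = {p \<in> irrs. p pdivides f}"

definition sqfree :: "'a list \<Rightarrow> bool" where
  "sqfree f \<longleftrightarrow> (\<forall>p\<in>irrs. \<not> (p \<star> p) pdivides f)"

lemma pdivides_monic_degree:
  assumes "f \<in> monics n" "p \<in> monics d" "p pdivides f"
  shows "d \<le> n" "\<exists>g\<in>monics (n - d). f = p \<star> g"
proof -
  obtain g where g: "g \<in> carrier PR" "f = p \<star> g" using assms(3) by (rule pdividesE)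
  show "d \<le> n" "\<exists>g\<in>monics (n - d). f = p \<star> g"
    using monic_cofactor[OF assms(2), of g n] assms(1) g by auto
qed

lemma irr_divs_sub:
  assumes "f \<in> monics n"
  shows "irr_divs f \<subseteq> (\<Union>d\<in>{1..n}. irr d)"
proof
  fix p assume "p \<in> irr_divs f"
  then have p: "p \<in> irrs" "p pdivides f" by (auto simp: irr_divs_def)
  then show "p \<in> (\<Union>d\<in>{1..n}. irr d)"
    using pdivides_monic_degree(1)[OF assms irrsD(4)[OF p(1)] p(2)] irrsD(5,6)[OF p(1)]
    by (intro UN_I[of "degree p"]) auto
qed

lemma finite_irr_divs: "f \<in> monics n \<Longrightarrow> finite (irr_divs f)"
  by (rule finite_subset[OF irr_divs_sub]) auto

text \<open>The degree inequality is the upper half of the double count below.\<close>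

lemma irr_divs_cofactor:
  assumes f: "f \<in> monics n"
  shows "\<exists>g\<in>monics (n - (\<Sum>p\<in>irr_divs f. degree p)). f = pprod (irr_divs f) \<star> g"
    and "(\<Sum>p\<in>irr_divs f. degree p) \<le> n"
proof -
  have fi: "finite (irr_divs f)" by (rule finite_irr_divs[OF f])
  have s: "irr_divs f \<subseteq> irrs" by (auto simp: irr_divs_def)
  obtain g where g: "g \<in> carrier PR" "f = pprod (irr_divs f) \<star> g"
    using pprod_pdivides[OF fi s monicsD(5)[OF f]] by (auto simp: irr_divs_def)
  from monic_cofactor[OF pprod_monic[OF fi s], of g n] g f
  show "\<exists>g\<in>monics (n - (\<Sum>p\<in>irr_divs f. degree p)). f = pprod (irr_divs f) \<star> g"
    "(\<Sum>p\<in>irr_divs f. degree p) \<le> n" by auto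
qed

text \<open>If the cofactor had positive degree, it would have an irreducible divisor
  \<open>p\<close>. This \<open>p\<close> divides \<open>f\<close>, so it already occurs in the
  product, and \<open>p \<star> p\<close> would divide \<open>f\<close>.\<close>

lemma sqfree_pprod_irr_divs:
  assumes f: "f \<in> monics n" and sq: "sqfree f"
  shows "f = pprod (irr_divs f)" "(\<Sum>p\<in>irr_divs f. degree p) = n"
proof -
  let ?D = "irr_divs f"
  have fi: "finite ?D" by (rule finite_irr_divs[OF f])
  have s: "?D \<subseteq> irrs" by (auto simp: irr_divs_def)
  obtain g where g: "g \<in> monics (n - (\<Sum>p\<in>?D. degree p))" "f = pprod ?D \<star> g"
    using irr_divs_cofactor(1)[OF f] by auto
  note gc = monicsD(5)[OF g(1)]
  have "n - (\<Sum>p\<in>?D. degree p) = 0"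
  proof (rule ccontr)
    assume "n - (\<Sum>p\<in>?D. degree p) \<noteq> 0"
    then have "n - (\<Sum>p\<in>?D. degree p) \<ge> 1" by linarith
    from ex_irr_pdivides[OF g(1) this] obtain p where p: "p \<in> irrs" "p pdivides g" by blast
    obtain k where k: "k \<in> carrier PR" "g = p \<star> k" using p(2) by (rule pdividesE)
    have pc: "p \<in> carrier PR" using irrsD(1)[OF p(1)] .
    have Dc: "pprod ?D \<in> carrier PR" by (rule pprod_closed[OF s])
    have "f = p \<star> (pprod ?D \<star> k)" using g k pc Dc by (simp add: P.m_ac)
    then have "p pdivides f" using pdividesI[of "pprod ?D \<star> k" p] Dc k by auto
    then have pD: "p \<in> ?D" using p by (auto simp: irr_divs_def)
    then have ins: "insert p (?D - {p}) = ?D" by auto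
    let ?E = "pprod (?D - {p})"
    have E: "?E \<in> carrier PR" using s by (intro pprod_closed) auto
    have "pprod ?D = p \<star> ?E"
      using pprod_insert[of "?D - {p}" p] fi s ins by auto
    then have "f = (p \<star> p) \<star> (?E \<star> k)" using g k pc E by (simp add: P.m_ac)
    then have "(p \<star> p) pdivides f" using pdividesI[of "?E \<star> k" "p \<star> p"] E k by auto
    then show False using sq p by (auto simp: sqfree_def)
  qed
  then have g0: "g \<in> monics 0" and e: "n \<le> (\<Sum>p\<in>?D. degree p)" using g by auto
  have "g = \<one>\<^bsub>PR\<^esub>" using g0 by (auto simp: monics_def univ_poly_one length_Suc_conv)
  then show "f = pprod ?D" using g(2) pprod_closed[OF s] by simp
  show "(\<Sum>p\<in>?D. degree p) = n" using e irr_divs_cofactor(2)[OF f] by simp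
qed

lemma irr_divs_pprod:
  assumes "finite A" "A \<subseteq> irrs"
  shows "irr_divs (pprod A) = A"
proof (intro equalityI subsetI)
  fix p assume "p \<in> irr_divs (pprod A)"
  then show "p \<in> A" using irr_pdivides_pprod[OF assms] by (auto simp: irr_divs_def)
next
  fix p assume p: "p \<in> A"
  then have "insert p (A - {p}) = A" by auto
  then have "pprod A = p \<star> pprod (A - {p})"
    using pprod_insert[of "A - {p}" p] assms by auto
  moreover have "pprod (A - {p}) \<in> carrier PR" using assms by (intro pprod_closed) auto
  ultimately show "p \<in> irr_divs (pprod A)" using p assms pdividesI[of "pprod (A - {p})" p] by (auto simp: irr_divs_def)
qed

text \<open>With \<open>sqfree_pprod_irr_divs\<close> and \<open>irr_divs_pprod\<close> this
  identifies square-free monic polynomials with finite sets of monic irreducibles.\<close>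

lemma sqfree_pprod:
  assumes "finite A" "A \<subseteq> irrs"
  shows "sqfree (pprod A)"
  unfolding sqfree_def
proof (intro ballI notI)
  fix p assume p: "p \<in> irrs" and d: "(p \<star> p) pdivides pprod A"
  have pc: "p \<in> carrier PR" "p \<noteq> []" using irrsD[OF p] by auto
  obtain g where g: "g \<in> carrier PR" "pprod A = p \<star> p \<star> g" using d by (rule pdividesE)
  then have g2: "pprod A = p \<star> (p \<star> g)" using pc by (simp add: P.m_assoc)
  then have "p pdivides pprod A" using pdividesI[of "p \<star> g" p] pc g by auto
  then have pA: "p \<in> A" using irr_pdivides_pprod[OF assms p] by simp
  then have ins: "insert p (A - {p}) = A" by auto
  have E: "pprod (A - {p}) \<in> carrier PR" using assms by (intro pprod_closed) auto
  have "pprod A = p \<star> pprod (A - {p})" using pprod_insert[of "A - {p}" p] assms ins by auto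
  then have eq: "p \<star> pprod (A - {p}) = p \<star> (p \<star> g)" using g2 by (rule subst)
  have "pprod (A - {p}) = p \<star> g"
    by (rule monic_lcancel[OF irrsD(4)[OF p] E P.m_closed[OF pc(1) g(1)] eq])
  then have "p pdivides pprod (A - {p})" using pdividesI[of g p] g by auto
  moreover have "finite (A - {p})" "A - {p} \<subseteq> irrs" using assms by blast+
  ultimately have "p \<in> A - {p}" using irr_pdivides_pprod[OF _ _ p] by blast
  then show False by simp
qed

section \<open>Counting multiples, and the weighted double count\<close>

lemma card_multiples:
  assumes p: "p \<in> monics d" and dn: "d \<le> n"
  shows "card {f \<in> monics n. p pdivides f} = q ^ (n - d)"
proof -
  have "{f \<in> monics n. p pdivides f} = (\<lambda>g. p \<star> g) ` monics (n - d)"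
  proof (intro equalityI subsetI)
    fix f assume "f \<in> (\<lambda>g. p \<star> g) ` monics (n - d)"
    then show "f \<in> {f \<in> monics n. p pdivides f}"
      using monics_mult[OF p, of _ "n - d"] dn monicsD(5) by (auto intro!: pdividesI)
  qed (use pdivides_monic_degree(2)[OF _ p] in auto)
  moreover have "inj_on (\<lambda>g. p \<star> g) (monics (n - d))"
    by (rule inj_onI) (use monic_lcancel[OF p] monicsD(5) in blast)
  ultimately show ?thesis by (simp add: card_image card_monics)
qed

text \<open>The cofactor has degree \<open>n - d >= 1\<close> and its constant term is forced to be
  \<open>c\<close> divided by that of \<open>p\<close>, which leaves \<open>n - d - 1\<close> free
  coefficients. If \<open>p\<close> has constant term zero, so have its multiples, whereas
  \<open>c\<close> is nonzero.\<close>

lemma card_multiples_const: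
  assumes p: "p \<in> monics d" and dn: "d < n" and c: "c \<in> carrier R" "c \<noteq> \<zero>"
  shows "card {f \<in> {f \<in> monics n. const_term f = c}. p pdivides f} =
     (if const_term p = \<zero> then 0 else q ^ (n - d - 1))"
proof -
  have ct: "const_term (p \<star> g) = const_term p \<otimes> const_term g" if "g \<in> carrier PR" for g
    using const_term_simprules_shell(2)[OF carrier_is_subring] that monicsD(5)[OF p] by auto
  have pc: "const_term p \<in> carrier R" using const_term_monic[OF p] monicsD(3)[OF p] by auto
  have gc: "const_term g \<in> carrier R" if "g \<in> monics (n - d)" for g
    using const_term_monic[OF that] monicsD(3)[OF that] by auto
  have eq: "{f \<in> {f \<in> monics n. const_term f = c}. p pdivides f} =
      (\<lambda>g. p \<star> g) ` {g \<in> monics (n - d). const_term p \<otimes> const_term g = c}"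
  proof (intro equalityI subsetI)
    fix f assume "f \<in> (\<lambda>g. p \<star> g) ` {g \<in> monics (n - d). const_term p \<otimes> const_term g = c}"
    then show "f \<in> {f \<in> {f \<in> monics n. const_term f = c}. p pdivides f}"
      using monics_mult[OF p, of _ "n - d"] dn monicsD(5) ct by (auto intro!: pdividesI)
  next
    fix f assume f: "f \<in> {f \<in> {f \<in> monics n. const_term f = c}. p pdivides f}"
    then obtain g where "g \<in> monics (n - d)" "f = p \<star> g"
      using pdivides_monic_degree(2)[OF _ p] by blast
    then show "f \<in> (\<lambda>g. p \<star> g) ` {g \<in> monics (n - d). const_term p \<otimes> const_term g = c}"
      using f ct monicsD(5) by auto
  qed
  have "inj_on (\<lambda>g. p \<star> g) {g \<in> monics (n - d). const_term p \<otimes> const_term g = c}"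
    by (rule inj_onI) (use monic_lcancel[OF p] monicsD(5) in blast)
  then have "card {f \<in> {f \<in> monics n. const_term f = c}. p pdivides f} =
      card {g \<in> monics (n - d). const_term p \<otimes> const_term g = c}"
    unfolding eq by (rule card_image)
  also have "\<dots> = (if const_term p = \<zero> then 0 else q ^ (n - d - 1))"
  proof (cases "const_term p = \<zero>")
    case True
    then have "{g \<in> monics (n - d). const_term p \<otimes> const_term g = c} = {}" using c gc by auto
    then show ?thesis using True by (metis (no_types, lifting) card.empty)
  next
    case False
    then have u: "const_term p \<in> Units R" using pc field_Units by auto
    have "{g \<in> monics (n - d). const_term p \<otimes> const_term g = c} =
        {g \<in> monics (n - d). const_term g = inv (const_term p) \<otimes> c}"
    proof (intro Collect_cong conj_cong refl)
      fix g assume "g \<in> monics (n - d)"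
      then show "(const_term p \<otimes> const_term g = c) = (const_term g = inv (const_term p) \<otimes> c)"
        using gc[of g] u c pc by (auto simp: m_assoc[symmetric])
    qed
    then show ?thesis using False card_monics_const[of "n - d" "inv (const_term p) \<otimes> c"] dn u c by simp
  qed
  finally show ?thesis .
qed

text \<open>Union bound over squares: in degree \<open>d\<close> there are at most
  \<open>q^d\<close> irreducibles, the square of each divides at most \<open>q^(n - 2d)\<close>
  polynomials, and \<open>q^(n - d) <= q^(n - 1)\<close> for each of the \<open>n\<close>
  degrees.\<close>

lemma card_not_sqfree: "card {f \<in> monics n. \<not> sqfree f} \<le> n * q ^ (n - 1)"
proof -
  have sub: "{f \<in> monics n. \<not> sqfree f} \<subseteq>
      (\<Union>d\<in>{1..n}. \<Union>p\<in>irr d. {f \<in> monics n. (p \<star> p) pdivides f})"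
  proof
    fix f assume "f \<in> {f \<in> monics n. \<not> sqfree f}"
    then obtain p where p: "p \<in> irrs" "(p \<star> p) pdivides f" and f: "f \<in> monics n"
      by (auto simp: sqfree_def)
    have "degree p + degree p \<le> n"
      using pdivides_monic_degree(1)[OF f monics_mult[OF irrsD(4)[OF p(1)] irrsD(4)[OF p(1)]] p(2)] .
    then show "f \<in> (\<Union>d\<in>{1..n}. \<Union>p\<in>irr d. {f \<in> monics n. (p \<star> p) pdivides f})"
      using p f irrsD(5,6)[OF p(1)] by (intro UN_I[of "degree p"] UN_I[of p]) auto
  qed
  have one: "card {f \<in> monics n. (p \<star> p) pdivides f} * q ^ d \<le> q ^ (n - 1)"
    if p: "p \<in> irr d" and d: "d \<ge> 1" for p d
  proof (cases "d + d \<le> n")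
    case True
    have "card {f \<in> monics n. (p \<star> p) pdivides f} = q ^ (n - (d + d))"
      using p True by (intro card_multiples monics_mult irrD(3))
    then have "card {f \<in> monics n. (p \<star> p) pdivides f} * q ^ d = q ^ (n - d)"
      using True by (simp add: power_add[symmetric])
    also have "\<dots> \<le> q ^ (n - 1)" using q2 d by (intro power_increasing) auto
    finally show ?thesis .
  next
    case False
    have "{f \<in> monics n. (p \<star> p) pdivides f} = {}"
      using False pdivides_monic_degree(1)[OF _ monics_mult[OF irrD(3)[OF p] irrD(3)[OF p]]] by blast
    then show ?thesis by (metis card.empty mult_zero_left le0)
  qed
  have "card {f \<in> monics n. \<not> sqfree f} \<le>
      (\<Sum>d\<in>{1..n}. \<Sum>p\<in>irr d. card {f \<in> monics n. (p \<star> p) pdivides f})"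
  proof -
    have "card {f \<in> monics n. \<not> sqfree f} \<le> card (\<Union>d\<in>{1..n}. \<Union>p\<in>irr d. {f \<in> monics n. (p \<star> p) pdivides f})"
      using sub by (intro card_mono) auto
    also have "\<dots> \<le> (\<Sum>d\<in>{1..n}. card (\<Union>p\<in>irr d. {f \<in> monics n. (p \<star> p) pdivides f}))"
      by (rule card_UN_le) simp
    also have "\<dots> \<le> (\<Sum>d\<in>{1..n}. \<Sum>p\<in>irr d. card {f \<in> monics n. (p \<star> p) pdivides f})"
      by (intro sum_mono card_UN_le) simp
    finally show ?thesis .
  qed
  also have "\<dots> \<le> (\<Sum>d\<in>{1..n}. q ^ (n - 1))"
  proof (rule sum_mono)
    fix d assume d: "d \<in> {1..n}"
    have "(\<Sum>p\<in>irr d. card {f \<in> monics n. (p \<star> p) pdivides f}) * q ^ d =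
        (\<Sum>p\<in>irr d. card {f \<in> monics n. (p \<star> p) pdivides f} * q ^ d)" by (simp add: sum_distrib_right)
    also have "\<dots> \<le> card (irr d) * q ^ (n - 1)"
      using sum_bounded_above[of "irr d" "\<lambda>p. card {f \<in> monics n. (p \<star> p) pdivides f} * q ^ d" "q ^ (n - 1)"] one d
      by auto
    also have "\<dots> \<le> q ^ (n - 1) * q ^ d" using card_irr_le[of d] by simp
    finally show "(\<Sum>p\<in>irr d. card {f \<in> monics n. (p \<star> p) pdivides f}) \<le> q ^ (n - 1)"
      using q2 by simp
  qed
  also have "\<dots> = n * q ^ (n - 1)" by simp
  finally show ?thesis .
qed

lemma sum_irr_divs:
  assumes S: "S \<subseteq> monics n"
  shows "(\<Sum>f\<in>S. \<Sum>p\<in>irr_divs f. degree p) = (\<Sum>d\<in>{1..n}. \<Sum>p\<in>irr d. d * card {f \<in> S. p pdivides f})"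
proof -
  have finS: "finite S" by (rule finite_subset[OF S finite_monics])
  have "(\<Sum>f\<in>S. \<Sum>p\<in>irr_divs f. degree p) = (\<Sum>f\<in>S. \<Sum>d\<in>{1..n}. \<Sum>p\<in>irr d. if p pdivides f then d else 0)"
  proof (rule sum.cong[OF refl])
    fix f assume "f \<in> S"
    then have f: "f \<in> monics n" using S by auto
    have "irr_divs f = (\<Union>d\<in>{1..n}. {p \<in> irr d. p pdivides f})"
      using irr_divs_sub[OF f] irrD(1) by (auto simp: irr_divs_def)
    moreover have "\<forall>i\<in>{1..n}. \<forall>j\<in>{1..n}. i \<noteq> j \<longrightarrow> {p \<in> irr i. p pdivides f} \<inter> {p \<in> irr j. p pdivides f} = {}"
      using irrD(2) by blast
    ultimately have "(\<Sum>p\<in>irr_divs f. degree p) = (\<Sum>d\<in>{1..n}. \<Sum>p\<in>{p \<in> irr d. p pdivides f}. degree p)"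
      by (simp add: sum.UNION_disjoint)
    also have "\<dots> = (\<Sum>d\<in>{1..n}. \<Sum>p\<in>irr d. if p pdivides f then d else 0)"
    proof (rule sum.cong[OF refl])
      fix d
      have "(\<Sum>p\<in>{p \<in> irr d. p pdivides f}. degree p) = (\<Sum>p\<in>irr d. if p pdivides f then degree p else 0)"
        by (rule sum.inter_filter) simp
      also have "\<dots> = (\<Sum>p\<in>irr d. if p pdivides f then d else 0)"
        using irrD(2) by (intro sum.cong) auto
      finally show "(\<Sum>p\<in>{p \<in> irr d. p pdivides f}. degree p) = (\<Sum>p\<in>irr d. if p pdivides f then d else 0)" .
    qed
    finally show "(\<Sum>p\<in>irr_divs f. degree p) = (\<Sum>d\<in>{1..n}. \<Sum>p\<in>irr d. if p pdivides f then d else 0)" .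
  qed
  also have "\<dots> = (\<Sum>d\<in>{1..n}. \<Sum>f\<in>S. \<Sum>p\<in>irr d. if p pdivides f then d else 0)" by (rule sum.swap)
  also have "\<dots> = (\<Sum>d\<in>{1..n}. \<Sum>p\<in>irr d. \<Sum>f\<in>S. if p pdivides f then d else 0)"
    by (intro sum.cong refl sum.swap)
  also have "\<dots> = (\<Sum>d\<in>{1..n}. \<Sum>p\<in>irr d. d * card {f \<in> S. p pdivides f})"
    using finS by (intro sum.cong refl) (simp add: sum.inter_filter[symmetric])
  finally show ?thesis .
qed

text \<open>Weighting a divisor by its degree makes the inner sum equal to \<open>n\<close> on
  square-free polynomials and at most \<open>n\<close> on all others, so only the latter produce an
  error. The set \<open>S\<close> will be all monic polynomials, and then those with a fixed
  constant term.\<close>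

lemma sum_irr_divs_bounds:
  assumes S: "S \<subseteq> monics n"
  shows "(\<Sum>f\<in>S. \<Sum>p\<in>irr_divs f. degree p) \<le> n * card S"
    and "n * card S \<le> (\<Sum>f\<in>S. \<Sum>p\<in>irr_divs f. degree p) + n * card {f \<in> S. \<not> sqfree f}"
proof -
  have finS: "finite S" by (rule finite_subset[OF S finite_monics])
  have "(\<Sum>f\<in>S. \<Sum>p\<in>irr_divs f. degree p) \<le> (\<Sum>f\<in>S. n)"
    using S irr_divs_cofactor(2) by (intro sum_mono) auto
  then show "(\<Sum>f\<in>S. \<Sum>p\<in>irr_divs f. degree p) \<le> n * card S" by (simp add: mult.commute)
  have "n * card S = (\<Sum>f\<in>S. n)" by simp
  also have "\<dots> \<le> (\<Sum>f\<in>S. (\<Sum>p\<in>irr_divs f. degree p) + (if \<not> sqfree f then n else 0))"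
    using S sqfree_pprod_irr_divs(2) by (intro sum_mono) auto
  also have "\<dots> = (\<Sum>f\<in>S. \<Sum>p\<in>irr_divs f. degree p) + n * card {f \<in> S. \<not> sqfree f}"
    using finS by (simp add: sum.distrib sum.inter_filter[symmetric])
  finally show "n * card S \<le> (\<Sum>f\<in>S. \<Sum>p\<in>irr_divs f. degree p) + n * card {f \<in> S. \<not> sqfree f}" .
qed

end

section \<open>The number of irreducible polynomials, overall and by constant term\<close>

context finite_field
begin

text \<open>An approximate substitute for the identity that sums \<open>d * card (irr d)\<close>
  over the divisors \<open>d\<close> of \<open>n\<close> to \<open>q^n\<close>. Here all degrees up
  to \<open>n\<close> enter, and each contributes about \<open>q^n\<close>.\<close>

lemma irr_count_sum:
  assumes n: "n \<ge> 1"
  shows "\<bar>(\<Sum>d\<in>{1..n}. real d * card (irr d) * real q ^ (n - d)) - real n * real q ^ n\<bar> \<le> real n ^ 2 * real q ^ (n - 1)"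
proof -
  have s: "(\<Sum>f\<in>monics n. \<Sum>p\<in>irr_divs f. degree p) = (\<Sum>d\<in>{1..n}. d * card (irr d) * q ^ (n - d))"
    unfolding sum_irr_divs[OF subset_refl]
  proof (intro sum.cong refl)
    fix d assume d: "d \<in> {1..n}"
    have "(\<Sum>p\<in>irr d. d * card {f \<in> monics n. p pdivides f}) = (\<Sum>p\<in>irr d. d * q ^ (n - d))"
      using d irrD(3) by (intro sum.cong refl) (simp add: card_multiples)
    then show "(\<Sum>p\<in>irr d. d * card {f \<in> monics n. p pdivides f}) = d * card (irr d) * q ^ (n - d)" by simp
  qed
  note b = sum_irr_divs_bounds[OF subset_refl, of n, unfolded s card_monics]
  have up: "(\<Sum>d\<in>{1..n}. d * card (irr d) * q ^ (n - d)) \<le> n * q ^ n" by (rule b(1))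
  have "n * card {f \<in> monics n. \<not> sqfree f} \<le> n * (n * q ^ (n - 1))"
    by (intro mult_left_mono card_not_sqfree) simp
  with b(2) have lo: "n * q ^ n \<le> (\<Sum>d\<in>{1..n}. d * card (irr d) * q ^ (n - d)) + n * (n * q ^ (n - 1))"
    by linarith
  have e: "(\<Sum>d\<in>{1..n}. real d * card (irr d) * real q ^ (n - d)) = real (\<Sum>d\<in>{1..n}. d * card (irr d) * q ^ (n - d))"
    by simp
  have "real n * real q ^ n = real (n * q ^ n)" "real n ^ 2 * real q ^ (n - 1) = real (n * (n * q ^ (n - 1)))"
    by (simp_all add: power2_eq_square)
  then show ?thesis unfolding e using up lo by linarith
qed

text \<open>In \<open>irr_count_sum\<close> the degrees below \<open>n\<close> contribute
  \<open>n - 1\<close> times \<open>q^n\<close> by induction, which leaves one \<open>q^n\<close>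
  for degree \<open>n\<close>. The factor \<open>2^n\<close> absorbs the accumulated errors.\<close>

lemma irr_count_asymp:
  assumes n: "n \<ge> 1"
  shows "\<bar>real n * card (irr n) - real q ^ n\<bar> \<le> real n ^ 2 * 2 ^ n * real q ^ (n - 1)"
  using n
proof (induction n rule: less_induct)
  case (less n)
  have split: "{1..n} = insert n {1..<n}" using less.prems by auto
  have sum: "(\<Sum>d\<in>{1..n}. real d * card (irr d) * real q ^ (n - d)) =
      real n * card (irr n) + (\<Sum>d\<in>{1..<n}. real d * card (irr d) * real q ^ (n - d))"
    unfolding split by (subst sum.insert) auto
  have "\<bar>(\<Sum>d\<in>{1..<n}. real d * card (irr d) * real q ^ (n - d)) - (real n - 1) * real q ^ n\<bar> =
      \<bar>\<Sum>d\<in>{1..<n}. real d * card (irr d) * real q ^ (n - d) - real q ^ n\<bar>"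
    using less.prems by (simp add: sum_subtractf of_nat_diff)
  also have "\<dots> \<le> (\<Sum>d\<in>{1..<n}. \<bar>real d * card (irr d) * real q ^ (n - d) - real q ^ n\<bar>)"
    by (rule sum_abs)
  also have "\<dots> \<le> (\<Sum>d\<in>{1..<n}. real n ^ 2 * 2 ^ d * real q ^ (n - 1))"
  proof (rule sum_mono)
    fix d assume d: "d \<in> {1..<n}"
    have "real d * card (irr d) * real q ^ (n - d) - real q ^ n =
        (real d * card (irr d) - real q ^ d) * real q ^ (n - d)"
      using d by (simp add: left_diff_distrib power_add[symmetric])
    then have "\<bar>real d * card (irr d) * real q ^ (n - d) - real q ^ n\<bar> =
        \<bar>real d * card (irr d) - real q ^ d\<bar> * real q ^ (n - d)" by (simp add: abs_mult)
    also have "\<dots> \<le> (real d ^ 2 * 2 ^ d * real q ^ (d - 1)) * real q ^ (n - d)"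
      using d by (intro mult_right_mono less.IH) auto
    also have "\<dots> = real d ^ 2 * 2 ^ d * real q ^ (n - 1)"
      using d by (simp add: power_add[symmetric])
    also have "\<dots> \<le> real n ^ 2 * 2 ^ d * real q ^ (n - 1)"
      using d by (intro mult_right_mono power_mono) auto
    finally show "\<bar>real d * card (irr d) * real q ^ (n - d) - real q ^ n\<bar> \<le> real n ^ 2 * 2 ^ d * real q ^ (n - 1)" .
  qed
  also have "\<dots> = real n ^ 2 * (\<Sum>d\<in>{1..<n}. 2 ^ d) * real q ^ (n - 1)"
    by (simp add: sum_distrib_left sum_distrib_right mult.assoc)
  \<comment> \<open>The missing \<open>2\<close> leaves room for the error of
    \<open>irr_count_sum\<close> itself.\<close>
  also have "(\<Sum>d\<in>{1..<n}. (2::real) ^ d) = 2 ^ n - 2"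
    using less.prems
  proof (induction n rule: dec_induct)
    case (step n)
    then show ?case by (simp add: sum.atLeastLessThan_Suc)
  qed simp
  finally have "\<bar>(\<Sum>d\<in>{1..<n}. real d * card (irr d) * real q ^ (n - d)) - (real n - 1) * real q ^ n\<bar>
      \<le> real n ^ 2 * (2 ^ n - 2) * real q ^ (n - 1)" .
  moreover have "real n ^ 2 * (2 ^ n - 2) * real q ^ (n - 1) + real n ^ 2 * real q ^ (n - 1) \<le> real n ^ 2 * 2 ^ n * real q ^ (n - 1)"
    by (simp add: algebra_simps)
  moreover have "(real n - 1) * real q ^ n = real n * real q ^ n - real q ^ n" by (simp add: left_diff_distrib)
  ultimately show ?case using irr_count_sum[OF less.prems] unfolding sum by linarith
qed

text \<open>The double count for the polynomials with constant term \<open>c\<close>. An irreducible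
  divisor of degree below \<open>n\<close> has the same number of such multiples for every nonzero
  \<open>c\<close>, so the lower degrees contribute a quantity \<open>W\<close> independent of
  \<open>c\<close>; in degree \<open>n\<close> the only multiple of \<open>p\<close> is
  \<open>p\<close>.\<close>

lemma irr_const_bounds:
  fixes n :: nat
  defines "W \<equiv> \<Sum>d\<in>{1..<n}. d * card {p \<in> irr d. const_term p \<noteq> \<zero>} * q ^ (n - d - 1)"
  assumes n: "n \<ge> 1" and c: "c \<in> carrier R" "c \<noteq> \<zero>"
  shows "W + n * card {p \<in> irr n. const_term p = c} \<le> n * q ^ (n - 1)"
    and "n * q ^ (n - 1) \<le> W + n * card {p \<in> irr n. const_term p = c}
        + n * card {f \<in> monics n. \<not> sqfree f \<and> const_term f = c}"
proof -
  let ?S = "{f \<in> monics n. const_term f = c}"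
  have sub: "?S \<subseteq> monics n" by auto
  have split: "{1..n} = insert n {1..<n}" using n by auto
  have low: "(\<Sum>p\<in>irr d. d * card {f \<in> ?S. p pdivides f}) =
      d * card {p \<in> irr d. const_term p \<noteq> \<zero>} * q ^ (n - d - 1)" if d: "d \<in> {1..<n}" for d
  proof -
    have "(\<Sum>p\<in>irr d. d * card {f \<in> ?S. p pdivides f}) =
        (\<Sum>p\<in>irr d. if const_term p \<noteq> \<zero> then d * q ^ (n - d - 1) else 0)"
    proof (rule sum.cong[OF refl])
      fix p assume p: "p \<in> irr d"
      have "d < n" using d by simp
      from card_multiples_const[OF irrD(3)[OF p] this c]
      show "d * card {f \<in> ?S. p pdivides f} = (if const_term p \<noteq> \<zero> then d * q ^ (n - d - 1) else 0)"
        by (simp del: mem_Collect_eq)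
    qed
    then show ?thesis by (simp add: sum.inter_filter[symmetric])
  qed
  have top: "(\<Sum>p\<in>irr n. n * card {f \<in> ?S. p pdivides f}) = n * card {p \<in> irr n. const_term p = c}"
  proof -
    have "{f \<in> ?S. p pdivides f} = (if const_term p = c then {p} else {})" if p: "p \<in> irr n" for p
    proof -
      have "f = p" if f: "f \<in> monics n" "p pdivides f" for f
      proof -
        obtain g where g: "g \<in> monics 0" "f = p \<star> g"
          using pdivides_monic_degree(2)[OF f(1) irrD(3)[OF p] f(2)] by auto
        have "g = \<one>\<^bsub>PR\<^esub>" using g(1) by (auto simp: monics_def univ_poly_one length_Suc_conv)
        then show "f = p" using g(2) monicsD(5)[OF irrD(3)[OF p]] by simp
      qed
      moreover have "p pdivides p"
        using pdividesI[of "\<one>\<^bsub>PR\<^esub>" p] monicsD(5)[OF irrD(3)[OF p]] by simp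
      ultimately show ?thesis using irrD(3)[OF p] by auto
    qed
    then have "(\<Sum>p\<in>irr n. n * card {f \<in> ?S. p pdivides f}) =
        (\<Sum>p\<in>irr n. if const_term p = c then n else 0)"
      by (intro sum.cong refl) auto
    then show ?thesis by (simp add: sum.inter_filter[symmetric])
  qed
  have s: "(\<Sum>f\<in>?S. \<Sum>p\<in>irr_divs f. degree p) = W + n * card {p \<in> irr n. const_term p = c}"
    unfolding sum_irr_divs[OF sub] split W_def using low top by (subst sum.insert) auto
  have cs: "card ?S = q ^ (n - 1)" by (rule card_monics_const[OF n c(1)])
  have ns: "{f \<in> ?S. \<not> sqfree f} = {f \<in> monics n. \<not> sqfree f \<and> const_term f = c}" by auto
  from sum_irr_divs_bounds[OF sub, unfolded s cs ns]
  show "W + n * card {p \<in> irr n. const_term p = c} \<le> n * q ^ (n - 1)"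
    "n * q ^ (n - 1) \<le> W + n * card {p \<in> irr n. const_term p = c}
        + n * card {f \<in> monics n. \<not> sqfree f \<and> const_term f = c}" by auto
qed

lemma card_by_const_term:
  assumes S: "S \<subseteq> monics n"
  shows "card S = card {p \<in> S. const_term p = \<zero>} + (\<Sum>c\<in>carrier R - {\<zero>}. card {p \<in> S. const_term p = c})"
proof -
  have fS: "finite S" by (rule finite_subset[OF S finite_monics])
  have "const_term p \<in> carrier R" if "p \<in> S" for p
    using that S const_term_monic[of p n] monicsD(3)[of p n n] by auto
  then have "S = (\<Union>c\<in>carrier R. {p \<in> S. const_term p = c})" by auto
  then have "card S = card (\<Union>c\<in>carrier R. {p \<in> S. const_term p = c})" by simp
  also have "\<dots> = (\<Sum>c\<in>carrier R. card {p \<in> S. const_term p = c})"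
    using fin fS by (intro card_UN_disjoint) auto
  also have "\<dots> = card {p \<in> S. const_term p = \<zero>} + (\<Sum>c\<in>carrier R - {\<zero>}. card {p \<in> S. const_term p = c})"
    using fin by (intro sum.remove) auto
  finally show ?thesis .
qed

text \<open>The estimate is summed over \<open>c\<close> because polynomials that are not
  square-free are controlled only in total, not for each constant term. The counts are first
  compared with a common value \<open>t0\<close>; the total number of irreducibles then shows that
  \<open>t0\<close> is close to \<open>1 / n\<close>.\<close>

lemma irr_const_asymp:
  assumes n: "n \<ge> 1"
  shows "(\<Sum>c\<in>carrier R - {\<zero>}. \<bar>card {p \<in> irr n. const_term p = c} / real q ^ (n - 1) - 1 / n\<bar>)
     \<le> 2 * real n + real n * 2 ^ n + 2"
proof -
  let ?C = "carrier R - {\<zero>}"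
  define Q where "Q = real q ^ (n - 1)"
  have Q: "Q > 0" using q2 unfolding Q_def by simp
  define W where "W = (\<Sum>d\<in>{1..<n}. d * card {p \<in> irr d. const_term p \<noteq> \<zero>} * q ^ (n - d - 1))"
  define t where "t c = card {p \<in> irr n. const_term p = c} / Q" for c
  define e where "e c = card {f \<in> monics n. \<not> sqfree f \<and> const_term f = c} / Q" for c
  \<comment> \<open>The value that \<open>t c\<close> would take for every \<open>c\<close> if all
    polynomials were square-free.\<close>
  define t0 where "t0 = 1 - real W / (n * Q)"
  have te: "\<bar>t c - t0\<bar> \<le> e c" if c: "c \<in> ?C" for c
  proof -
    have c': "c \<in> carrier R" "c \<noteq> \<zero>" using c by auto
    have tQ: "t c * Q = card {p \<in> irr n. const_term p = c}"
      and eQ: "e c * Q = card {f \<in> monics n. \<not> sqfree f \<and> const_term f = c}"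
      using Q by (simp_all add: t_def e_def)
    have "real (W + n * card {p \<in> irr n. const_term p = c}) \<le> real (n * q ^ (n - 1))"
      unfolding W_def by (intro of_nat_mono irr_const_bounds(1) n c')
    then have 1: "W + n * (t c * Q) \<le> n * Q" unfolding tQ by (simp add: Q_def)
    have "real (n * q ^ (n - 1)) \<le> real (W + n * card {p \<in> irr n. const_term p = c} +
        n * card {f \<in> monics n. \<not> sqfree f \<and> const_term f = c})"
      unfolding W_def by (intro of_nat_mono irr_const_bounds(2) n c')
    then have 2: "n * Q \<le> W + n * (t c * Q) + n * (e c * Q)" unfolding tQ eQ by (simp add: Q_def)
    have nQ: "real n * Q > 0" using n Q by simp
    have e1: "(t c - t0) * (n * Q) = W + n * (t c * Q) - n * Q"
      using n Q by (simp add: t0_def algebra_simps)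
    have e2: "e c * (n * Q) = n * (e c * Q)" by simp
    have "\<bar>t c - t0\<bar> * (n * Q) = \<bar>(t c - t0) * (n * Q)\<bar>"
      unfolding abs_mult[of "t c - t0"] abs_of_pos[OF nQ] ..
    also have "\<dots> \<le> e c * (n * Q)" unfolding e1 e2 using 1 2 by linarith
    finally show ?thesis using nQ by (rule mult_right_le_imp_le)
  qed
  have esum: "(\<Sum>c\<in>?C. e c) \<le> n"
  proof -
    let ?N = "{f \<in> monics n. \<not> sqfree f}"
    have "(\<Sum>c\<in>?C. card {f \<in> monics n. \<not> sqfree f \<and> const_term f = c}) \<le> card ?N"
      using card_by_const_term[of ?N n] by (simp add: conj_assoc)
    also have "\<dots> \<le> n * q ^ (n - 1)" by (rule card_not_sqfree)
    finally have "real (\<Sum>c\<in>?C. card {f \<in> monics n. \<not> sqfree f \<and> const_term f = c}) \<le> real (n * q ^ (n - 1))"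
      by (rule of_nat_mono)
    also have "\<dots> = n * Q" by (simp add: Q_def)
    finally show ?thesis unfolding e_def sum_divide_distrib[symmetric] of_nat_sum
      using Q by (simp add: pos_divide_le_eq)
  qed
  have cC: "card ?C = q - 1" using fin by simp
  have cC': "real (card ?C) = real q - 1" using cC q2 by simp
  have tt: "(\<Sum>c\<in>?C. \<bar>t c - t0\<bar>) \<le> n" by (rule order_trans[OF sum_mono[OF te] esum])
  define Y where "Y = (\<Sum>c\<in>?C. t c)"
  have "\<bar>Y - (real q - 1) * t0\<bar> = \<bar>\<Sum>c\<in>?C. t c - t0\<bar>" by (simp only: Y_def sum_subtractf sum_constant cC')
  also have "\<dots> \<le> n" by (rule order_trans[OF sum_abs tt])
  finally have X1: "\<bar>Y - (real q - 1) * t0\<bar> \<le> n" .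
  \<comment> \<open>Irreducibles with constant term zero, such as \<open>X\<close> for
    \<open>n = 1\<close>, are missed by the sum over nonzero \<open>c\<close>.\<close>
  define a0 where "a0 = card {p \<in> irr n. const_term p = \<zero>} / Q"
  have a0: "0 \<le> a0" "a0 \<le> 1"
  proof -
    have "card {p \<in> irr n. const_term p = \<zero>} \<le> card {p \<in> monics n. const_term p = \<zero>}"
      using irr_subset by (intro card_mono) auto
    also have "\<dots> = q ^ (n - 1)" by (rule card_monics_const[OF n zero_closed])
    finally have "real (card {p \<in> irr n. const_term p = \<zero>}) \<le> Q" unfolding Q_def by (metis of_nat_le_iff of_nat_power)
    then show "0 \<le> a0" "a0 \<le> 1" unfolding a0_def using Q by auto
  qed
  have X2: "Y = card (irr n) / Q - a0"
    unfolding Y_def t_def a0_def using card_by_const_term[OF irr_subset, of n]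
    by (simp add: sum_divide_distrib[symmetric] add_divide_distrib)
  have qQ: "real q ^ n = q * Q" using n unfolding Q_def by (cases n) auto
  have "\<bar>card (irr n) / Q - q / n\<bar> * (n * Q) = \<bar>(card (irr n) / Q - q / n) * (n * Q)\<bar>"
    using n Q by (simp add: abs_mult)
  also have "(card (irr n) / Q - q / n) * (n * Q) = real n * card (irr n) - real q ^ n"
    using n Q by (simp add: qQ field_simps)
  also have "\<bar>\<dots>\<bar> \<le> (n * 2 ^ n) * (n * Q)"
    using irr_count_asymp[OF n] unfolding Q_def by (simp add: power2_eq_square mult.assoc mult.left_commute)
  finally have X3: "\<bar>card (irr n) / Q - q / n\<bar> \<le> n * 2 ^ n" using n Q by (simp add: mult.commute)
  have n1: "0 \<le> 1 / real n" "1 / real n \<le> 1" using n by auto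
  \<comment> \<open>The \<open>2\<close> is a crude allowance for \<open>a0\<close> and
    \<open>1 / n\<close>.\<close>
  have "\<bar>Y - (real q - 1) / n\<bar> \<le> n * 2 ^ n + 2"
    using X3 a0 n1 unfolding X2 diff_divide_distrib by linarith
  then have X4: "\<bar>(real q - 1) * t0 - (real q - 1) / n\<bar> \<le> n + n * 2 ^ n + 2" using X1 by linarith
  have "(\<Sum>c\<in>?C. \<bar>t c - 1 / n\<bar>) \<le> (\<Sum>c\<in>?C. \<bar>t c - t0\<bar> + \<bar>t0 - 1 / n\<bar>)" by (intro sum_mono) auto
  also have "\<dots> = (\<Sum>c\<in>?C. \<bar>t c - t0\<bar>) + (real q - 1) * \<bar>t0 - 1 / n\<bar>" by (simp only: sum.distrib sum_constant cC')
  also have "(real q - 1) * \<bar>t0 - 1 / n\<bar> = \<bar>(real q - 1) * t0 - (real q - 1) / n\<bar>"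
  proof -
    have "(real q - 1) * t0 - (real q - 1) / n = (real q - 1) * (t0 - 1 / n)"
      by (simp add: right_diff_distrib)
    then show ?thesis using q2 by (simp add: abs_mult)
  qed
  also have "(\<Sum>c\<in>?C. \<bar>t c - t0\<bar>) + \<bar>(real q - 1) * t0 - (real q - 1) / n\<bar> \<le> 2 * real n + real n * 2 ^ n + 2"
    using tt X4 by simp
  finally show ?thesis unfolding t_def Q_def .
qed

subsection \<open>Factorization types\<close>

text \<open>Each divisor is counted once, whatever its multiplicity; the comparison with the cycle
  type is made for square-free polynomials.\<close>

definition fac_type :: "'a list \<Rightarrow> nat multiset" where
  "fac_type f = image_mset (\<lambda>p. degree p) (mset_set (irr_divs f))"

lemma count_degrees:
  assumes "finite A" "A \<subseteq> irrs"
  shows "count (image_mset (\<lambda>p. degree p) (mset_set A)) i = card (A \<inter> irr i)"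
proof -
  have "A \<inter> irr i = {p \<in> A. degree p = i}" using assms irrD(2) irrsD(5) by blast
  moreover have "count (image_mset (\<lambda>p. degree p) (mset_set A)) i = card {p \<in> A. degree p = i}"
  proof -
    have "count (image_mset (\<lambda>p. degree p) (mset_set A)) i =
        (\<Sum>p\<in>{p \<in> A. degree p = i}. count (mset_set A) p)"
      using assms(1) unfolding count_image_mset by (intro sum.cong) auto
    also have "\<dots> = (\<Sum>p\<in>{p \<in> A. degree p = i}. 1)" using assms(1) by (intro sum.cong) auto
    finally show ?thesis by simp
  qed
  ultimately show ?thesis by simp
qed

text \<open>A square-free polynomial is a set of monic irreducibles, and type \<open>\<mu>\<close>
  means that \<open>count \<mu> i\<close> of them have degree \<open>i\<close>; these choices are
  independent for different \<open>i\<close>.\<close>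

lemma card_sqfree_type:
  assumes mu: "partition_of n \<mu>"
  shows "card {f \<in> monics n. sqfree f \<and> fac_type f = \<mu>} = (\<Prod>i\<in>set_mset \<mu>. card (irr i) choose count \<mu> i)"
proof -
  let ?F = "{f \<in> monics n. sqfree f \<and> fac_type f = \<mu>}"
  let ?B = "PiE (set_mset \<mu>) (\<lambda>i. {B. B \<subseteq> irr i \<and> card B = count \<mu> i})"
  let ?\<phi> = "\<lambda>f. \<lambda>i\<in>set_mset \<mu>. irr_divs f \<inter> irr i"
  have D: "finite (irr_divs f)" "irr_divs f \<subseteq> irrs" if "f \<in> ?F" for f
    using that finite_irr_divs by (auto simp: irr_divs_def)
  have Dmu: "count \<mu> i = card (irr_divs f \<inter> irr i)" if "f \<in> ?F" for f i
    using count_degrees[OF D[OF that]] that by (auto simp: fac_type_def)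
  have Dun: "irr_divs f = (\<Union>i\<in>set_mset \<mu>. irr_divs f \<inter> irr i)" if f: "f \<in> ?F" for f
  proof
    show "irr_divs f \<subseteq> (\<Union>i\<in>set_mset \<mu>. irr_divs f \<inter> irr i)"
    proof
      fix p assume p: "p \<in> irr_divs f"
      then have pi: "p \<in> irr_divs f \<inter> irr (degree p)" using D(2)[OF f] irrsD(5) by blast
      then have "count \<mu> (degree p) > 0" using D(1)[OF f] unfolding Dmu[OF f] by (auto simp: card_gt_0_iff)
      then have "degree p \<in># \<mu>" by simp
      then show "p \<in> (\<Union>i\<in>set_mset \<mu>. irr_divs f \<inter> irr i)" using pi by blast
    qed
  qed auto
  have "bij_betw ?\<phi> ?F ?B"
  proof (rule bij_betw_imageI)
    show "inj_on ?\<phi> ?F"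
    proof (rule inj_onI)
      fix f g assume f: "f \<in> ?F" and g: "g \<in> ?F" and e: "?\<phi> f = ?\<phi> g"
      have "irr_divs f \<inter> irr i = irr_divs g \<inter> irr i" if "i \<in># \<mu>" for i
        using fun_cong[OF e, of i] that by simp
      then have "irr_divs f = irr_divs g" using Dun[OF f] Dun[OF g] by (metis (no_types, lifting) SUP_cong)
      then show "f = g" using sqfree_pprod_irr_divs(1)[of f n] sqfree_pprod_irr_divs(1)[of g n] f g by simp
    qed
    show "?\<phi> ` ?F = ?B"
    proof (intro equalityI subsetI)
      fix b assume "b \<in> ?\<phi> ` ?F"
      then show "b \<in> ?B" using Dmu by auto
    next
      fix b assume b: "b \<in> ?B"
      have bi: "b i \<subseteq> irr i" "card (b i) = count \<mu> i" if "i \<in># \<mu>" for i using b that by auto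
      define A where "A = (\<Union>i\<in>set_mset \<mu>. b i)"
      have A1: "finite A" unfolding A_def by (rule finite_UN_I[OF finite_set_mset]) (rule finite_subset[OF bi(1) finite_irr])
      have A2: "A \<subseteq> irrs" unfolding A_def using bi(1) irrD(1) by blast
      have Ai: "A \<inter> irr i = (if i \<in># \<mu> then b i else {})" for i
      proof -
        have "b j \<inter> irr i = {}" if "j \<in># \<mu>" "j \<noteq> i" for j
          using bi(1)[OF that(1)] irrD(2) that(2) by blast
        then show ?thesis unfolding A_def using bi(1)[of i] by (cases "i \<in># \<mu>") auto
      qed
      have ty: "image_mset (\<lambda>p. degree p) (mset_set A) = \<mu>"
      proof (rule multiset_eqI)
        fix i show "count (image_mset (\<lambda>p. degree p) (mset_set A)) i = count \<mu> i"
          unfolding count_degrees[OF A1 A2] Ai using bi(2)[of i] by (auto simp: not_in_iff)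
      qed
      have "(\<Sum>p\<in>A. degree p) = \<Sum>\<^sub># (image_mset (\<lambda>p. degree p) (mset_set A))"
        by (simp add: sum_unfold_sum_mset)
      then have "(\<Sum>p\<in>A. degree p) = n" using ty mu by (simp add: partition_of_def)
      then have mem: "pprod A \<in> ?F"
        using pprod_monic[OF A1 A2] sqfree_pprod[OF A1 A2] ty by (simp add: fac_type_def irr_divs_pprod[OF A1 A2])
      have eq: "?\<phi> (pprod A) = b"
      proof
        fix i show "?\<phi> (pprod A) i = b i"
          using b by (auto simp: irr_divs_pprod[OF A1 A2] Ai)
      qed
      show "b \<in> ?\<phi> ` ?F" by (rule image_eqI[where f="?\<phi>", OF eq[symmetric] mem])
    qed
  qed
  then have "card ?F = card ?B" by (rule bij_betw_same_card)
  also have "\<dots> = (\<Prod>i\<in>set_mset \<mu>. card {B. B \<subseteq> irr i \<and> card B = count \<mu> i})"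
    by (rule card_PiE) simp
  also have "\<dots> = (\<Prod>i\<in>set_mset \<mu>. card (irr i) choose count \<mu> i)"
    by (intro prod.cong refl n_subsets) simp
  finally show ?thesis .
qed

lemma foldr_pprod:
  assumes "distinct fs" "set fs \<subseteq> irrs"
  shows "foldr (\<star>) fs \<one>\<^bsub>PR\<^esub> = pprod (set fs)"
  using assms by (induction fs) (auto simp: pprod_insert[simplified])

lemma monic_mult_of:
  assumes f: "f \<in> monics n" and n: "n \<ge> 1"
  shows "f \<in> carrier (Ring_Divisibility.mult_of PR)" "f \<notin> Units (Ring_Divisibility.mult_of PR)"
proof -
  show "f \<in> carrier (Ring_Divisibility.mult_of PR)" using monicsD(4,5)[OF f] by (simp add: univ_poly_zero)
  show "f \<notin> Units (Ring_Divisibility.mult_of PR)"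
    using univ_poly_units'[OF carrier_is_subfield, of f] monicsD(1)[OF f] n by simp
qed

lemma cycle_type_sqfree:
  assumes f: "charpoly_over R A \<in> monics n" and n: "n \<ge> 1" and sq: "sqfree (charpoly_over R A)"
  shows "cycle_type R A = fac_type (charpoly_over R A)"
proof -
  let ?f = "charpoly_over R A" and ?M = "Ring_Divisibility.mult_of PR"
  have fld: "field R" by (rule field_axioms)
  have fi: "finite (irr_divs ?f)" "irr_divs ?f \<subseteq> irrs" using finite_irr_divs[OF f] by (auto simp: irr_divs_def)
  obtain fs where fs: "set fs = irr_divs ?f" "distinct fs" using finite_distinct_list[OF fi(1)] by blast
  have "foldr (\<star>) fs \<one>\<^bsub>PR\<^esub> = ?f"
    using foldr_pprod[OF fs(2)] fi fs(1) sqfree_pprod_irr_divs(1)[OF f sq] by simp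
  moreover have "Divisibility.irreducible ?M p" if "p \<in> set fs" for p
    using P.ring_irreducibleE(3) irrsD(1,3) fi fs(1) that by blast
  ultimately have "factors ?M fs ?f" by (simp add: factors_def)
  moreover have "set fs \<subseteq> carrier ?M" using irrsD(1,2) fi fs(1) by (auto simp: univ_poly_zero)
  moreover have "fac_type ?f = mset (map (\<lambda>f. degree f) fs)"
    unfolding fac_type_def fs(1)[symmetric] using fs(2) by (simp add: mset_set_set)
  ultimately have "\<exists>fs. set fs \<subseteq> carrier ?M \<and> factors ?M fs ?f \<and> fac_type ?f = mset (map (\<lambda>f. degree f) fs)"
    by blast
  then show ?thesis unfolding cycle_type_def
    by (rule the1_equality[OF cycle_type_unique[OF fld monic_mult_of[OF f n]]])
qed

lemma sqfree_irr:
  assumes "p \<in> irr n" shows "sqfree p" "fac_type p = {#n#}" "irr_divs p = {p}"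
proof -
  have pi: "{p} \<subseteq> irrs" "finite {p}" using irrD(1)[OF assms] by auto
  have "pprod {p} = p" using pprod_insert[of "{}" p] pi irrsD(1) by auto
  then show "sqfree p" "irr_divs p = {p}" using sqfree_pprod[OF pi(2,1)] irr_divs_pprod[OF pi(2,1)] by auto
  then show "fac_type p = {#n#}" using irrD(2)[OF assms] by (simp add: fac_type_def)
qed

text \<open>A type with a single part forces the list of irreducible factors to have length one, so
  square-freeness is a consequence here.\<close>

lemma cycle_type_irr:
  assumes f: "charpoly_over R A \<in> monics n" and n: "n \<ge> 1"
  shows "cycle_type R A = {#n#} \<longleftrightarrow> charpoly_over R A \<in> irr n"
proof
  let ?f = "charpoly_over R A" and ?M = "Ring_Divisibility.mult_of PR"
  have fld: "field R" by (rule field_axioms)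
  assume c: "cycle_type R A = {#n#}"
  have "\<exists>fs. set fs \<subseteq> carrier ?M \<and> factors ?M fs ?f \<and> cycle_type R A = mset (map (\<lambda>f. degree f) fs)"
    unfolding cycle_type_def by (rule theI'[OF cycle_type_unique[OF fld monic_mult_of[OF f n]]])
  then obtain fs where fs: "set fs \<subseteq> carrier ?M" "factors ?M fs ?f" "{#n#} = mset (map (\<lambda>f. degree f) fs)"
    using c by auto
  have "length fs = 1" using arg_cong[OF fs(3), of size] by simp
  then obtain g where g: "fs = [g]" by (auto simp: length_Suc_conv)
  then have "g \<in> carrier PR" "g \<noteq> \<zero>\<^bsub>PR\<^esub>" "?f = g" "Divisibility.irreducible ?M g"
    using fs by (auto simp: factors_def)
  then have "pirreducible (carrier R) ?f"
    using P.irreducible_mult_imp_irreducible[of g] by (auto simp: ring_irreducible_def)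
  then show "?f \<in> irr n" using f by (simp add: irr_def)
next
  assume "charpoly_over R A \<in> irr n"
  then show "cycle_type R A = {#n#}" using cycle_type_sqfree[OF f n] sqfree_irr by simp
qed

text \<open>The left side quantifies over all irreducible polynomials, the right side over monic
  ones; a unit factor can be moved from the square into the cofactor.\<close>

lemma regular_semisimple_sqfree:
  "regular_semisimple R A \<longleftrightarrow> sqfree (charpoly_over R A)"
proof -
  let ?f = "charpoly_over R A"
  have sqr: "p [^]\<^bsub>PR\<^esub> (2::nat) = p \<star> p" if "p \<in> carrier PR" for p
    using that by (simp add: numeral_2_eq_2)
  have "(\<exists>p\<in>carrier PR. pirreducible (carrier R) p \<and> (p [^]\<^bsub>PR\<^esub> (2::nat)) pdivides ?f) \<longleftrightarrow>
      (\<exists>p\<in>irrs. (p \<star> p) pdivides ?f)"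
  proof
    assume "\<exists>p\<in>carrier PR. pirreducible (carrier R) p \<and> (p [^]\<^bsub>PR\<^esub> (2::nat)) pdivides ?f"
    then obtain p where p: "p \<in> carrier PR" "pirreducible (carrier R) p" "(p \<star> p) pdivides ?f" using sqr by auto
    obtain k where k: "k \<in> carrier R - {\<zero>}" "[k] \<star> p \<in> irrs" using ex_irr_associate[OF p(1,2)] by auto
    have ku: "[k] \<in> Units PR" using k univ_poly_carrier_units by auto
    let ?i = "inv\<^bsub>PR\<^esub> [k]"
    have kc: "[k] \<in> carrier PR" "?i \<in> carrier PR" using P.Units_closed[OF ku] P.Units_inv_closed[OF ku] .
    obtain g where g: "g \<in> carrier PR" "?f = p \<star> p \<star> g" using p(3) by (rule pdividesE)
    have "([k] \<star> p \<star> ([k] \<star> p)) \<star> (?i \<star> ?i \<star> g) =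
       ([k] \<star> ?i) \<star> ([k] \<star> ?i) \<star> (p \<star> p \<star> g)"
      using kc p(1) g(1) by (simp add: P.m_ac)
    also have "\<dots> = ?f" using ku p(1) g by simp
    finally have "([k] \<star> p \<star> ([k] \<star> p)) pdivides ?f"
      using pdividesI[of "?i \<star> ?i \<star> g" "[k] \<star> p \<star> ([k] \<star> p)"] kc g(1) by simp
    then show "\<exists>p\<in>irrs. (p \<star> p) pdivides ?f" using k(2) by blast
  next
    assume "\<exists>p\<in>irrs. (p \<star> p) pdivides ?f"
    then obtain p where p: "p \<in> irrs" "(p \<star> p) pdivides ?f" by blast
    then show "\<exists>p\<in>carrier PR. pirreducible (carrier R) p \<and> (p [^]\<^bsub>PR\<^esub> (2::nat)) pdivides ?f"
      using irrsD(1,3)[OF p(1)] sqr[of p] by (intro bexI[of _ p]) simp_all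
  qed
  then show ?thesis unfolding regular_semisimple_def sqfree_def by blast
qed

end

section \<open>Characteristic polynomials\<close>

lemma (in ring) finsum_uminus:
  assumes "\<And>i. i \<in> A \<Longrightarrow> f i \<in> carrier R"
  shows "(\<Oplus>i\<in>A. \<ominus> f i) = \<ominus> (\<Oplus>i\<in>A. f i)"
proof (cases "finite A")
  case True
  have "(\<Oplus>i\<in>A. \<ominus> f i) = (\<Oplus>i\<in>A. (\<ominus> \<one>) \<otimes> f i)"
    using assms by (intro finsum_cong') (auto simp: l_minus)
  also have "\<dots> = (\<ominus> \<one>) \<otimes> (\<Oplus>i\<in>A. f i)"
    using assms True by (intro finsum_rdistr[symmetric]) auto
  also have "\<dots> = \<ominus> (\<Oplus>i\<in>A. f i)" using assms by (simp add: l_minus)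
  finally show ?thesis .
qed simp

lemma (in ring) minus_cancel:
  assumes "x \<in> carrier R" "y \<in> carrier R" "z \<in> carrier R" "x \<ominus> y = x \<ominus> z"
  shows "y = z"
proof -
  have "\<ominus> y = \<ominus> z" using assms by (simp add: minus_eq)
  then show ?thesis using assms minus_minus by metis
qed

context domain
begin

lemma poly_of_const_hom: "ring_hom_cring R (poly_ring R) poly_of_const"
proof -
  interpret P: domain "poly_ring R" by (rule univ_poly_is_domain[OF carrier_is_subring])
  show ?thesis
    using canonical_embedding_is_hom[OF carrier_is_subring] by unfold_locales simp
qed

lemma const_term_hom: "ring_hom_cring (poly_ring R) R const_term"
proof -
  interpret P: domain "poly_ring R" by (rule univ_poly_is_domain[OF carrier_is_subring])
  show ?thesis
  proof unfold_locales
    show "const_term \<in> Ring.ring_hom (poly_ring R) R"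
      using const_term_simprules_shell[OF carrier_is_subring]
      by (intro ring_hom_memI) (auto simp: univ_poly_one const_term_def)
  qed
qed

text \<open>One Horner step appends a coefficient, so the prefixes of a coefficient list are its
  Horner values.\<close>

lemma var_mult_add_const:
  assumes q: "q \<in> carrier (poly_ring R)" "q \<noteq> []" and a: "a \<in> carrier R"
  shows "(X \<otimes>\<^bsub>poly_ring R\<^esub> q) \<oplus>\<^bsub>poly_ring R\<^esub> poly_of_const a = q @ [a]"
proof -
  interpret P: domain "poly_ring R" by (rule univ_poly_is_domain[OF carrier_is_subring])
  have X: "X \<in> carrier (poly_ring R)" by (rule var_closed(1)[OF carrier_is_subring])
  have "X \<otimes>\<^bsub>poly_ring R\<^esub> q = q @ [\<zero>]"
    using poly_mult_var[OF carrier_is_subring q(1)] q X P.m_comm by simp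
  moreover have sq: "set q \<subseteq> carrier R" and lq: "lead_coeff q \<noteq> \<zero>"
    using q univ_poly_carrier[of R "carrier R" q] by (auto simp: polynomial_def)
  have rz: "map2 (\<oplus>) q (replicate (length q) \<zero>) = q"
    using sq by (induction q) auto
  have nq: "normalize (q @ [b]) = q @ [b]" for b using q(2) lq by (cases q) auto
  have "poly_add (q @ [\<zero>]) (poly_of_const a) = q @ [a]"
  proof (cases "a = \<zero>")
    case True
    have "replicate (Suc (length q)) \<zero> = replicate (length q) \<zero> @ [\<zero>]"
      by (simp add: replicate_append_same)
    then have "map2 (\<oplus>) (q @ [\<zero>]) (replicate (Suc (length q)) \<zero>) = q @ [\<zero>]"
      using rz by (simp del: replicate_Suc)
    then show ?thesis using True nq by (simp add: poly_of_const_def)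
  next
    case False
    then show ?thesis using rz nq a by (simp add: poly_of_const_def)
  qed
  ultimately show ?thesis by (simp add: univ_poly_add)
qed

end

definition charmat :: "('a, 'b) ring_scheme \<Rightarrow> nat \<Rightarrow> 'a mat \<Rightarrow> 'a list mat" where
  "charmat R n A = mat n n (\<lambda>(i, j). (if i = j then X\<^bsub>R\<^esub> else \<zero>\<^bsub>poly_ring R\<^esub>)
     \<ominus>\<^bsub>poly_ring R\<^esub> ring.poly_of_const R (A $$ (i, j)))"

lemma charpoly_over_charmat:
  "A \<in> carrier (mat_over R n) \<Longrightarrow> charpoly_over R A = det_over (poly_ring R) (charmat R n A)"
  by (simp add: charpoly_over_def charmat_def)

locale matrix_field = polynomial_field + fixes n :: nat
  assumes n: "n \<ge> 1"
begin

abbreviation M where "M \<equiv> mat_over R n"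
abbreviation MP where "MP \<equiv> mat_over (poly_ring R) n"
abbreviation mmult (infixl \<open>\<diamondop>\<close> 70) where "A \<diamondop> B \<equiv> A \<otimes>\<^bsub>mat_over R n\<^esub> B"

sublocale c: ring_hom_cring R PR poly_of_const by (rule poly_of_const_hom)
sublocale ct: ring_hom_cring PR R const_term by (rule const_term_hom)
sublocale M: monoid M by (rule monoid_mat_over)
sublocale MP: monoid MP by (rule P.monoid_mat_over)
sublocale GL: group "GL R n" by (rule group_GL)

lemma X_closed [simp]: "X \<in> carrier PR" by (rule var_closed(1)[OF carrier_is_subring])

lemma charmat_closed [simp, intro]: "A \<in> carrier M \<Longrightarrow> charmat R n A \<in> carrier MP"
  unfolding charmat_def by (intro mat_in_mat_over) auto

lemma charmat_entry:
  assumes "A \<in> carrier M" "i < n" "j < n"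
  shows "charmat R n A $$ (i, j) =
     (if i = j then X else \<zero>\<^bsub>PR\<^esub>) \<oplus>\<^bsub>PR\<^esub> poly_of_const (\<ominus> (A $$ (i, j)))"
  using assms by (simp add: charmat_def P.minus_eq)

lemma charpoly_closed: "A \<in> carrier M \<Longrightarrow> charpoly_over R A \<in> carrier PR"
  by (simp add: charpoly_over_charmat P.det_over_closed[where n=n])

definition constmat :: "'a mat \<Rightarrow> 'a list mat" where
  "constmat K = mat n n (\<lambda>ij. poly_of_const (K $$ ij))"

lemma constmat_closed [simp]: "K \<in> carrier M \<Longrightarrow> constmat K \<in> carrier MP"
  unfolding constmat_def by (intro mat_in_mat_over) auto

lemma constmat_entry [simp]: "i < n \<Longrightarrow> j < n \<Longrightarrow> constmat K $$ (i, j) = poly_of_const (K $$ (i, j))"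
  by (simp add: constmat_def)

lemma det_constmat: "K \<in> carrier M \<Longrightarrow> det_over PR (constmat K) = poly_of_const (det_over R K)"
  unfolding constmat_def by (rule c.det_over_hom[symmetric])

text \<open>The indeterminate commutes with constants, so \<open>K\<close> intertwines
  \<open>X - A\<close> and \<open>X - B\<close> as soon as it intertwines \<open>A\<close> and
  \<open>B\<close>.\<close>

lemma charmat_intertwine:
  assumes K: "K \<in> carrier M" and A: "A \<in> carrier M" and B: "B \<in> carrier M"
    and eq: "K \<diamondop> A = B \<diamondop> K"
  shows "constmat K \<otimes>\<^bsub>MP\<^esub> charmat R n A = charmat R n B \<otimes>\<^bsub>MP\<^esub> constmat K"
proof (rule mat_over_eqI)
  fix i j assume ij: "i < n" "j < n"
  let ?c = poly_of_const
  have "(constmat K \<otimes>\<^bsub>MP\<^esub> charmat R n A) $$ (i, j) =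
     (\<Oplus>\<^bsub>PR\<^esub>l\<in>{..<n}. (if l = j then ?c (K $$ (i, l)) \<star> X else \<zero>\<^bsub>PR\<^esub>)
        \<oplus>\<^bsub>PR\<^esub> ?c (\<ominus> (K $$ (i, l) \<otimes> A $$ (l, j))))"
    unfolding mat_over_mult_entry[OF ij]
    using ij K A by (intro P.finsum_cong' refl) (auto simp: charmat_entry P.r_distr P.r_minus)
  also have "\<dots> = (\<Oplus>\<^bsub>PR\<^esub>l\<in>{..<n}. (if l = j then ?c (K $$ (i, l)) \<star> X else \<zero>\<^bsub>PR\<^esub>))
      \<oplus>\<^bsub>PR\<^esub> (\<Oplus>\<^bsub>PR\<^esub>l\<in>{..<n}. ?c (\<ominus> (K $$ (i, l) \<otimes> A $$ (l, j))))"
    using ij K A by (intro P.finsum_addf) auto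
  also have "(\<Oplus>\<^bsub>PR\<^esub>l\<in>{..<n}. (if l = j then ?c (K $$ (i, l)) \<star> X else \<zero>\<^bsub>PR\<^esub>)) =
      ?c (K $$ (i, j)) \<star> X"
    using ij K P.finsum_delta[of "{..<n}" j "\<lambda>l. ?c (K $$ (i, l)) \<star> X"] by auto
  also have "(\<Oplus>\<^bsub>PR\<^esub>l\<in>{..<n}. ?c (\<ominus> (K $$ (i, l) \<otimes> A $$ (l, j)))) =
      ?c (\<Oplus>l\<in>{..<n}. \<ominus> (K $$ (i, l) \<otimes> A $$ (l, j)))"
    using ij K A by (subst c.hom_finsum) (auto simp: o_def)
  also have "(\<Oplus>l\<in>{..<n}. \<ominus> (K $$ (i, l) \<otimes> A $$ (l, j))) = \<ominus> ((K \<diamondop> A) $$ (i, j))"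
    using ij K A by (subst finsum_uminus) auto
  also have "\<dots> = (\<Oplus>l\<in>{..<n}. \<ominus> (B $$ (i, l) \<otimes> K $$ (l, j)))"
    unfolding eq using ij K B by (subst finsum_uminus) auto
  also have "?c \<dots> = (\<Oplus>\<^bsub>PR\<^esub>l\<in>{..<n}. ?c (\<ominus> (B $$ (i, l) \<otimes> K $$ (l, j))))"
    using ij K B by (subst c.hom_finsum) (auto simp: o_def)
  also have "?c (K $$ (i, j)) \<star> X =
      (\<Oplus>\<^bsub>PR\<^esub>l\<in>{..<n}. (if l = i then X \<star> ?c (K $$ (l, j)) else \<zero>\<^bsub>PR\<^esub>))"
    using ij K P.finsum_delta[of "{..<n}" i "\<lambda>l. X \<star> ?c (K $$ (l, j))"] by (auto simp: P.m_comm)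
  also have "\<dots> \<oplus>\<^bsub>PR\<^esub> (\<Oplus>\<^bsub>PR\<^esub>l\<in>{..<n}. ?c (\<ominus> (B $$ (i, l) \<otimes> K $$ (l, j)))) =
     (\<Oplus>\<^bsub>PR\<^esub>l\<in>{..<n}. (if l = i then X \<star> ?c (K $$ (l, j)) else \<zero>\<^bsub>PR\<^esub>) \<oplus>\<^bsub>PR\<^esub>
        ?c (\<ominus> (B $$ (i, l) \<otimes> K $$ (l, j))))"
    using ij K B by (intro P.finsum_addf[symmetric]) auto
  also have "\<dots> = (charmat R n B \<otimes>\<^bsub>MP\<^esub> constmat K) $$ (i, j)"
    unfolding mat_over_mult_entry[OF ij]
    using ij K B by (intro P.finsum_cong' refl) (auto simp: charmat_entry P.l_distr P.l_minus)
  finally show "(constmat K \<otimes>\<^bsub>MP\<^esub> charmat R n A) $$ (i, j) =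
    (charmat R n B \<otimes>\<^bsub>MP\<^esub> constmat K) $$ (i, j)" .
qed (use K A B in \<open>auto intro!: MP.m_closed\<close>)

lemma det_unit:
  assumes "K \<in> Units M"
  shows "det_over R K \<in> carrier R" "det_over R K \<noteq> \<zero>"
proof -
  have K: "K \<in> carrier M" and I: "inv\<^bsub>M\<^esub> K \<in> carrier M" using assms by auto
  show "det_over R K \<in> carrier R" using K by auto
  have "det_over R K \<otimes> det_over R (inv\<^bsub>M\<^esub> K) = \<one>"
    using assms by (simp add: det_over_mult[OF K I, symmetric] det_over_one)
  then show "det_over R K \<noteq> \<zero>" using I det_over_closed[OF I] by auto
qed

text \<open>Taking determinants in \<open>charmat_intertwine\<close> leaves the nonzero constant
  \<open>det_over R K\<close> on both sides, which cancels in a domain.\<close>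

lemma charpoly_conj:
  assumes K: "K \<in> Units M" and A: "A \<in> carrier M" and B: "B \<in> carrier M"
    and eq: "K \<diamondop> A = B \<diamondop> K"
  shows "charpoly_over R A = charpoly_over R B"
proof -
  have Kc: "K \<in> carrier M" using K by auto
  let ?d = "det_over PR (constmat K)"
  have d: "?d \<in> carrier PR" "?d \<noteq> \<zero>\<^bsub>PR\<^esub>"
    using det_unit[OF K] P.det_over_closed[OF constmat_closed[OF Kc]]
    by (auto simp: det_constmat[OF Kc] poly_of_const_def univ_poly_zero)
  have "?d \<star> charpoly_over R A = charpoly_over R B \<star> ?d"
    using charmat_intertwine[OF Kc A B eq] Kc A B
      P.det_over_mult[of "constmat K" n "charmat R n A"] P.det_over_mult[of "charmat R n B" n "constmat K"]
    by (simp add: charpoly_over_charmat)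
  then show ?thesis
    using d charpoly_closed[OF A] charpoly_closed[OF B] P.m_lcancel[of ?d] P.m_comm by metis
qed

text \<open>This is \<open>(-1)^n\<close>, kept in the form in which it arises; what is used of it
  is that it is nonzero.\<close>

definition negdet :: 'a where
  "negdet = det_over R (mat n n (\<lambda>(i, j). if i = j then \<ominus> \<one> else \<zero>))"

lemma negdet: "negdet \<in> carrier R" "negdet \<noteq> \<zero>"
proof -
  let ?N = "mat n n (\<lambda>(i, j). if i = j then \<ominus> \<one> else \<zero>)"
  have N: "?N \<in> carrier M" by (intro mat_in_mat_over) auto
  have NN: "?N \<diamondop> ?N = \<one>\<^bsub>M\<^esub>"
  proof (rule mat_over_eqI[OF _ M.one_closed])
    fix i j assume ij: "i < n" "j < n"
    have "(?N \<diamondop> ?N) $$ (i, j) = (\<Oplus>l\<in>{..<n}. if l = i then (if i = j then \<one> else \<zero>) else \<zero>)"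
      unfolding mat_over_mult_entry[OF ij] using ij by (intro finsum_cong' refl) (auto simp: l_minus)
    also have "\<dots> = \<one>\<^bsub>M\<^esub> $$ (i, j)"
      using ij by (subst finsum_delta) auto
    finally show "(?N \<diamondop> ?N) $$ (i, j) = \<one>\<^bsub>M\<^esub> $$ (i, j)" .
  qed (use N in auto)
  then have "?N \<in> Units M" using N by (auto simp: Units_def)
  then show "negdet \<in> carrier R" "negdet \<noteq> \<zero>" using det_unit unfolding negdet_def by auto
qed

text \<open>Evaluating \<open>X - A\<close> at zero gives \<open>-A\<close>, the product of a scalar
  matrix and \<open>A\<close>.\<close>

lemma const_term_charpoly:
  assumes A: "A \<in> carrier M"
  shows "const_term (charpoly_over R A) = negdet \<otimes> det_over R A"
proof -
  let ?N = "mat n n (\<lambda>(i, j). if i = j then \<ominus> \<one> else \<zero>)"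
  have N: "?N \<in> carrier M" by (intro mat_in_mat_over) auto
  have cX: "const_term X = \<zero>" by (simp add: const_term_def eval_var)
  have cc: "const_term (poly_of_const a) = a" if "a \<in> carrier R" for a
    using that by (auto simp: const_term_def poly_of_const_def)
  have "const_term (charpoly_over R A) = det_over R (mat n n (\<lambda>ij. const_term (charmat R n A $$ ij)))"
    unfolding charpoly_over_charmat[OF A] using A by (intro ct.det_over_hom) auto
  also have "mat n n (\<lambda>ij. const_term (charmat R n A $$ ij)) = ?N \<diamondop> A"
  proof (rule mat_over_eqI)
    fix i j assume ij: "i < n" "j < n"
    have "(?N \<diamondop> A) $$ (i, j) = (\<Oplus>l\<in>{..<n}. if l = i then \<ominus> (A $$ (l, j)) else \<zero>)"
      unfolding mat_over_mult_entry[OF ij] using ij A by (intro finsum_cong' refl) (auto simp: l_minus)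
    also have "\<dots> = \<ominus> (A $$ (i, j))"
      using ij A finsum_delta[of "{..<n}" i "\<lambda>l. \<ominus> (A $$ (l, j))"] by auto
    also have "\<dots> = const_term (charmat R n A $$ (i, j))"
      unfolding charmat_entry[OF A ij] using A ij by (subst ct.hom_add) (auto simp: cX cc)
    finally show "mat n n (\<lambda>ij. const_term (charmat R n A $$ ij)) $$ (i, j) = (?N \<diamondop> A) $$ (i, j)"
      using ij by simp
  qed (use A N in \<open>auto intro!: mat_in_mat_over\<close>)
  finally show ?thesis using det_over_mult[OF N A] by (simp add: negdet_def)
qed

subsection \<open>Companion matrices\<close>

text \<open>The coefficients are placed in the first column so that right multiplication by the
  unipotent group below changes exactly them; the lowest entry, minus the constant term, stays
  fixed.\<close>

definition companion :: "'a list \<Rightarrow> 'a mat" where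
  "companion p = mat n n (\<lambda>(i, j). if j = 0 then \<ominus> (p ! Suc i) else if j = Suc i then \<one> else \<zero>)"

lemma companion_closed [simp]: "p \<in> monics n \<Longrightarrow> companion p \<in> carrier M"
  unfolding companion_def by (intro mat_in_mat_over) (auto simp: monicsD(3))

lemma companion_entry:
  "i < n \<Longrightarrow> j < n \<Longrightarrow>
    companion p $$ (i, j) = (if j = 0 then \<ominus> (p ! Suc i) else if j = Suc i then \<one> else \<zero>)"
  by (simp add: companion_def)

text \<open>For a companion matrix \<open>C\<close>, this is \<open>X - C\<close> with its first
  column replaced by the last unit vector; no coefficient of the polynomial is left.\<close>

definition shiftmat :: "'a list mat" where
  "shiftmat = mat n n (\<lambda>(i, j).
     if j = 0 then (if Suc i = n then \<one>\<^bsub>PR\<^esub> else \<zero>\<^bsub>PR\<^esub>)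
     else (if i = j then X else \<zero>\<^bsub>PR\<^esub>) \<oplus>\<^bsub>PR\<^esub> poly_of_const (if j = Suc i then \<ominus> \<one> else \<zero>))"

lemma shiftmat_closed [simp]: "shiftmat \<in> carrier MP"
  unfolding shiftmat_def by (intro mat_in_mat_over) auto

text \<open>
  Adding to the first column of \<open>X - C\<close> the other columns weighted by the Horner prefixes of \<open>p\<close>
  clears it up to the entry \<open>p\<close> in the last row. The remaining determinant does not depend on \<open>p\<close>,
  so the case \<open>p = X\<^sup>n\<close> shows that it is \<open>1\<close>.
\<close>

lemma charpoly_companion_aux:
  assumes p: "p \<in> monics n"
  shows "charpoly_over R (companion p) = det_over PR shiftmat \<star> p"
proof -
  note pp = monicsD[OF p]
  let ?C = "charmat R n (companion p)"
  define hor where "hor i = take (Suc i) p" for i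
  have hor: "hor i \<in> carrier PR" "hor i \<noteq> []" if "i \<le> n" for i
  proof -
    have "hor i \<in> monics i"
      using that pp unfolding hor_def monics_def by (auto dest: in_set_takeD simp: hd_conv_nth)
    then show "hor i \<in> carrier PR" "hor i \<noteq> []" by (auto dest: monicsD)
  qed
  have hor0: "hor 0 = \<one>\<^bsub>PR\<^esub>" using pp by (cases p) (auto simp: hor_def univ_poly_one)
  have horS: "(X \<star> hor i) \<oplus>\<^bsub>PR\<^esub> poly_of_const (p ! Suc i) = hor (Suc i)" if "i < n" for i
    using that hor pp var_mult_add_const[of "hor i" "p ! Suc i"]
    by (simp add: hor_def take_Suc_conv_app_nth)
  have horn: "hor n = p" using pp by (simp add: hor_def)
  define V where "V = mat n n (\<lambda>(i, j). if j = 0 then hor i else if i = j then \<one>\<^bsub>PR\<^esub> else \<zero>\<^bsub>PR\<^esub>)"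
  define D where "D = mat n n (\<lambda>(i, j). if i = j then (if i = 0 then p else \<one>\<^bsub>PR\<^esub>) else \<zero>\<^bsub>PR\<^esub>)"
  have V: "V \<in> carrier MP" unfolding V_def using hor by (intro mat_in_mat_over) auto
  have D: "D \<in> carrier MP" unfolding D_def using pp by (intro mat_in_mat_over) auto
  have C: "?C \<in> carrier MP" using p by simp
  have detV: "det_over PR V = \<one>\<^bsub>PR\<^esub>"
    by (subst P.det_over_lower_triangular[OF V])
       (auto simp: V_def hor0 intro!: P.finprod_one_eqI)
  have detD: "det_over PR D = p"
  proof -
    have "det_over PR D = (\<Otimes>\<^bsub>PR\<^esub>i\<in>{..<n}. if 0 = i then p else \<one>\<^bsub>PR\<^esub>)"
      using pp by (subst P.det_over_lower_triangular[OF D]) (auto simp: D_def intro!: P.finprod_cong')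
    also have "\<dots> = p" using n pp P.finprod_singleton[of 0 "{..<n}" "\<lambda>_. p"] by auto
    finally show ?thesis .
  qed
  have prod: "?C \<otimes>\<^bsub>MP\<^esub> V = shiftmat \<otimes>\<^bsub>MP\<^esub> D"
  proof (rule mat_over_eqI)
    fix i j assume ij: "i < n" "j < n"
    have "(shiftmat \<otimes>\<^bsub>MP\<^esub> D) $$ (i, j) =
        (\<Oplus>\<^bsub>PR\<^esub>l\<in>{..<n}. if l = j then shiftmat $$ (i, j) \<star> D $$ (j, j) else \<zero>\<^bsub>PR\<^esub>)"
      unfolding mat_over_mult_entry[OF ij]
      using ij D mat_over_entry[OF shiftmat_closed] by (intro P.finsum_cong' refl) (auto simp: D_def pp)
    also have "\<dots> = shiftmat $$ (i, j) \<star> D $$ (j, j)"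
      using ij D mat_over_entry[OF shiftmat_closed] by (subst P.finsum_delta) auto
    finally have R: "(shiftmat \<otimes>\<^bsub>MP\<^esub> D) $$ (i, j) = shiftmat $$ (i, j) \<star> D $$ (j, j)" .
    show "(?C \<otimes>\<^bsub>MP\<^esub> V) $$ (i, j) = (shiftmat \<otimes>\<^bsub>MP\<^esub> D) $$ (i, j)"
    proof (cases "j = 0")
      case False
      have "(?C \<otimes>\<^bsub>MP\<^esub> V) $$ (i, j) = (\<Oplus>\<^bsub>PR\<^esub>l\<in>{..<n}. if l = j then ?C $$ (i, j) else \<zero>\<^bsub>PR\<^esub>)"
        unfolding mat_over_mult_entry[OF ij]
        using ij C mat_over_entry[OF C] False by (intro P.finsum_cong' refl) (auto simp: V_def)
      also have "\<dots> = ?C $$ (i, j)" using ij C by (subst P.finsum_delta) auto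
      also have "\<dots> = shiftmat $$ (i, j)"
        using ij p False by (simp add: charmat_entry companion_entry shiftmat_def)
      finally show ?thesis unfolding R using ij False by (simp add: D_def shiftmat_def)
    next
      case True
      \<comment> \<open>The diagonal, first-column and superdiagonal parts of row \<open>i\<close>
        of \<open>X - C\<close>. The first two meet at \<open>i = 0\<close>, so they are kept as
        separate sums.\<close>
      let ?t1 = "\<lambda>l. if l = i then X \<star> hor l else \<zero>\<^bsub>PR\<^esub>"
      let ?t2 = "\<lambda>l. if l = 0 then poly_of_const (p ! Suc i) \<star> hor l else \<zero>\<^bsub>PR\<^esub>"
      let ?t3 = "\<lambda>l. if l = Suc i then \<ominus>\<^bsub>PR\<^esub> hor l else \<zero>\<^bsub>PR\<^esub>"
      have c1: "poly_of_const \<one> = \<one>\<^bsub>PR\<^esub>" by simp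
      have "(?C \<otimes>\<^bsub>MP\<^esub> V) $$ (i, j) = (\<Oplus>\<^bsub>PR\<^esub>l\<in>{..<n}. ?C $$ (i, l) \<star> hor l)"
        unfolding mat_over_mult_entry[OF ij]
        using ij C True mat_over_entry[OF C] hor by (intro P.finsum_cong' refl) (auto simp: V_def)
      also have "\<dots> = (\<Oplus>\<^bsub>PR\<^esub>l\<in>{..<n}. (?t1 l \<oplus>\<^bsub>PR\<^esub> ?t2 l) \<oplus>\<^bsub>PR\<^esub> ?t3 l)"
        using ij p hor pp
        by (intro P.finsum_cong' refl)
           (auto simp: charmat_entry companion_entry P.l_distr P.l_minus hor0 c1)
      also have "\<dots> = ((\<Oplus>\<^bsub>PR\<^esub>l\<in>{..<n}. ?t1 l) \<oplus>\<^bsub>PR\<^esub> (\<Oplus>\<^bsub>PR\<^esub>l\<in>{..<n}. ?t2 l)) \<oplus>\<^bsub>PR\<^esub> (\<Oplus>\<^bsub>PR\<^esub>l\<in>{..<n}. ?t3 l)"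
        using ij hor pp by (subst P.finsum_addf; (subst P.finsum_addf)?) auto
      also have "(\<Oplus>\<^bsub>PR\<^esub>l\<in>{..<n}. ?t1 l) = X \<star> hor i"
        using ij hor P.finsum_delta[of "{..<n}" i "\<lambda>l. X \<star> hor l"] by auto
      also have "(\<Oplus>\<^bsub>PR\<^esub>l\<in>{..<n}. ?t2 l) = poly_of_const (p ! Suc i)"
        using ij hor n pp P.finsum_delta[of "{..<n}" 0 "\<lambda>l. poly_of_const (p ! Suc i) \<star> hor l"]
        by (auto simp: hor0)
      also have "(\<Oplus>\<^bsub>PR\<^esub>l\<in>{..<n}. ?t3 l) = (if Suc i = n then \<zero>\<^bsub>PR\<^esub> else \<ominus>\<^bsub>PR\<^esub> hor (Suc i))"
      proof (cases "Suc i = n")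
        case True
        then have "(\<Oplus>\<^bsub>PR\<^esub>l\<in>{..<n}. ?t3 l) = (\<Oplus>\<^bsub>PR\<^esub>l\<in>{..<n}. \<zero>\<^bsub>PR\<^esub>)" by (intro P.finsum_cong') auto
        then show ?thesis using True by simp
      next
        case False
        then show ?thesis using ij hor P.finsum_delta[of "{..<n}" "Suc i" "\<lambda>l. \<ominus>\<^bsub>PR\<^esub> hor l"] by auto
      qed
      also have "(X \<star> hor i \<oplus>\<^bsub>PR\<^esub> poly_of_const (p ! Suc i)) = hor (Suc i)" by (rule horS[OF ij(1)])
      also have "hor (Suc i) \<oplus>\<^bsub>PR\<^esub> (if Suc i = n then \<zero>\<^bsub>PR\<^esub> else \<ominus>\<^bsub>PR\<^esub> hor (Suc i)) =
          (if Suc i = n then p else \<zero>\<^bsub>PR\<^esub>)"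
        using ij hor[of "Suc i"] horn by (auto simp: P.r_neg)
      finally show ?thesis unfolding R using ij True pp by (simp add: D_def shiftmat_def)
    qed
  qed (use C V D in \<open>auto intro!: MP.m_closed\<close>)
  have "charpoly_over R (companion p) = det_over PR ?C \<star> det_over PR V"
    using p C P.det_over_closed[OF C] by (simp add: charpoly_over_charmat[OF companion_closed] detV)
  also have "\<dots> = det_over PR shiftmat \<star> det_over PR D"
    by (simp only: P.det_over_mult[OF C V, symmetric] prod P.det_over_mult[OF shiftmat_closed D])
  finally show ?thesis unfolding detD .
qed

lemma det_shiftmat: "det_over PR shiftmat = \<one>\<^bsub>PR\<^esub>"
proof -
  \<comment> \<open>The polynomial \<open>X^n\<close>, for which \<open>X - C\<close> is upper
    triangular with diagonal \<open>X\<close>.\<close>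
  define p where "p = \<one> # replicate n \<zero>"
  have p: "p \<in> monics n" by (auto simp: monics_def p_def)
  have C: "charmat R n (companion p) \<in> carrier MP" using p by simp
  have "charpoly_over R (companion p) = (\<Otimes>\<^bsub>PR\<^esub>i\<in>{..<n}. charmat R n (companion p) $$ (i, i))"
    unfolding charpoly_over_charmat[OF companion_closed[OF p]]
    by (rule P.det_over_upper_triangular[OF C])
       (use p in \<open>auto simp: charmat_entry companion_entry p_def\<close>)
  also have "\<dots> = (\<Otimes>\<^bsub>PR\<^esub>i\<in>{..<n}. X)"
    using p by (intro P.finprod_cong') (auto simp: charmat_entry companion_entry p_def)
  also have "\<dots> = X [^]\<^bsub>PR\<^esub> n" by (subst P.finprod_const) auto
  also have "\<dots> = p"
    unfolding unitary_monom_eq_var_pow[OF carrier_is_subring, symmetric] by (simp add: monom_def p_def)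
  finally have "det_over PR shiftmat \<star> p = \<one>\<^bsub>PR\<^esub> \<star> p"
    using charpoly_companion_aux[OF p] monicsD(5)[OF p] by simp
  then show ?thesis
    using P.m_rcancel[of p "det_over PR shiftmat" "\<one>\<^bsub>PR\<^esub>"] monicsD(4,5)[OF p] P.det_over_closed[OF shiftmat_closed]
    by (auto simp: univ_poly_zero)
qed

lemma charpoly_companion: "p \<in> monics n \<Longrightarrow> charpoly_over R (companion p) = p"
  using charpoly_companion_aux det_shiftmat monicsD(5) by auto

end

lemma card_le_fibers:
  assumes "finite A" and f: "f ` A \<subseteq> B" and "finite B"
    and "\<And>b. b \<in> B \<Longrightarrow> card {a \<in> A. f a = b} \<le> m"
  shows "card A \<le> card B * m"
proof -
  have "A = (\<Union>b\<in>B. {a \<in> A. f a = b})" using f by auto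
  then have "card A \<le> (\<Sum>b\<in>B. card {a \<in> A. f a = b})"
    using card_UN_le[OF assms(3), of "\<lambda>b. {a \<in> A. f a = b}"] by simp
  also have "\<dots> \<le> card B * m" using sum_bounded_above[of B _ m] assms(4) by simp
  finally show ?thesis .
qed

section \<open>The stabiliser of the first coordinate functional, and products with companion
  matrices\<close>

context matrix_field
begin

lemma GL_simps:
  "carrier (GL R n) = Units M" "mult (GL R n) = mult M" "\<one>\<^bsub>GL R n\<^esub> = \<one>\<^bsub>M\<^esub>"
  by (auto simp: GL_def units_of_def)

lemma GL_inv: "h \<in> Units M \<Longrightarrow> inv\<^bsub>GL R n\<^esub> h = inv\<^bsub>M\<^esub> h"
  unfolding GL_def by (rule M.units_of_inv)

lemma charpoly_conj_GL:
  assumes "h \<in> carrier (GL R n)" "g \<in> carrier (GL R n)"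
  shows "charpoly_over R (g \<otimes>\<^bsub>GL R n\<^esub> h \<otimes>\<^bsub>GL R n\<^esub> inv\<^bsub>GL R n\<^esub> g) = charpoly_over R h"
proof -
  have hg: "h \<in> Units M" "g \<in> Units M" using assms by (auto simp: GL_simps)
  let ?h = "g \<diamondop> h \<diamondop> inv\<^bsub>M\<^esub> g"
  have "g \<diamondop> h = ?h \<diamondop> g"
    using hg by (simp add: M.m_assoc M.Units_closed)
  then have "charpoly_over R h = charpoly_over R ?h"
    using hg by (intro charpoly_conj[of g]) auto
  then show ?thesis using hg by (simp add: GL_simps GL_inv)
qed

text \<open>With \<open>e_0\<close> the first unit row vector, these are the invertible
  \<open>K\<close> with \<open>e_0 K = e_0\<close>. By \<open>unip_intertwine\<close> below,
  conjugation by them preserves the unipotent group.\<close>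

definition fixrow :: "'a mat set" where
  "fixrow = {K \<in> Units M. \<forall>j<n. K $$ (0, j) = (if j = 0 then \<one> else \<zero>)}"

lemma row0_mult:
  assumes K: "K \<in> carrier M" "\<And>j. j < n \<Longrightarrow> K $$ (0, j) = (if j = 0 then \<one> else \<zero>)"
    and A: "A \<in> carrier M" and j: "j < n"
  shows "(K \<diamondop> A) $$ (0, j) = A $$ (0, j)"
proof -
  have "(K \<diamondop> A) $$ (0, j) = (\<Oplus>l\<in>{..<n}. if l = 0 then A $$ (l, j) else \<zero>)"
    using n j K A by (subst mat_over_mult_entry) (auto intro!: finsum_cong')
  also have "\<dots> = A $$ (0, j)" using n A j finsum_delta[of "{..<n}" 0 "\<lambda>l. A $$ (l, j)"] by auto
  finally show ?thesis .
qed

lemma fixrow_mult_inv: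
  assumes K: "K \<in> fixrow" and L: "L \<in> fixrow"
  shows "L \<diamondop> inv\<^bsub>M\<^esub> K \<in> fixrow"
proof -
  have KL: "K \<in> Units M" "L \<in> Units M" using assms by (auto simp: fixrow_def)
  have K0: "\<And>j. j < n \<Longrightarrow> K $$ (0, j) = (if j = 0 then \<one> else \<zero>)"
    and L0: "\<And>j. j < n \<Longrightarrow> L $$ (0, j) = (if j = 0 then \<one> else \<zero>)" using assms by (auto simp: fixrow_def)
  have "(L \<diamondop> inv\<^bsub>M\<^esub> K) $$ (0, j) = (if j = 0 then \<one> else \<zero>)" if j: "j < n" for j
  proof -
    have "(L \<diamondop> inv\<^bsub>M\<^esub> K) $$ (0, j) = (inv\<^bsub>M\<^esub> K) $$ (0, j)"
      using KL by (intro row0_mult j L0) auto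
    also have "\<dots> = (K \<diamondop> inv\<^bsub>M\<^esub> K) $$ (0, j)"
      using KL by (intro row0_mult[symmetric] j K0) auto
    also have "\<dots> = (if j = 0 then \<one> else \<zero>)" using KL n j by (simp add: M.Units_r_inv)
    finally show ?thesis .
  qed
  then show ?thesis using KL unfolding fixrow_def by auto
qed

lemma row_mult_cong:
  assumes "A \<in> carrier M" "B \<in> carrier M" "C \<in> carrier M" "i < n" "j < n"
    and "\<And>l. l < n \<Longrightarrow> A $$ (i, l) = B $$ (i, l)"
  shows "(A \<diamondop> C) $$ (i, j) = (B \<diamondop> C) $$ (i, j)"
  using assms by (auto intro!: finsum_cong')

text \<open>Read backwards: row \<open>i + 1\<close> of \<open>A\<close> is recovered from row
  \<open>i\<close> of the product and row \<open>0\<close> of \<open>A\<close>. This is the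
  recursion behind \<open>fixrow_commute_companion\<close>.\<close>

lemma companion_mult_left:
  assumes p: "p \<in> monics n" and A: "A \<in> carrier M" and ij: "i < n" "j < n"
  shows "(companion p \<diamondop> A) $$ (i, j) =
     \<ominus> (p ! Suc i) \<otimes> A $$ (0, j) \<oplus> (if Suc i < n then A $$ (Suc i, j) else \<zero>)"
proof -
  have pc: "p ! Suc i \<in> carrier R" using p ij by (auto simp: monicsD(3))
  have "(companion p \<diamondop> A) $$ (i, j) =
     (\<Oplus>l\<in>{..<n}. (if l = 0 then \<ominus> (p ! Suc i) \<otimes> A $$ (l, j) else \<zero>) \<oplus>
         (if l = Suc i then A $$ (l, j) else \<zero>))"
    unfolding mat_over_mult_entry[OF ij]
    using ij p A pc by (intro finsum_cong' refl) (auto simp: companion_entry)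
  also have "\<dots> = (\<Oplus>l\<in>{..<n}. if l = 0 then \<ominus> (p ! Suc i) \<otimes> A $$ (l, j) else \<zero>) \<oplus>
         (\<Oplus>l\<in>{..<n}. if l = Suc i then A $$ (l, j) else \<zero>)"
    using ij A pc by (intro finsum_addf) auto
  also have "(\<Oplus>l\<in>{..<n}. if l = 0 then \<ominus> (p ! Suc i) \<otimes> A $$ (l, j) else \<zero>) = \<ominus> (p ! Suc i) \<otimes> A $$ (0, j)"
    using n A ij pc finsum_delta[of "{..<n}" 0 "\<lambda>l. \<ominus> (p ! Suc i) \<otimes> A $$ (l, j)"] by auto
  also have "(\<Oplus>l\<in>{..<n}. if l = Suc i then A $$ (l, j) else \<zero>) = (if Suc i < n then A $$ (Suc i, j) else \<zero>)"
  proof (cases "Suc i < n")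
    case True
    then show ?thesis using A ij finsum_delta[of "{..<n}" "Suc i" "\<lambda>l. A $$ (l, j)"] by auto
  next
    case False
    then have "(\<Oplus>l\<in>{..<n}. if l = Suc i then A $$ (l, j) else \<zero>) = (\<Oplus>l\<in>{..<n}. \<zero>)"
      by (intro finsum_cong') auto
    then show ?thesis using False by simp
  qed
  finally show ?thesis .
qed

lemma companion_mult_right:
  assumes p: "p \<in> monics n" and A: "A \<in> carrier M" and ij: "i < n" "j < n" "j \<noteq> 0"
  shows "(A \<diamondop> companion p) $$ (i, j) = A $$ (i, j - 1)"
proof -
  have "(A \<diamondop> companion p) $$ (i, j) = (\<Oplus>l\<in>{..<n}. if l = j - 1 then A $$ (i, l) else \<zero>)"
    unfolding mat_over_mult_entry[OF ij(1,2)]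
    using ij p A by (intro finsum_cong' refl) (auto simp: companion_entry)
  also have "\<dots> = A $$ (i, j - 1)" using ij A finsum_delta[of "{..<n}" "j - 1" "\<lambda>l. A $$ (i, l)"] by auto
  finally show ?thesis .
qed

lemma companion_unit:
  assumes p: "p \<in> monics n" and pn: "p ! n \<noteq> \<zero>"
  shows "companion p \<in> Units M"
proof -
  have pc: "p ! i \<in> carrier R" if "i \<le> n" for i using p that by (auto simp: monicsD(3))
  have p0: "p ! 0 = \<one>" using p by (auto simp: monicsD)
  have un: "p ! n \<in> Units R" using pn pc[of n] field_Units by auto
  define u where "u = \<ominus> (inv (p ! n))"
  have u: "u \<in> carrier R" using un by (auto simp: u_def)
  have up: "u \<otimes> \<ominus> (p ! n) = \<one>" "\<ominus> (p ! n) \<otimes> u = \<one>"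
    using un pc[of n] by (auto simp: u_def l_minus r_minus)
  \<comment> \<open>The inverse shifts back by ones below the diagonal; its last column solves
    \<open>C d = e\<close> with \<open>e\<close> the last unit vector, which gives
    \<open>d_0 = -1 / p_n\<close> and \<open>d_i = p_i * d_0\<close>.\<close>
  define D where "D = mat n n (\<lambda>(i, j). if Suc j = n then u \<otimes> p ! i else if i = Suc j then \<one> else \<zero>)"
  have D: "D \<in> carrier M" unfolding D_def using u pc by (intro mat_in_mat_over) auto
  have De: "D $$ (i, j) = (if Suc j = n then u \<otimes> p ! i else if i = Suc j then \<one> else \<zero>)"
    if "i < n" "j < n" for i j using that by (simp add: D_def)
  have C: "companion p \<in> carrier M" using p by simp
  have "companion p \<diamondop> D = \<one>\<^bsub>M\<^esub>"
  proof (rule mat_over_eqI[OF M.m_closed[OF C D] M.one_closed])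
    fix i j assume ij: "i < n" "j < n"
    show "(companion p \<diamondop> D) $$ (i, j) = \<one>\<^bsub>M\<^esub> $$ (i, j)"
      unfolding companion_mult_left[OF p D ij] using ij pc[of "Suc i"] u up p0 n
      by (cases "Suc j = n"; cases "Suc i = n")
         (auto simp: De l_minus r_minus l_neg m_comm)
  qed
  moreover have "D \<diamondop> companion p = \<one>\<^bsub>M\<^esub>"
  proof (rule mat_over_eqI[OF M.m_closed[OF D C] M.one_closed])
    fix i j assume ij: "i < n" "j < n"
    show "(D \<diamondop> companion p) $$ (i, j) = \<one>\<^bsub>M\<^esub> $$ (i, j)"
    proof (cases "j = 0")
      case False
      then show ?thesis using companion_mult_right[OF p D ij False] ij by (auto simp: De)
    next
      case True
      \<comment> \<open>For \<open>i = 0\<close> the index \<open>i - 1\<close> truncates to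
        \<open>0\<close>, so the second summand has to be set to zero explicitly.\<close>
      have "(D \<diamondop> companion p) $$ (i, j) =
        (\<Oplus>l\<in>{..<n}. (if l = n - 1 then p ! i else \<zero>) \<oplus>
          (if l = i - 1 then (if i = 0 then \<zero> else \<ominus> (p ! i)) else \<zero>))"
        unfolding mat_over_mult_entry[OF ij]
      proof (intro finsum_cong' refl)
        fix l assume l: "l \<in> {..<n}"
        have "u \<otimes> p ! i \<otimes> \<ominus> (p ! n) = p ! i"
        proof -
          have "u \<otimes> p ! i \<otimes> \<ominus> (p ! n) = (u \<otimes> \<ominus> (p ! n)) \<otimes> p ! i"
            using u pc[of i] pc[of n] ij by (simp add: m_ac)
          then show ?thesis using up pc[of i] ij by simp
        qed
        moreover have "Suc l = n \<longleftrightarrow> l = n - 1" using n by auto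
        ultimately show "D $$ (i, l) \<otimes> companion p $$ (l, j) = (if l = n - 1 then p ! i else \<zero>) \<oplus>
          (if l = i - 1 then (if i = 0 then \<zero> else \<ominus> (p ! i)) else \<zero>)"
          using l ij True pc[of i] pc[of "Suc l"] by (auto simp: De companion_entry)
      qed (use pc ij in auto)
      also have "\<dots> = (\<Oplus>l\<in>{..<n}. (if l = n - 1 then p ! i else \<zero>)) \<oplus>
          (\<Oplus>l\<in>{..<n}. (if l = i - 1 then (if i = 0 then \<zero> else \<ominus> (p ! i)) else \<zero>))"
        using pc ij by (intro finsum_addf) auto
      also have "(\<Oplus>l\<in>{..<n}. (if l = n - 1 then p ! i else \<zero>)) = p ! i"
        using n ij pc[of i] by (subst finsum_delta) auto
      also have "(\<Oplus>l\<in>{..<n}. (if l = i - 1 then (if i = 0 then \<zero> else \<ominus> (p ! i)) else \<zero>)) =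
          (if i = 0 then \<zero> else \<ominus> (p ! i))"
        using n ij pc[of i] by (subst finsum_delta) auto
      finally show ?thesis using ij True p0 pc[of i] by (auto simp: r_neg)
    qed
  qed
  ultimately show ?thesis using C D unfolding Units_def by auto
qed

subsection \<open>The unipotent subgroup supported on the first column\<close>

definition unip :: "(nat \<Rightarrow> 'a) \<Rightarrow> 'a mat" where
  "unip u = mat n n (\<lambda>(i, j). if j = 0 \<and> i \<noteq> 0 then u i else if i = j then \<one> else \<zero>)"

lemma unip_closed: "u \<in> {1..<n} \<rightarrow> carrier R \<Longrightarrow> unip u \<in> carrier M"
  unfolding unip_def by (intro mat_in_mat_over) auto

lemma unip_entry:
  "i < n \<Longrightarrow> j < n \<Longrightarrow>
    unip u $$ (i, j) = (if j = 0 \<and> i \<noteq> 0 then u i else if i = j then \<one> else \<zero>)"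
  by (simp add: unip_def)

lemma unip_cong: "(\<And>i. 0 < i \<Longrightarrow> i < n \<Longrightarrow> u i = v i) \<Longrightarrow> unip u = unip v"
  unfolding unip_def by (intro cong_mat) auto

lemma mult_unip:
  assumes A: "A \<in> carrier M" and u: "u \<in> {1..<n} \<rightarrow> carrier R" and ij: "i < n" "j < n"
  shows "(A \<diamondop> unip u) $$ (i, j) =
     (if j = 0 then A $$ (i, 0) \<oplus> (\<Oplus>l\<in>{1..<n}. A $$ (i, l) \<otimes> u l) else A $$ (i, j))"
proof -
  have uc: "\<And>i. 0 < i \<Longrightarrow> i < n \<Longrightarrow> u i \<in> carrier R" using u by auto
  show ?thesis
  proof (cases "j = 0")
  case False
  have "(A \<diamondop> unip u) $$ (i, j) = (\<Oplus>l\<in>{..<n}. if l = j then A $$ (i, l) else \<zero>)"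
    unfolding mat_over_mult_entry[OF ij]
    using ij False A by (intro finsum_cong' refl) (auto simp: unip_entry)
  then show ?thesis using False ij A finsum_delta[of "{..<n}" j "\<lambda>l. A $$ (i, l)"] by auto
next
  case True
  have s: "{..<n} = insert 0 {1..<n}" using n by auto
  have "(\<Oplus>l\<in>{..<n}. A $$ (i, l) \<otimes> unip u $$ (l, j)) =
      A $$ (i, 0) \<otimes> unip u $$ (0, j) \<oplus> (\<Oplus>l\<in>{1..<n}. A $$ (i, l) \<otimes> unip u $$ (l, j))"
    unfolding s using A uc ij n True by (intro finsum_insert) (auto simp: unip_entry)
  also have "(\<Oplus>l\<in>{1..<n}. A $$ (i, l) \<otimes> unip u $$ (l, j)) = (\<Oplus>l\<in>{1..<n}. A $$ (i, l) \<otimes> u l)"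
    using A uc ij n True by (intro finsum_cong') (auto simp: unip_entry)
  finally show ?thesis using True ij A by (simp add: unip_entry)
  qed
qed

lemma unip_mult:
  assumes A: "A \<in> carrier M" and u: "u \<in> {1..<n} \<rightarrow> carrier R" and ij: "i < n" "j < n"
  shows "(unip u \<diamondop> A) $$ (i, j) = (if i = 0 then A $$ (0, j) else A $$ (i, j) \<oplus> u i \<otimes> A $$ (0, j))"
proof -
  have uc: "\<And>i. 0 < i \<Longrightarrow> i < n \<Longrightarrow> u i \<in> carrier R" using u by auto
  show ?thesis
  proof (cases "i = 0")
  case True
  then show ?thesis using row0_mult[of "unip u" A j] unip_closed[OF u] A ij by (simp add: unip_entry)
next
  case False
  have "(unip u \<diamondop> A) $$ (i, j) = (\<Oplus>l\<in>{..<n}. (if l = i then A $$ (l, j) else \<zero>) \<oplus>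
      (if l = 0 then u i \<otimes> A $$ (l, j) else \<zero>))"
    unfolding mat_over_mult_entry[OF ij]
    using ij False A uc[of i] by (intro finsum_cong' refl) (auto simp: unip_entry)
  also have "\<dots> = (\<Oplus>l\<in>{..<n}. (if l = i then A $$ (l, j) else \<zero>)) \<oplus>
      (\<Oplus>l\<in>{..<n}. (if l = 0 then u i \<otimes> A $$ (l, j) else \<zero>))"
    using ij False A uc[of i] by (intro finsum_addf) auto
  finally show ?thesis
    using ij False A uc[of i] finsum_delta[of "{..<n}" i "\<lambda>l. A $$ (l, j)"]
      finsum_delta[of "{..<n}" 0 "\<lambda>l. u i \<otimes> A $$ (l, j)"] by auto
  qed
qed

text \<open>Write \<open>unip u = 1 + u e_0\<close>, with \<open>u\<close> a column vanishing at the
  top and \<open>e_0\<close> the first unit row vector. Then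
  \<open>K (1 + u e_0) = K + (K u) e_0 = (1 + (K u) e_0) K\<close>, since
  \<open>e_0 K = e_0\<close>.\<close>

lemma unip_intertwine:
  assumes K: "K \<in> carrier M" "\<And>j. j < n \<Longrightarrow> K $$ (0, j) = (if j = 0 then \<one> else \<zero>)"
    and u: "u \<in> {1..<n} \<rightarrow> carrier R"
    and v: "\<And>i. 0 < i \<Longrightarrow> i < n \<Longrightarrow> v i = (\<Oplus>l\<in>{1..<n}. K $$ (i, l) \<otimes> u l)"
  shows "K \<diamondop> unip u = unip v \<diamondop> K"
proof -
  have uc: "\<And>i. 0 < i \<Longrightarrow> i < n \<Longrightarrow> u i \<in> carrier R" using u by auto
  have cl: "(\<Oplus>l\<in>{1..<n}. K $$ (i, l) \<otimes> u l) \<in> carrier R" if "i < n" for i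
    using that K uc by (intro finsum_closed) auto
  have vc: "v \<in> {1..<n} \<rightarrow> carrier R" using v cl by auto
  have z: "(\<Oplus>l\<in>{1..<n}. K $$ (0, l) \<otimes> u l) = \<zero>"
  proof -
    have "(\<Oplus>l\<in>{1..<n}. K $$ (0, l) \<otimes> u l) = (\<Oplus>l\<in>{1..<n}. \<zero>)"
      using K uc by (intro finsum_cong') auto
    then show ?thesis by simp
  qed
  show ?thesis
  proof (rule mat_over_eqI)
    fix i j assume ij: "i < n" "j < n"
    show "(K \<diamondop> unip u) $$ (i, j) = (unip v \<diamondop> K) $$ (i, j)"
      unfolding mult_unip[OF K(1) u ij] unip_mult[OF K(1) vc ij]
      using ij n K v[of i] cl[of i] z by (auto)
  qed (use K unip_closed[OF u] unip_closed[OF vc] in auto)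
qed

lemma unip_add:
  assumes u: "u \<in> {1..<n} \<rightarrow> carrier R" and v: "v \<in> {1..<n} \<rightarrow> carrier R"
  shows "unip u \<diamondop> unip v = unip (\<lambda>i. u i \<oplus> v i)"
proof (rule mat_over_eqI[of _ R n])
  have uc: "\<And>i. 0 < i \<Longrightarrow> i < n \<Longrightarrow> u i \<in> carrier R" using u by auto
  have vc: "\<And>i. 0 < i \<Longrightarrow> i < n \<Longrightarrow> v i \<in> carrier R" using v by auto
  fix i j assume ij: "i < n" "j < n"
  show "(unip u \<diamondop> unip v) $$ (i, j) = unip (\<lambda>i. u i \<oplus> v i) $$ (i, j)"
    unfolding unip_mult[OF unip_closed[OF v] u ij]
    using ij n uc[of i] vc[of i] by (auto simp: unip_entry a_comm)
qed (use u v unip_closed[OF u] unip_closed[OF v] in \<open>auto intro!: unip_closed M.m_closed simp: Pi_iff\<close>)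

lemma unip_zero: "unip (\<lambda>_. \<zero>) = \<one>\<^bsub>M\<^esub>"
  by (rule mat_over_eqI[of _ R n]) (auto intro!: unip_closed simp: unip_entry)

text \<open>Only the values of \<open>u\<close> on \<open>{1..<n}\<close> enter the matrix;
  extensional functions make the parametrisation injective.\<close>

definition unips :: "'a mat set" where
  "unips = unip ` ({1..<n} \<rightarrow>\<^sub>E carrier R)"

lemma unip_in_unips:
  assumes u: "u \<in> {1..<n} \<rightarrow> carrier R"
  shows "unip u \<in> unips"
proof -
  have "unip u = unip (restrict u {1..<n})" by (rule unip_cong) auto
  moreover have "restrict u {1..<n} \<in> {1..<n} \<rightarrow>\<^sub>E carrier R" using u by auto
  ultimately show ?thesis unfolding unips_def by blast
qed

lemma unipsE:
  assumes "w \<in> unips"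
  obtains u where "w = unip u" "u \<in> {1..<n} \<rightarrow> carrier R"
  using assms unfolding unips_def by auto

lemma unip_inj:
  assumes "unip u = unip v" "0 < i" "i < n"
  shows "u i = v i"
  using arg_cong[OF assms(1), of "\<lambda>A. A $$ (i, 0)"] assms(2,3) by (simp add: unip_entry)

lemma unip_uminus:
  assumes u: "u \<in> {1..<n} \<rightarrow> carrier R"
  shows "unip u \<diamondop> unip (\<lambda>i. \<ominus> u i) = \<one>\<^bsub>M\<^esub>" "unip (\<lambda>i. \<ominus> u i) \<diamondop> unip u = \<one>\<^bsub>M\<^esub>"
proof -
  have uc: "\<And>i. 0 < i \<Longrightarrow> i < n \<Longrightarrow> u i \<in> carrier R" using u by auto
  show "unip u \<diamondop> unip (\<lambda>i. \<ominus> u i) = \<one>\<^bsub>M\<^esub>"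
    using uc by (subst unip_add) (auto simp: unip_zero[symmetric] r_neg intro!: unip_cong)
  show "unip (\<lambda>i. \<ominus> u i) \<diamondop> unip u = \<one>\<^bsub>M\<^esub>"
    using uc by (subst unip_add) (auto simp: unip_zero[symmetric] l_neg intro!: unip_cong)
qed

lemma unip_unit:
  assumes u: "u \<in> {1..<n} \<rightarrow> carrier R"
  shows "unip u \<in> Units M"
proof -
  have "(\<lambda>i. \<ominus> u i) \<in> {1..<n} \<rightarrow> carrier R" using u by (auto simp: Pi_iff)
  then show ?thesis
    using unip_uminus[OF u] unip_closed[of u] unip_closed[of "\<lambda>i. \<ominus> u i"] u
    unfolding Units_def by auto
qed

lemma unips_subgroup: "subgroup unips (GL R n)"
proof (rule GL.subgroupI)
  show "unips \<subseteq> carrier (GL R n)"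
    by (auto simp: GL_simps elim!: unipsE intro!: unip_unit)
  show "unips \<noteq> {}" using unip_in_unips[of "\<lambda>_. \<zero>"] by auto
next
  fix w assume "w \<in> unips"
  then obtain u where w: "w = unip u" and u: "u \<in> {1..<n} \<rightarrow> carrier R" by (rule unipsE)
  have "inv\<^bsub>GL R n\<^esub> w = unip (\<lambda>i. \<ominus> u i)"
    using unip_uminus(2)[OF u] unip_unit[OF u] unip_unit[of "\<lambda>i. \<ominus> u i"] u unfolding w
    by (intro GL.inv_equality) (auto simp: GL_simps Pi_iff)
  then show "inv\<^bsub>GL R n\<^esub> w \<in> unips" using u by (auto intro!: unip_in_unips simp: Pi_iff)
next
  fix w w' assume "w \<in> unips" "w' \<in> unips"
  then show "w \<otimes>\<^bsub>GL R n\<^esub> w' \<in> unips"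
    by (auto simp: GL_simps unip_add Pi_iff elim!: unipsE intro!: unip_in_unips)
qed

text \<open>The identity with column \<open>k\<close> replaced by \<open>a\<close>: an explicit
  supply of conjugators.\<close>

definition colmat :: "nat \<Rightarrow> (nat \<Rightarrow> 'a) \<Rightarrow> 'a mat" where
  "colmat k a = mat n n (\<lambda>(i, j). if j = k then a i else if i = j then \<one> else \<zero>)"

lemma colmat_closed: "a \<in> {..<n} \<rightarrow> carrier R \<Longrightarrow> colmat k a \<in> carrier M"
  unfolding colmat_def by (intro mat_in_mat_over) auto

lemma colmat_entry:
  "i < n \<Longrightarrow> j < n \<Longrightarrow> colmat k a $$ (i, j) = (if j = k then a i else if i = j then \<one> else \<zero>)"
  by (simp add: colmat_def)

lemma colmat_mult:
  assumes k: "k < n" and a: "a \<in> {..<n} \<rightarrow> carrier R" and b: "b \<in> {..<n} \<rightarrow> carrier R"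
  shows "colmat k a \<diamondop> colmat k b = colmat k (\<lambda>i. if i = k then a k \<otimes> b k else b i \<oplus> a i \<otimes> b k)"
proof (rule mat_over_eqI[of _ R n])
  have ac: "\<And>i. i < n \<Longrightarrow> a i \<in> carrier R" using a by auto
  have bc: "\<And>i. i < n \<Longrightarrow> b i \<in> carrier R" using b by auto
  fix i j assume ij: "i < n" "j < n"
  have "(colmat k a \<diamondop> colmat k b) $$ (i, j) =
      (\<Oplus>l\<in>{..<n}. (if l = k then a i \<otimes> colmat k b $$ (l, j) else \<zero>) \<oplus>
          (if l = i then (if i = k then \<zero> else colmat k b $$ (l, j)) else \<zero>))"
    unfolding mat_over_mult_entry[OF ij]
    using ij ac bc k by (intro finsum_cong' refl) (auto simp: colmat_entry)
  also have "\<dots> = (\<Oplus>l\<in>{..<n}. (if l = k then a i \<otimes> colmat k b $$ (l, j) else \<zero>)) \<oplus>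
      (\<Oplus>l\<in>{..<n}. (if l = i then (if i = k then \<zero> else colmat k b $$ (l, j)) else \<zero>))"
    using ij ac bc k by (intro finsum_addf) (auto simp: colmat_entry)
  also have "(\<Oplus>l\<in>{..<n}. (if l = k then a i \<otimes> colmat k b $$ (l, j) else \<zero>)) = a i \<otimes> colmat k b $$ (k, j)"
    using ij ac bc k finsum_delta[of "{..<n}" k "\<lambda>l. a i \<otimes> colmat k b $$ (l, j)"] mat_over_entry[OF colmat_closed[OF b]]
    by auto
  also have "(\<Oplus>l\<in>{..<n}. (if l = i then (if i = k then \<zero> else colmat k b $$ (l, j)) else \<zero>)) =
      (if i = k then \<zero> else colmat k b $$ (i, j))"
    using ij ac bc k finsum_delta[of "{..<n}" i "\<lambda>l. if i = k then \<zero> else colmat k b $$ (l, j)"] mat_over_entry[OF colmat_closed[OF b]]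
    by auto
  finally show "(colmat k a \<diamondop> colmat k b) $$ (i, j) =
      colmat k (\<lambda>i. if i = k then a k \<otimes> b k else b i \<oplus> a i \<otimes> b k) $$ (i, j)"
    using ij ac[of i] bc[of i] bc[of k] ac[of k] k by (auto simp: colmat_entry a_comm)
qed (use assms in \<open>auto intro!: M.m_closed colmat_closed simp: Pi_iff\<close>)

lemma colmat_one: "colmat k (\<lambda>i. if i = k then \<one> else \<zero>) = \<one>\<^bsub>M\<^esub>"
  by (rule mat_over_eqI[of _ R n]) (auto intro!: colmat_closed simp: colmat_entry)

lemma colmat_unit:
  assumes k: "k < n" and a: "a \<in> {..<n} \<rightarrow> carrier R" and ak: "a k \<noteq> \<zero>"
  shows "colmat k a \<in> Units M"
proof -
  have ac: "\<And>i. i < n \<Longrightarrow> a i \<in> carrier R" using a by auto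
  have au: "a k \<in> Units R" using ac[OF k] ak field_Units by auto
  define b where "b = (\<lambda>i. if i = k then inv (a k) else \<ominus> (a i \<otimes> inv (a k)))"
  have ic: "inv (a k) \<in> carrier R" using au by auto
  have b: "b \<in> {..<n} \<rightarrow> carrier R" using ac ic by (auto simp: b_def)
  have "colmat k a \<diamondop> colmat k b = \<one>\<^bsub>M\<^esub>"
    unfolding colmat_mult[OF k a b] colmat_one[of k, symmetric] using ac ic au k
    by (intro mat_over_eqI[of _ R n] colmat_closed) (auto simp: b_def colmat_entry l_neg Pi_iff)
  moreover have "colmat k b \<diamondop> colmat k a = \<one>\<^bsub>M\<^esub>"
    unfolding colmat_mult[OF k b a] colmat_one[of k, symmetric] using ac ic au k
    by (intro mat_over_eqI[of _ R n] colmat_closed) (auto simp: b_def colmat_entry l_minus r_neg m_assoc Pi_iff)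
  ultimately show ?thesis using colmat_closed[OF a] colmat_closed[OF b] unfolding Units_def by auto
qed

text \<open>Conjugation by a matrix with first row \<open>e_0\<close> acts on the column
  \<open>u\<close> linearly. The identity with column \<open>k\<close> replaced by \<open>u\<close>
  sends the \<open>k\<close>-th unit vector to \<open>u\<close>, and it is invertible since
  \<open>u k\<close> is nonzero.\<close>

lemma unip_conj_basis:
  assumes u: "u \<in> {1..<n} \<rightarrow> carrier R" and k: "0 < k" "k < n" "u k \<noteq> \<zero>"
  shows "\<exists>s\<in>carrier (GL R n).
    unip u = s \<otimes>\<^bsub>GL R n\<^esub> unip (\<lambda>i. if i = k then \<one> else \<zero>) \<otimes>\<^bsub>GL R n\<^esub> inv\<^bsub>GL R n\<^esub> s"
proof -
  have uc: "\<And>i. 0 < i \<Longrightarrow> i < n \<Longrightarrow> u i \<in> carrier R" using u by auto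
  \<comment> \<open>The value \<open>u 0\<close> is arbitrary, and the first row of the conjugator
    must stay a unit vector.\<close>
  define a where "a = u(0 := \<zero>)"
  have a: "a \<in> {..<n} \<rightarrow> carrier R" using uc by (auto simp: a_def)
  let ?s = "colmat k a" and ?e = "\<lambda>i. if i = k then \<one> else \<zero>"
  have s: "?s \<in> Units M" using k by (intro colmat_unit a) (auto simp: a_def)
  have "?s \<diamondop> unip ?e = unip u \<diamondop> ?s"
  proof (rule unip_intertwine[OF colmat_closed[OF a]])
    fix i assume i: "0 < i" "i < n"
    have "(\<Oplus>l\<in>{1..<n}. ?s $$ (i, l) \<otimes> ?e l) = (\<Oplus>l\<in>{1..<n}. if l = k then u i else \<zero>)"
      using i uc[of i] by (intro finsum_cong') (auto simp: colmat_entry a_def)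
    also have "\<dots> = u i" using i k uc[of i] by (subst finsum_delta) auto
    finally show "u i = (\<Oplus>l\<in>{1..<n}. ?s $$ (i, l) \<otimes> ?e l)" ..
  qed (use k in \<open>auto simp: colmat_entry a_def Pi_iff\<close>)
  then have "?s \<diamondop> unip ?e \<diamondop> inv\<^bsub>M\<^esub> ?s = unip u"
    using s unip_closed[OF u] by (simp add: M.m_assoc M.Units_closed)
  then show ?thesis using s by (intro bexI[of _ ?s]) (auto simp: GL_simps GL_inv)
qed

text \<open>If \<open>u 1\<close> vanishes, \<open>unip_conj_basis\<close> reaches only another unit
  vector \<open>k\<close>. The vector with ones at both \<open>1\<close> and \<open>k\<close> is
  conjugate to either unit vector and links the two.\<close>

lemma unips_conj:
  assumes w: "w \<in> unips" "w \<noteq> \<one>\<^bsub>GL R n\<^esub>"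
  shows "\<exists>s\<in>carrier (GL R n).
    w = s \<otimes>\<^bsub>GL R n\<^esub> unip (\<lambda>i. if i = 1 then \<one> else \<zero>) \<otimes>\<^bsub>GL R n\<^esub> inv\<^bsub>GL R n\<^esub> s"
proof -
  let ?G = "GL R n" and ?e = "\<lambda>k i. if i = k then \<one> else \<zero>"
  define cj where "cj x y \<longleftrightarrow> (\<exists>s\<in>carrier ?G. x = s \<otimes>\<^bsub>?G\<^esub> y \<otimes>\<^bsub>?G\<^esub> inv\<^bsub>?G\<^esub> s)" for x y
  obtain u where wu: "w = unip u" and u: "u \<in> {1..<n} \<rightarrow> carrier R"
    using w(1) by (rule unipsE)
  have "\<exists>k. 0 < k \<and> k < n \<and> u k \<noteq> \<zero>"
  proof (rule ccontr)
    assume "\<nexists>k. 0 < k \<and> k < n \<and> u k \<noteq> \<zero>"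
    then have "unip u = unip (\<lambda>_. \<zero>)" by (intro unip_cong) auto
    then show False using w wu by (simp add: unip_zero GL_simps)
  qed
  then obtain k where k: "0 < k" "k < n" "u k \<noteq> \<zero>" by auto
  have n1: "1 < n" using k by auto
  have ue: "unip (?e l) \<in> carrier ?G" for l
    by (auto simp: GL_simps intro!: unip_unit)
  have 1: "cj w (unip (?e k))" unfolding cj_def wu by (rule unip_conj_basis[OF u k])
  let ?v = "\<lambda>i. if i = 1 \<or> i = k then \<one> else \<zero>"
  have 2: "cj (unip ?v) (unip (?e k))" "cj (unip ?v) (unip (?e 1))"
    unfolding cj_def using k n1 by (intro unip_conj_basis; simp)+
  have sym: "cj y x" if "cj x y" "y \<in> carrier ?G" for x y
  proof -
    from that(1) obtain s where s: "s \<in> carrier ?G" "x = s \<otimes>\<^bsub>?G\<^esub> y \<otimes>\<^bsub>?G\<^esub> inv\<^bsub>?G\<^esub> s"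
      unfolding cj_def by (rule bexE)
    have "y = inv\<^bsub>?G\<^esub> s \<otimes>\<^bsub>?G\<^esub> x \<otimes>\<^bsub>?G\<^esub> inv\<^bsub>?G\<^esub> (inv\<^bsub>?G\<^esub> s)"
      unfolding s(2) using s(1) that(2) by (simp add: GL.m_assoc GL.inv_mult_cancel)
    then show ?thesis unfolding cj_def using s(1) by blast
  qed
  have trans: "cj x z" if "cj x y" "cj y z" "z \<in> carrier ?G" for x y z
  proof -
    from that(1) obtain s where s: "s \<in> carrier ?G" "x = s \<otimes>\<^bsub>?G\<^esub> y \<otimes>\<^bsub>?G\<^esub> inv\<^bsub>?G\<^esub> s"
      unfolding cj_def by (rule bexE)
    from that(2) obtain t where t: "t \<in> carrier ?G" "y = t \<otimes>\<^bsub>?G\<^esub> z \<otimes>\<^bsub>?G\<^esub> inv\<^bsub>?G\<^esub> t"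
      unfolding cj_def by (rule bexE)
    have "x = (s \<otimes>\<^bsub>?G\<^esub> t) \<otimes>\<^bsub>?G\<^esub> z \<otimes>\<^bsub>?G\<^esub> inv\<^bsub>?G\<^esub> (s \<otimes>\<^bsub>?G\<^esub> t)"
      unfolding s(2) t(2) using s(1) t(1) that(3) by (simp add: GL.m_assoc GL.inv_mult_group)
    then show ?thesis unfolding cj_def using s(1) t(1) by blast
  qed
  have vG: "unip ?v \<in> carrier ?G" by (auto simp: GL_simps intro!: unip_unit)
  have "cj w (unip (?e 1))"
    by (rule trans[OF trans[OF 1 sym[OF 2(1)]] 2(2)]) (use ue vG in auto)
  then show ?thesis unfolding cj_def .
qed

end

section \<open>Good matrices: equidistribution along the unipotent group, and their number\<close>

locale finite_matrix_field = matrix_field + finite_field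
begin

lemma card_unips: "card unips = q ^ (n - 1)"
proof -
  have "inj_on unip ({1..<n} \<rightarrow>\<^sub>E carrier R)"
  proof (rule inj_onI)
    fix u v assume uv: "u \<in> {1..<n} \<rightarrow>\<^sub>E carrier R" "v \<in> {1..<n} \<rightarrow>\<^sub>E carrier R" "unip u = unip v"
    show "u = v" by (rule PiE_ext[OF uv(1,2)]) (use unip_inj[OF uv(3)] in auto)
  qed
  then show ?thesis unfolding unips_def by (simp add: card_image card_PiE)
qed

lemma finite_unips: "finite unips"
  unfolding unips_def using fin by (intro finite_imageI finite_PiE) auto

lemma finite_M: "finite (carrier M)"
proof -
  have "carrier M \<subseteq> (\<lambda>f. mat n n f) ` (({..<n} \<times> {..<n}) \<rightarrow>\<^sub>E carrier R)"
  proof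
    fix A assume A: "A \<in> carrier M"
    have "A = mat n n (restrict (\<lambda>ij. A $$ ij) ({..<n} \<times> {..<n}))"
      using A by (intro eq_matI) auto
    moreover have "restrict (\<lambda>ij. A $$ ij) ({..<n} \<times> {..<n}) \<in> ({..<n} \<times> {..<n}) \<rightarrow>\<^sub>E carrier R"
      using A by auto
    ultimately show "A \<in> (\<lambda>f. mat n n f) ` (({..<n} \<times> {..<n}) \<rightarrow>\<^sub>E carrier R)" by blast
  qed
  moreover have "finite (({..<n} \<times> {..<n}) \<rightarrow>\<^sub>E carrier R)" using fin by (intro finite_PiE) auto
  ultimately show ?thesis using finite_surj by blast
qed

lemma finite_Units: "finite (Units M)"
  by (rule finite_subset[OF _ finite_M]) auto

text \<open>Equivalently, \<open>h\<close> is invertible and the row vectors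
  \<open>e_0, e_0 h, ..., e_0 h^(n-1)\<close> form a basis.\<close>

definition good :: "'a mat set" where
  "good = {h \<in> Units M. \<exists>K\<in>fixrow. \<exists>p\<in>monics n. K \<diamondop> h = companion p \<diamondop> K}"

lemma fixrowD:
  assumes "K \<in> fixrow"
  shows "K \<in> Units M" "K \<in> carrier M" "\<And>j. j < n \<Longrightarrow> K $$ (0, j) = (if j = 0 then \<one> else \<zero>)"
  using assms by (auto simp: fixrow_def)

lemma charpoly_companion_conj:
  assumes K: "K \<in> Units M" and h: "h \<in> carrier M" and p: "p \<in> monics n" and eq: "K \<diamondop> h = companion p \<diamondop> K"
  shows "charpoly_over R h = p"
  using charpoly_conj[OF K h companion_closed[OF p] eq] charpoly_companion[OF p] by simp

text \<open>The first column of the product is the companion matrix applied to the column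
  \<open>(1, u)\<close>; the superdiagonal shifts \<open>u\<close> up by one, so nothing reaches the
  last entry, which carries the constant term.\<close>

lemma companion_unip:
  assumes p: "p \<in> monics n" and u: "u \<in> {1..<n} \<rightarrow> carrier R"
  shows "companion p \<diamondop> unip u =
     companion (\<one> # map (\<lambda>i. p ! Suc i \<ominus> (if Suc i < n then u (Suc i) else \<zero>)) [0..<n])"
    (is "_ = companion ?p")
proof -
  have pc: "p ! i \<in> carrier R" if "i \<le> n" for i using p that by (auto simp: monicsD)
  have uc: "\<And>i. 0 < i \<Longrightarrow> i < n \<Longrightarrow> u i \<in> carrier R" using u by auto
  have p': "?p \<in> monics n" using pc uc by (auto simp: monics_def)
  show ?thesis
  proof (rule mat_over_eqI[of _ R n])
    fix i j assume ij: "i < n" "j < n"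
    have "(\<Oplus>l\<in>{1..<n}. companion p $$ (i, l) \<otimes> u l) = (if Suc i < n then u (Suc i) else \<zero>)"
    proof (cases "Suc i < n")
      case True
      have "(\<Oplus>l\<in>{1..<n}. companion p $$ (i, l) \<otimes> u l) = (\<Oplus>l\<in>{1..<n}. if l = Suc i then u l else \<zero>)"
        using ij uc by (intro finsum_cong') (auto simp: companion_entry)
      then show ?thesis using True uc finsum_delta[of "{1..<n}" "Suc i" u] by auto
    next
      case False
      have "(\<Oplus>l\<in>{1..<n}. companion p $$ (i, l) \<otimes> u l) = (\<Oplus>l\<in>{1..<n}. \<zero>)"
        using ij uc False by (intro finsum_cong') (auto simp: companion_entry)
      then show ?thesis using False by simp
    qed
    then show "(companion p \<diamondop> unip u) $$ (i, j) = companion ?p $$ (i, j)"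
      unfolding mult_unip[OF companion_closed[OF p] u ij]
      using ij pc[of "Suc i"] uc[of "Suc i"] by (auto simp: companion_entry minus_eq minus_add)
  qed (use p p' u in \<open>auto intro!: M.m_closed unip_closed\<close>)
qed

text \<open>Conjugation by \<open>K\<close> turns \<open>h\<close> into a companion matrix and maps
  the unipotent group into itself, so \<open>h w\<close> becomes a companion matrix whose
  coefficients, apart from the constant one, are translated by \<open>K u\<close>.\<close>

lemma good_mult_unip:
  assumes h: "h \<in> good"
  shows "bij_betw (\<lambda>w. charpoly_over R (h \<diamondop> w)) unips
     {p \<in> monics n. const_term p = const_term (charpoly_over R h)}"
proof -
  obtain K p where K: "K \<in> fixrow" and p: "p \<in> monics n" and eq: "K \<diamondop> h = companion p \<diamondop> K"
    and hu: "h \<in> Units M" using h unfolding good_def by auto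
  note Kf = fixrowD[OF K]
  have hc: "h \<in> carrier M" using hu by auto
  have ch: "charpoly_over R h = p" by (rule charpoly_companion_conj[OF Kf(1) hc p eq])
  have pc: "p ! i \<in> carrier R" if "i \<le> n" for i using p that by (auto simp: monicsD)
  define ku where "ku u i = (\<Oplus>l\<in>{1..<n}. K $$ (i, l) \<otimes> u l)" for u i
  have kuc: "ku u \<in> {1..<n} \<rightarrow> carrier R" if "u \<in> {1..<n} \<rightarrow> carrier R" for u
    using that Kf unfolding ku_def by (auto intro!: finsum_closed)
  define np where "np u = \<one> # map (\<lambda>i. p ! Suc i \<ominus> (if Suc i < n then ku u (Suc i) else \<zero>)) [0..<n]" for u
  have np: "np u \<in> monics n" if "u \<in> {1..<n} \<rightarrow> carrier R" for u
    using pc kuc[OF that] unfolding np_def by (auto simp: monics_def Pi_iff)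
  have inter: "K \<diamondop> unip u = unip (ku u) \<diamondop> K" if u: "u \<in> {1..<n} \<rightarrow> carrier R" for u
    by (rule unip_intertwine[OF Kf(2,3) u]) (auto simp: ku_def)
  have cp: "charpoly_over R (h \<diamondop> unip u) = np u" if u: "u \<in> {1..<n} \<rightarrow> carrier R" for u
  proof (rule charpoly_companion_conj[OF Kf(1) _ np[OF u]])
    note uc = unip_closed[OF u] unip_closed[OF kuc[OF u]]
    show "h \<diamondop> unip u \<in> carrier M" using hc uc by auto
    have "K \<diamondop> (h \<diamondop> unip u) = companion p \<diamondop> (K \<diamondop> unip u)"
      using hc uc Kf(2) p by (simp add: M.m_assoc[symmetric] eq)
    also have "\<dots> = companion p \<diamondop> unip (ku u) \<diamondop> K"
      unfolding inter[OF u] using uc Kf(2) p by (simp add: M.m_assoc)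
    also have "companion p \<diamondop> unip (ku u) = companion (np u)"
      unfolding np_def by (rule companion_unip[OF p kuc[OF u]])
    finally show "K \<diamondop> (h \<diamondop> unip u) = companion (np u) \<diamondop> K" .
  qed
  have ct: "const_term (np u) = const_term p" if u: "u \<in> {1..<n} \<rightarrow> carrier R" for u
    using const_term_monic[OF np[OF u]] const_term_monic[OF p] n pc[of n]
    by (cases n) (auto simp: np_def nth_append minus_eq)
  have inj: "inj_on (\<lambda>w. charpoly_over R (h \<diamondop> w)) unips"
  proof (rule inj_onI)
    fix w w' assume w: "w \<in> unips" "w' \<in> unips" and e: "charpoly_over R (h \<diamondop> w) = charpoly_over R (h \<diamondop> w')"
    obtain u where u: "w = unip u" "u \<in> {1..<n} \<rightarrow> carrier R" using w(1) by (rule unipsE)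
    obtain v where v: "w' = unip v" "v \<in> {1..<n} \<rightarrow> carrier R" using w(2) by (rule unipsE)
    have npe: "np u = np v" using e u v cp by simp
    have "ku u i = ku v i" if i: "0 < i" "i < n" for i
    proof -
      have "np u ! i = np v ! i" using npe by simp
      then have "p ! i \<ominus> ku u i = p ! i \<ominus> ku v i"
        using i unfolding np_def by (cases i) auto
      moreover have "ku u i \<in> carrier R" "ku v i \<in> carrier R" using kuc[OF u(2)] kuc[OF v(2)] i by auto
      ultimately show ?thesis using minus_cancel[of "p ! i" "ku u i" "ku v i"] pc[of i] i by auto
    qed
    then have "unip (ku u) = unip (ku v)" by (intro unip_cong)
    then have "K \<diamondop> unip u = K \<diamondop> unip v" using inter u v by simp
    then show "w = w'" using Kf(1) unip_closed u v M.Units_l_cancel by metis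
  qed
  have sub: "(\<lambda>w. charpoly_over R (h \<diamondop> w)) ` unips \<subseteq> {p \<in> monics n. const_term p = const_term (charpoly_over R h)}"
    using cp np ct ch by (auto elim!: unipsE)
  have cc: "const_term p \<in> carrier R" using const_term_monic[OF p] pc by auto
  \<comment> \<open>Injectivity suffices, because both sides have \<open>q^(n - 1)\<close>
    elements.\<close>
  have "card ((\<lambda>w. charpoly_over R (h \<diamondop> w)) ` unips) = card {p \<in> monics n. const_term p = const_term (charpoly_over R h)}"
    unfolding card_image[OF inj] card_unips ch using card_monics_const[OF n cc] by simp
  then have "(\<lambda>w. charpoly_over R (h \<diamondop> w)) ` unips = {p \<in> monics n. const_term p = const_term (charpoly_over R h)}"
    by (intro card_subset_eq sub) auto
  then show ?thesis using inj by (simp add: bij_betw_def)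
qed

text \<open>Two matrices with the same first row differ by a left factor in \<open>fixrow\<close>,
  and there are at most \<open>q^n\<close> first rows. Counting the zero row as well is harmless for
  an upper bound.\<close>

lemma card_Units_le: "card (Units M) \<le> q ^ n * card fixrow"
proof -
  let ?row = "\<lambda>K. restrict (\<lambda>j. K $$ (0, j)) {..<n}"
  have "card (Units M) \<le> card ({..<n} \<rightarrow>\<^sub>E carrier R) * card fixrow"
  proof (rule card_le_fibers[of _ ?row])
    show "finite (Units M)" by (rule finite_Units)
    show "?row ` Units M \<subseteq> {..<n} \<rightarrow>\<^sub>E carrier R"
    proof (rule image_subsetI)
      fix K assume "K \<in> Units M"
      then have "K \<in> carrier M" by auto
      then show "?row K \<in> {..<n} \<rightarrow>\<^sub>E carrier R" using n by (simp add: restrict_PiE_iff)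
    qed
    show "finite ({..<n} \<rightarrow>\<^sub>E carrier R)" using fin by (intro finite_PiE) auto
    fix r
    let ?F = "{K \<in> Units M. ?row K = r}"
    show "card ?F \<le> card fixrow"
    proof (cases "?F = {}")
      case True then show ?thesis by (metis card.empty le0)
    next
      case False
      then obtain K0 where K0: "K0 \<in> Units M" "?row K0 = r" by auto
      have K0c: "K0 \<in> carrier M" "inv\<^bsub>M\<^esub> K0 \<in> carrier M" using K0 by auto
      show ?thesis
      proof (rule card_inj_on_le[where f="\<lambda>K. K \<diamondop> inv\<^bsub>M\<^esub> K0"])
        show "inj_on (\<lambda>K. K \<diamondop> inv\<^bsub>M\<^esub> K0) ?F"
        proof (rule inj_onI)
          fix K L assume KL: "K \<in> ?F" "L \<in> ?F" "K \<diamondop> inv\<^bsub>M\<^esub> K0 = L \<diamondop> inv\<^bsub>M\<^esub> K0"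
          have c: "H \<diamondop> inv\<^bsub>M\<^esub> K0 \<diamondop> K0 = H" if "H \<in> Units M" for H
            using that K0(1) K0c by (simp add: M.m_assoc M.Units_closed)
          have KU: "K \<in> Units M" "L \<in> Units M" using KL(1,2) by auto
          show "K = L" using c[OF KU(1)] c[OF KU(2)] unfolding KL(3) by (rule subst)
        qed
        show "(\<lambda>K. K \<diamondop> inv\<^bsub>M\<^esub> K0) ` ?F \<subseteq> fixrow"
        proof safe
          fix K assume K: "K \<in> Units M" "r = ?row K"
          have eq: "K $$ (0, l) = K0 $$ (0, l)" if "l < n" for l
            using fun_cong[OF trans[OF K0(2) K(2)], of l] that by simp
          have "(K \<diamondop> inv\<^bsub>M\<^esub> K0) $$ (0, j) = (if j = 0 then \<one> else \<zero>)" if j: "j < n" for j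
          proof -
            have "(K \<diamondop> inv\<^bsub>M\<^esub> K0) $$ (0, j) = (K0 \<diamondop> inv\<^bsub>M\<^esub> K0) $$ (0, j)"
              using K K0c n j eq by (intro row_mult_cong) auto
            also have "\<dots> = (if j = 0 then \<one> else \<zero>)" using K0 n j by (simp add: M.Units_r_inv)
            finally show ?thesis .
          qed
          then show "K \<diamondop> inv\<^bsub>M\<^esub> K0 \<in> fixrow" using K K0 unfolding fixrow_def by auto
        qed
        show "finite fixrow" by (rule finite_subset[OF _ finite_Units]) (auto simp: fixrow_def)
      qed
    qed
  qed
  then show ?thesis by (simp add: card_PiE)
qed

lemma card_monics_nonzero: "card {p \<in> monics n. p ! n \<noteq> \<zero>} = (q - 1) * q ^ (n - 1)"
proof -
  have "{p \<in> monics n. p ! n \<noteq> \<zero>} = monics n - {p \<in> monics n. const_term p = \<zero>}"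
    using const_term_monic by auto
  then have "card {p \<in> monics n. p ! n \<noteq> \<zero>} = q ^ n - q ^ (n - 1)"
    using card_monics_const[OF n zero_closed] card_monics[of n] by (simp add: card_Diff_subset)
  also have "q ^ n = q * q ^ (n - 1)" using n by (cases n) auto
  finally show ?thesis by (simp add: diff_mult_distrib)
qed

text \<open>If \<open>J\<close> commutes with \<open>C\<close> and fixes the row vector
  \<open>e_0\<close>, it fixes every \<open>e_0 C^i\<close>, and these span. The induction carries
  this out row by row.\<close>

lemma fixrow_commute_companion:
  assumes J: "J \<in> fixrow" and p: "p \<in> monics n" and eq: "J \<diamondop> companion p = companion p \<diamondop> J"
  shows "J = \<one>\<^bsub>M\<^esub>"
proof -
  note Jf = fixrowD[OF J]
  have "\<forall>j<n. J $$ (i, j) = (if i = j then \<one> else \<zero>)" if "i < n" for i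
    using that
  proof (induction i)
    case 0
    then show ?case using Jf(3) by auto
  next
    case (Suc i)
    have pc: "p ! Suc i \<in> carrier R" using p Suc.prems by (auto simp: monicsD)
    show ?case
    proof (intro allI impI)
      fix j assume j: "j < n"
      have "(J \<diamondop> companion p) $$ (i, j) = (\<one>\<^bsub>M\<^esub> \<diamondop> companion p) $$ (i, j)"
        using Suc Jf(2) p j by (intro row_mult_cong) auto
      then have "(companion p \<diamondop> J) $$ (i, j) = companion p $$ (i, j)" using eq p by simp
      then have "\<ominus> (p ! Suc i) \<otimes> J $$ (0, j) \<oplus> J $$ (Suc i, j) = companion p $$ (i, j)"
        using companion_mult_left[OF p Jf(2), of i j] Suc.prems j by simp
      moreover have "companion p $$ (i, j) = \<ominus> (p ! Suc i) \<otimes> J $$ (0, j) \<oplus> (if Suc i = j then \<one> else \<zero>)"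
        using Suc.prems j n Jf(3)[OF j] pc by (auto simp: companion_entry)
      ultimately have "\<ominus> (p ! Suc i) \<otimes> J $$ (0, j) \<oplus> J $$ (Suc i, j) =
          \<ominus> (p ! Suc i) \<otimes> J $$ (0, j) \<oplus> (if Suc i = j then \<one> else \<zero>)" by (rule trans)
      moreover have "\<ominus> (p ! Suc i) \<otimes> J $$ (0, j) \<in> carrier R" "J $$ (Suc i, j) \<in> carrier R"
        using pc Jf(2) Suc.prems j n by auto
      ultimately show "J $$ (Suc i, j) = (if Suc i = j then \<one> else \<zero>)"
        by (subst (asm) add.l_cancel) auto
    qed
  qed
  then show ?thesis using Jf(2) by (intro mat_over_eqI[of _ R n]) auto
qed

text \<open>The map \<open>(K, p)\<close> to \<open>K^-1 C K\<close>, with \<open>C\<close> the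
  companion matrix of \<open>p\<close>, is injective: \<open>p\<close> is the characteristic
  polynomial of the image, and two choices of \<open>K\<close> differ by an element of
  \<open>fixrow\<close> commuting with \<open>C\<close>. A nonzero constant term makes the image
  invertible.\<close>

lemma card_good_ge: "card fixrow * ((q - 1) * q ^ (n - 1)) \<le> card good"
proof -
  let ?P = "{p \<in> monics n. p ! n \<noteq> \<zero>}"
  let ?f = "\<lambda>(K, p). inv\<^bsub>M\<^esub> K \<diamondop> companion p \<diamondop> K"
  have eqs: "K \<diamondop> ?f (K, p) = companion p \<diamondop> K" if "K \<in> fixrow" "p \<in> monics n" for K p
    using fixrowD[OF that(1)] that(2) by (simp add: M.m_assoc[symmetric] M.Units_r_inv)
  have un: "?f (K, p) \<in> Units M" if "K \<in> fixrow" "p \<in> ?P" for K p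
    using fixrowD[OF that(1)] that(2) companion_unit by auto
  have "card (fixrow \<times> ?P) \<le> card good"
  proof (rule card_inj_on_le)
    show "inj_on ?f (fixrow \<times> ?P)"
    proof (rule inj_onI, clarify)
      fix K p L r assume K: "K \<in> fixrow" and L: "L \<in> fixrow" and p: "p \<in> monics n" "p ! n \<noteq> \<zero>"
        and r: "r \<in> monics n" "r ! n \<noteq> \<zero>"
        and e: "inv\<^bsub>M\<^esub> K \<diamondop> companion p \<diamondop> K = inv\<^bsub>M\<^esub> L \<diamondop> companion r \<diamondop> L"
      note Kf = fixrowD[OF K] and Lf = fixrowD[OF L]
      define h where "h = inv\<^bsub>M\<^esub> K \<diamondop> companion p \<diamondop> K"
      have hc: "h \<in> carrier M" using Kf p unfolding h_def by auto
      have Kh: "K \<diamondop> h = companion p \<diamondop> K" using eqs[OF K p(1)] by (simp add: h_def)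
      have Lh: "L \<diamondop> h = companion r \<diamondop> L" using eqs[OF L r(1)] by (simp add: h_def e)
      have pr: "p = r"
        using charpoly_companion_conj[OF Kf(1) hc p(1) Kh] charpoly_companion_conj[OF Lf(1) hc r(1) Lh] by simp
      let ?J = "L \<diamondop> inv\<^bsub>M\<^esub> K"
      have Ic: "inv\<^bsub>M\<^esub> K \<in> carrier M" using Kf by auto
      have Cc: "companion p \<in> carrier M" using p by simp
      have "companion p = K \<diamondop> h \<diamondop> inv\<^bsub>M\<^esub> K"
        unfolding Kh using Kf Ic Cc by (simp add: M.m_assoc M.Units_r_inv)
      then have "?J \<diamondop> companion p = L \<diamondop> (inv\<^bsub>M\<^esub> K \<diamondop> K) \<diamondop> h \<diamondop> inv\<^bsub>M\<^esub> K"
        using Kf Lf Ic hc by (simp add: M.m_assoc del: M.Units_l_inv)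
      also have "\<dots> = L \<diamondop> h \<diamondop> inv\<^bsub>M\<^esub> K" using Kf Lf by (simp add: M.Units_l_inv)
      also have "\<dots> = companion p \<diamondop> ?J" unfolding Lh pr[symmetric] using Lf Ic Cc by (simp add: M.m_assoc)
      finally have "?J = \<one>\<^bsub>M\<^esub>" by (intro fixrow_commute_companion[OF fixrow_mult_inv[OF K L] p(1)])
      then have "?J \<diamondop> K = K" using Kf by simp
      then have "K = L" using Kf Lf Ic by (simp add: M.m_assoc M.Units_l_inv)
      then show "K = L \<and> p = r" using pr by simp
    qed
    show "?f ` (fixrow \<times> ?P) \<subseteq> good"
      unfolding good_def using eqs un by fastforce
    show "finite good" by (rule finite_subset[OF _ finite_Units]) (auto simp: good_def)
  qed
  then show ?thesis by (simp add: card_cartesian_product card_monics_nonzero)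
qed

text \<open>In \<open>card_Units_le\<close> and \<open>card_good_ge\<close> the number of elements
  of \<open>fixrow\<close> cancels, so the good share is at least
  \<open>(q - 1) * q^(n - 1) / q^n = 1 - 1 / q\<close>.\<close>

lemma card_not_good: "q * card (Units M - good) \<le> card (Units M)"
proof -
  have sub: "good \<subseteq> Units M" by (auto simp: good_def)
  then have "card (Units M - good) = card (Units M) - card good"
    using finite_Units by (intro card_Diff_subset) (auto intro: finite_subset)
  moreover have "q * card good \<ge> (q - 1) * card (Units M)"
  proof -
    have "(q - 1) * card (Units M) \<le> (q - 1) * (q ^ n * card fixrow)"
      by (intro mult_left_mono card_Units_le) auto
    also have "\<dots> = q * (card fixrow * ((q - 1) * q ^ (n - 1)))"
      using n by (cases n) (auto simp: ac_simps)
    also have "\<dots> \<le> q * card good" by (intro mult_left_mono card_good_ge) auto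
    finally show ?thesis .
  qed
  ultimately have "q * card (Units M - good) \<le> q * card (Units M) - (q - 1) * card (Units M)"
    by (simp add: diff_mult_distrib2)
  also have "\<dots> = card (Units M)" using q2 by (simp add: diff_mult_distrib[symmetric])
  finally show ?thesis .
qed

end

section \<open>Products of regular elliptic elements\<close>

context finite_matrix_field
begin

abbreviation G where "G \<equiv> carrier (GL R n)"
abbreviation gmult (infixl \<open>\<cdot>\<close> 70) where "g \<cdot> h \<equiv> g \<otimes>\<^bsub>GL R n\<^esub> h"

lemma G_M: "h \<in> G \<Longrightarrow> h \<in> carrier M" by (auto simp: GL_simps)

lemma finite_G: "finite G" using finite_Units by (simp add: GL_simps)

lemma N_pos: "real (card G) > 0" using finite_G GL.one_closed by (auto simp: card_gt_0_iff)

lemma good_G: "good \<subseteq> G" by (auto simp: good_def GL_simps)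

lemma unips_G: "w \<in> unips \<Longrightarrow> w \<in> G" using subgroup.subset[OF unips_subgroup] by auto

text \<open>Up to the constant \<open>negdet\<close> this is the determinant, in the form that can
  be read off the characteristic polynomial.\<close>

definition \<delta> :: "'a mat \<Rightarrow> 'a" where "\<delta> h = const_term (charpoly_over R h)"

lemma \<delta>_det: "h \<in> G \<Longrightarrow> \<delta> h = negdet \<otimes> det_over R h"
  unfolding \<delta>_def by (rule const_term_charpoly[OF G_M])

lemma \<delta>_closed: assumes "h \<in> G" shows "\<delta> h \<in> carrier R - {\<zero>}"
  unfolding \<delta>_det[OF assms] using negdet det_unit[of h] assms integral by (auto simp: GL_simps)

lemma det_G_mult: "g \<in> G \<Longrightarrow> h \<in> G \<Longrightarrow> det_over R (g \<cdot> h) = det_over R g \<otimes> det_over R h"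
  using det_over_mult[of g n h] G_M by (simp add: GL_simps)

lemma det_G_closed: "g \<in> G \<Longrightarrow> det_over R g \<in> carrier R" "g \<in> G \<Longrightarrow> det_over R g \<noteq> \<zero>"
  using det_unit by (auto simp: GL_simps)

text \<open>In general \<open>\<delta>\<close> is not multiplicative because of the factor
  \<open>negdet\<close>; this congruence is the trace of multiplicativity that the averages
  require.\<close>

lemma \<delta>_mult_cong:
  assumes "g \<in> G" "h \<in> G" "h' \<in> G" "\<delta> h = \<delta> h'"
  shows "\<delta> (g \<cdot> h) = \<delta> (g \<cdot> h')"
proof -
  have "det_over R h = det_over R h'"
    using assms(4) unfolding \<delta>_det[OF assms(2)] \<delta>_det[OF assms(3)]
    by (rule m_lcancel[OF negdet(2,1) det_G_closed(1)[OF assms(2)] det_G_closed(1)[OF assms(3)], THEN iffD1])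
  then show ?thesis using assms by (simp add: \<delta>_det det_G_mult GL.m_closed)
qed

lemma ex_\<delta>:
  assumes c: "c \<in> carrier R - {\<zero>}"
  shows "\<exists>g\<in>G. \<delta> g = c"
proof -
  have "card {p \<in> monics n. const_term p = c} > 0"
    using card_monics_const[OF n, of c] c q2 by simp
  then obtain p where p: "p \<in> monics n" "const_term p = c" by (metis (mono_tags, lifting) card_gt_0_iff empty_Collect_eq)
  then have "companion p \<in> Units M" using c const_term_monic[OF p(1)] by (intro companion_unit) auto
  moreover have "\<delta> (companion p) = c" using p by (simp add: \<delta>_def charpoly_companion)
  ultimately show ?thesis by (auto simp: GL_simps)
qed

text \<open>Left multiplication by a suitable \<open>g\<close> maps one fiber into the other; by
  symmetry all fibers have the same size.\<close>

lemma card_\<delta>_fiber_le: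
  assumes c: "c \<in> carrier R - {\<zero>}" and d: "d \<in> carrier R - {\<zero>}"
  shows "card {t \<in> G. \<delta> t = c} \<le> card {t \<in> G. \<delta> t = d}"
proof -
  obtain x where x: "x \<in> G" "\<delta> x = c" using ex_\<delta>[OF c] by auto
  obtain y where y: "y \<in> G" "\<delta> y = d" using ex_\<delta>[OF d] by auto
  let ?g = "y \<cdot> inv\<^bsub>GL R n\<^esub> x"
  have g: "?g \<in> G" using x y by auto
  show ?thesis
  proof (rule card_inj_on_le)
    show "inj_on (\<lambda>t. ?g \<cdot> t) {t \<in> G. \<delta> t = c}" using g by (auto simp: inj_on_def)
    show "(\<lambda>t. ?g \<cdot> t) ` {t \<in> G. \<delta> t = c} \<subseteq> {t \<in> G. \<delta> t = d}"
    proof safe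
      fix t assume t: "t \<in> G" "c = \<delta> t"
      show "?g \<cdot> t \<in> G" using g t by simp
      have "\<delta> (?g \<cdot> t) = \<delta> (?g \<cdot> x)" using g t x by (intro \<delta>_mult_cong) auto
      also have "?g \<cdot> x = y" using x y by (simp add: GL.m_assoc)
      finally show "\<delta> (?g \<cdot> t) = d" using y by simp
    qed
    show "finite {t \<in> G. \<delta> t = d}" using finite_G by simp
  qed
qed

lemma card_units: "real (card (carrier R - {\<zero>})) = real q - 1"
  using fin q2 by (simp add: of_nat_diff)

lemma sum_over_\<delta>:
  fixes f :: "'a \<Rightarrow> real"
  shows "(real q - 1) * (\<Sum>t\<in>G. f (\<delta> t)) = real (card G) * (\<Sum>c\<in>carrier R - {\<zero>}. f c)"
proof -
  let ?C = "carrier R - {\<zero>}"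
  define m where "m = card {t \<in> G. \<delta> t = \<one>}"
  have m: "card {t \<in> G. \<delta> t = c} = m" if "c \<in> ?C" for c
    unfolding m_def using card_\<delta>_fiber_le[OF that, of \<one>] card_\<delta>_fiber_le[of \<one> c] that by (auto intro: antisym)
  have eq: "(\<Sum>t\<in>G. h (\<delta> t)) = m * (\<Sum>c\<in>?C. h c)" for h :: "'a \<Rightarrow> real"
  proof -
    have "(\<Sum>t\<in>G. h (\<delta> t)) = (\<Sum>c\<in>?C. \<Sum>t\<in>{t \<in> G. \<delta> t = c}. h (\<delta> t))"
      using \<delta>_closed fin finite_G by (intro sum.group[symmetric]) auto
    also have "\<dots> = (\<Sum>c\<in>?C. m * h c)"
      by (intro sum.cong refl) (simp add: m)
    finally show ?thesis by (simp add: sum_distrib_left)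
  qed
  have "real (card G) = m * (real q - 1)" using eq[of "\<lambda>_. 1"] card_units by simp
  then show ?thesis unfolding eq by simp
qed

section \<open>Deviation from the conditional expectation given the determinant\<close>

definition ind :: "'a list set \<Rightarrow> 'a mat \<Rightarrow> real" where
  "ind B h = (if charpoly_over R h \<in> B then 1 else 0)"

text \<open>The share of \<open>B\<close> among the monic polynomials with constant term
  \<open>c\<close>: the conditional probability that a uniform characteristic polynomial would
  have.\<close>

definition dens :: "'a list set \<Rightarrow> 'a \<Rightarrow> real" where
  "dens B c = card {p \<in> monics n \<inter> B. const_term p = c} / real q ^ (n - 1)"

definition dev :: "'a list set \<Rightarrow> 'a mat \<Rightarrow> real" where
  "dev B h = ind B h - dens B (\<delta> h)"

lemma dens_bounds: assumes "c \<in> carrier R" shows "0 \<le> dens B c" "dens B c \<le> 1"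
proof -
  have "card {p \<in> monics n \<inter> B. const_term p = c} \<le> card {p \<in> monics n. const_term p = c}"
    by (intro card_mono) auto
  also have "\<dots> = q ^ (n - 1)" by (rule card_monics_const[OF n assms])
  finally have "real (card {p \<in> monics n \<inter> B. const_term p = c}) \<le> real (q ^ (n - 1))" by (rule of_nat_mono)
  then show "0 \<le> dens B c" "dens B c \<le> 1" unfolding dens_def using q2 by auto
qed

lemma dev_bound: assumes "h \<in> G" shows "\<bar>dev B h\<bar> \<le> 1"
  using dens_bounds[of "\<delta> h" B] \<delta>_closed[OF assms] by (auto simp: dev_def ind_def)

lemma class_dev: "GL.class_function (dev B)" and class_ind: "GL.class_function (ind B)"
  unfolding GL.class_function_def dev_def ind_def \<delta>_def by (simp_all add: charpoly_conj_GL)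

lemma good_unip_\<delta>:
  assumes "h \<in> good" "w \<in> unips" shows "\<delta> (h \<cdot> w) = \<delta> h"
  using bij_betwE[OF good_mult_unip[OF assms(1)]] assms(2) by (auto simp: \<delta>_def GL_simps)

text \<open>On the coset of a good \<open>h\<close> the characteristic polynomial takes each value
  with constant term \<open>\<delta> h\<close> once, and \<open>dens\<close> is by definition the
  mean of the indicator over these values.\<close>

lemma good_sum_dev:
  assumes h: "h \<in> good"
  shows "(\<Sum>w\<in>unips. dev B (h \<cdot> w)) = 0"
proof -
  let ?P = "{p \<in> monics n. const_term p = \<delta> h}"
  have dc: "\<delta> h \<in> carrier R" using \<delta>_closed h good_G by auto
  have "(\<Sum>w\<in>unips. ind B (h \<cdot> w)) = (\<Sum>w\<in>unips. if charpoly_over R (h \<diamondop> w) \<in> B then 1 else 0)"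
    by (simp add: ind_def GL_simps)
  also have "\<dots> = (\<Sum>p\<in>?P. if p \<in> B then 1 else 0)"
    using good_mult_unip[OF h] unfolding \<delta>_def[symmetric]
    by (rule sum.reindex_bij_betw[where g="\<lambda>p. if p \<in> B then 1 else 0"])
  also have "\<dots> = card {p \<in> monics n \<inter> B. const_term p = \<delta> h}"
  proof -
    have "{p \<in> ?P. p \<in> B} = {p \<in> monics n \<inter> B. const_term p = \<delta> h}" by auto
    then show ?thesis by (simp add: sum.inter_filter[symmetric])
  qed
  also have "\<dots> = (\<Sum>w\<in>unips. dens B (\<delta> (h \<cdot> w)))"
    using q2 by (simp add: good_unip_\<delta>[OF h] dens_def card_unips)
  finally show ?thesis by (simp add: dev_def sum_subtractf)
qed

lemma card_bad: "real (card (G - good)) \<le> real (card G) / q"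
proof -
  have "real (q * card (G - good)) \<le> real (card G)"
    using card_not_good by (intro of_nat_mono) (simp add: GL_simps)
  then show ?thesis using q2 by (simp add: field_simps)
qed

lemma sum_le_bad:
  assumes "\<And>h. h \<in> good \<Longrightarrow> f h = 0" "\<And>h. h \<in> G \<Longrightarrow> \<bar>f h\<bar> \<le> (B::real)"
  shows "(\<Sum>h\<in>G. \<bar>f h\<bar>) \<le> B * card G / q"
proof -
  have "(\<Sum>h\<in>G. \<bar>f h\<bar>) = (\<Sum>h\<in>G - good. \<bar>f h\<bar>)"
    using finite_G good_G assms(1) by (intro sum.mono_neutral_right) auto
  also have "\<dots> \<le> card (G - good) * B" using assms(2) by (intro sum_bounded_above) auto
  also have "\<dots> \<le> (card G / q) * B"
    using card_bad assms(2)[OF GL.one_closed] by (intro mult_right_mono) auto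
  finally show ?thesis by (simp add: ac_simps)
qed

text \<open>For \<open>n \<ge> 2\<close> this is \<open>mixing\<close> with
  \<open>\<beta> = 1 / q\<close>: the coset sums vanish at good elements, and the remaining ones
  make up at most a fraction \<open>1 / q\<close>. For \<open>n = 1\<close> the group
  \<open>unips\<close> is trivial, so \<open>dev\<close> itself vanishes at good elements and the
  double sum is bounded directly.\<close>

lemma dev_mixing:
  fixes a b :: "'a mat \<Rightarrow> real"
  assumes b: "GL.class_function b" and bB: "\<And>t. t \<in> G \<Longrightarrow> \<bar>b t\<bar> \<le> B" and aA: "\<And>t. t \<in> G \<Longrightarrow> \<bar>a t\<bar> \<le> A"
  shows "\<bar>\<Sum>h\<in>G. \<Sum>t\<in>G. a h * b t * dev S (h \<cdot> t)\<bar> \<le> A * B * (real (card G))\<^sup>2 * sqrt (3 / q)"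
proof -
  have A0: "0 \<le> A" "0 \<le> B" using aA[OF GL.one_closed] bB[OF GL.one_closed] by linarith+
  have qq: "real q \<ge> 2" using q2 by simp
  show ?thesis
  proof (cases "n = 1")
    case True
    have un: "unips = {\<one>\<^bsub>GL R n\<^esub>}"
    proof -
      have "card unips = 1" using True card_unips by simp
      then show ?thesis using subgroup.one_closed[OF unips_subgroup] by (metis card_1_singletonE singletonD)
    qed
    have z: "dev S h = 0" if "h \<in> good" for h
    proof -
      have "h \<in> G" using that good_G by auto
      then show ?thesis using good_sum_dev[OF that, of S] unfolding un by simp
    qed
    have "\<bar>\<Sum>h\<in>G. \<Sum>t\<in>G. a h * b t * dev S (h \<cdot> t)\<bar> \<le> (\<Sum>h\<in>G. \<Sum>t\<in>G. \<bar>a h * b t * dev S (h \<cdot> t)\<bar>)"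
      by (rule order_trans[OF sum_abs sum_mono[OF sum_abs]])
    also have "\<dots> \<le> (\<Sum>h\<in>G. \<Sum>t\<in>G. (A * B) * \<bar>dev S (h \<cdot> t)\<bar>)"
      unfolding abs_mult using aA bB A0 by (intro sum_mono mult_right_mono mult_mono) auto
    also have "\<dots> = (\<Sum>h\<in>G. (A * B) * (\<Sum>t\<in>G. \<bar>dev S t\<bar>))"
      using GL.sum_mult_left[of _ "\<lambda>t. \<bar>dev S t\<bar>"] by (simp add: sum_distrib_left[symmetric])
    also have "\<dots> \<le> (\<Sum>h\<in>G. (A * B) * (1 * card G / q))"
      using A0 sum_le_bad[OF z dev_bound] by (intro sum_mono mult_left_mono) auto
    also have "\<dots> = A * B * (real (card G))\<^sup>2 * (1 / q)" by (simp add: power2_eq_square)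
    also have "\<dots> \<le> A * B * (real (card G))\<^sup>2 * sqrt (3 / q)"
    proof (rule mult_left_mono)
      show "1 / real q \<le> sqrt (3 / q)" using qq by (intro real_le_rsqrt) (simp add: power2_eq_square field_simps)
    qed (use A0 in simp)
    finally show ?thesis .
  next
    case False
    then have n2: "n \<ge> 2" using n by simp
    have cu: "card unips \<ge> q"
    proof -
      have "q ^ 1 \<le> q ^ (n - 1)" using n2 q2 by (intro power_increasing) auto
      then show ?thesis by (simp add: card_unips)
    qed
    have w0: "unip (\<lambda>i. if i = 1 then \<one> else \<zero>) \<in> G" by (auto simp: GL_simps intro!: unip_unit)
    have "(\<Sum>h\<in>G. \<bar>\<Sum>w\<in>unips. dev S (h \<cdot> w)\<bar>) \<le> real (card unips) * card G / q"
    proof (rule sum_le_bad)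
      fix h assume h: "h \<in> G"
      have "\<bar>\<Sum>w\<in>unips. dev S (h \<cdot> w)\<bar> \<le> (\<Sum>w\<in>unips. \<bar>dev S (h \<cdot> w)\<bar>)" by (rule sum_abs)
      also have "\<dots> \<le> (\<Sum>w\<in>unips. 1)" using h unips_G by (intro sum_mono dev_bound) auto
      finally show "\<bar>\<Sum>w\<in>unips. dev S (h \<cdot> w)\<bar> \<le> card unips" by simp
    qed (rule good_sum_dev)
    then have small: "(\<Sum>h\<in>G. \<bar>\<Sum>w\<in>unips. dev S (h \<cdot> w)\<bar>) \<le> (1 / real q) * card G * card unips"
      by (simp add: ac_simps)
    have "\<bar>\<Sum>h\<in>G. \<Sum>t\<in>G. a h * b t * dev S (h \<cdot> t)\<bar>
        \<le> A * B * (real (card G))\<^sup>2 * sqrt (1 / real q + 2 / card unips)"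
      by (rule GL.mixing[OF finite_G class_dev dev_bound unips_subgroup _ w0 _ small b bB aA])
         (use cu q2 unips_conj in auto)
    also have "\<dots> \<le> A * B * (real (card G))\<^sup>2 * sqrt (3 / q)"
    proof (rule mult_left_mono)
      \<comment> \<open>Since \<open>card unips \<ge> q\<close>, the two error terms add up to
        \<open>1 / q + 2 / q\<close>.\<close>
      have "2 / real (card unips) \<le> 2 / q" using cu qq by (intro divide_left_mono) auto
      then show "sqrt (1 / real q + 2 / card unips) \<le> sqrt (3 / q)" by simp
    qed (use A0 in simp)
    finally show ?thesis .
  qed
qed

text \<open>The mean of \<open>dens B\<close> over the nonzero constant terms: the probability of
  \<open>B\<close> when the constant term is random too.\<close>

definition avg :: "'a list set \<Rightarrow> real" where
  "avg B = card {p \<in> monics n \<inter> B. const_term p \<noteq> \<zero>} / ((real q - 1) * real q ^ (n - 1))"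

lemma sum_dens: "(\<Sum>c\<in>carrier R - {\<zero>}. dens B c) = (real q - 1) * avg B"
proof -
  let ?S = "{p \<in> monics n \<inter> B. const_term p \<noteq> \<zero>}"
  have "card ?S = card {p \<in> ?S. const_term p = \<zero>} + (\<Sum>c\<in>carrier R - {\<zero>}. card {p \<in> ?S. const_term p = c})"
    by (rule card_by_const_term[of _ n]) auto
  also have "{p \<in> ?S. const_term p = \<zero>} = {}" by auto
  also have "(\<Sum>c\<in>carrier R - {\<zero>}. card {p \<in> ?S. const_term p = c}) =
      (\<Sum>c\<in>carrier R - {\<zero>}. card {p \<in> monics n \<inter> B. const_term p = c})"
    by (intro sum.cong refl arg_cong[where f=card]) auto
  finally have "card ?S = (\<Sum>c\<in>carrier R - {\<zero>}. card {p \<in> monics n \<inter> B. const_term p = c})" by simp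
  then show ?thesis
    unfolding dens_def avg_def sum_divide_distrib[symmetric] of_nat_sum[symmetric] using q2 by simp
qed

lemma sum_dens_\<delta>: "(\<Sum>t\<in>G. dens B (\<delta> t)) = card G * avg B"
proof -
  have "(real q - 1) * (\<Sum>t\<in>G. dens B (\<delta> t)) = (real q - 1) * (card G * avg B)"
    unfolding sum_over_\<delta> sum_dens by simp
  then show ?thesis using q2 by simp
qed

text \<open>A function of \<open>\<delta>\<close> alone is constant on the cosets of
  \<open>unips\<close> at good elements, where \<open>dev\<close> sums to zero. Averaging over right
  translates therefore leaves only the elements that are not good.\<close>

lemma sum_dev_weight:
  fixes g :: "'a mat \<Rightarrow> real"
  assumes g: "\<And>t. t \<in> G \<Longrightarrow> \<bar>g t\<bar> \<le> 1" and gd: "\<And>t t'. t \<in> G \<Longrightarrow> t' \<in> G \<Longrightarrow> \<delta> t = \<delta> t' \<Longrightarrow> g t = g t'"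
  shows "\<bar>\<Sum>t\<in>G. dev B t * g t\<bar> \<le> card G / q"
proof -
  have cu: "real (card unips) > 0"
    using subgroup.one_closed[OF unips_subgroup] finite_unips by (auto simp: card_gt_0_iff)
  have "card unips * (\<Sum>t\<in>G. dev B t * g t) = (\<Sum>w\<in>unips. \<Sum>t\<in>G. dev B t * g t)" by simp
  also have "\<dots> = (\<Sum>w\<in>unips. \<Sum>t\<in>G. dev B (t \<cdot> w) * g (t \<cdot> w))"
    using unips_G by (intro sum.cong refl GL.sum_mult_right[where f="\<lambda>t. dev B t * g t", symmetric]) auto
  also have "\<dots> = (\<Sum>t\<in>G. \<Sum>w\<in>unips. dev B (t \<cdot> w) * g (t \<cdot> w))" by (rule sum.swap)
  finally have eq: "card unips * (\<Sum>t\<in>G. dev B t * g t) = (\<Sum>t\<in>G. \<Sum>w\<in>unips. dev B (t \<cdot> w) * g (t \<cdot> w))" .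
  have "\<bar>\<Sum>t\<in>G. \<Sum>w\<in>unips. dev B (t \<cdot> w) * g (t \<cdot> w)\<bar> \<le> (\<Sum>t\<in>G. \<bar>\<Sum>w\<in>unips. dev B (t \<cdot> w) * g (t \<cdot> w)\<bar>)"
    by (rule sum_abs)
  also have "\<dots> \<le> real (card unips) * card G / q"
  proof (rule sum_le_bad)
    fix t assume t: "t \<in> good"
    have tG: "t \<in> G" using t good_G by auto
    have "(\<Sum>w\<in>unips. dev B (t \<cdot> w) * g (t \<cdot> w)) = (\<Sum>w\<in>unips. dev B (t \<cdot> w) * g t)"
      using unips_G tG good_unip_\<delta>[OF t] by (intro sum.cong refl arg_cong2[where f=times] gd) auto
    then show "(\<Sum>w\<in>unips. dev B (t \<cdot> w) * g (t \<cdot> w)) = 0"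
      using good_sum_dev[OF t, of B] by (simp add: sum_distrib_right[symmetric])
  next
    fix t assume t: "t \<in> G"
    have "\<bar>\<Sum>w\<in>unips. dev B (t \<cdot> w) * g (t \<cdot> w)\<bar> \<le> (\<Sum>w\<in>unips. \<bar>dev B (t \<cdot> w) * g (t \<cdot> w)\<bar>)" by (rule sum_abs)
    also have "\<dots> \<le> (\<Sum>w\<in>unips. 1)"
      unfolding abs_mult using t unips_G by (intro sum_mono mult_le_one dev_bound g) auto
    finally show "\<bar>\<Sum>w\<in>unips. dev B (t \<cdot> w) * g (t \<cdot> w)\<bar> \<le> card unips" by simp
  qed
  finally have "card unips * \<bar>\<Sum>t\<in>G. dev B t * g t\<bar> \<le> card unips * (card G / q)"
    unfolding eq[symmetric] using cu by (simp add: abs_mult)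
  then show ?thesis using cu by (simp only: mult_le_cancel_left_pos)
qed

text \<open>The first term comes from the elements that are not good, the second from the uneven
  distribution of the constant terms of irreducible polynomials, by \<open>irr_const_asymp\<close>
  spread over \<open>q - 1\<close> values.\<close>

definition err :: real where
  "err = 1 / q + (2 * real n + real n * 2 ^ n + 2) / (real q - 1)"

text \<open>Split \<open>ind I\<close> into \<open>dev I\<close>, the difference of
  \<open>dens I\<close> from \<open>1 / n\<close>, and \<open>1 / n\<close>; the first is handled by
  \<open>sum_dev_weight\<close>, the second by \<open>irr_const_asymp\<close>. The set
  \<open>I\<close> is prescribed only on monic polynomials of degree \<open>n\<close>, as it will be
  given by a definite description.\<close>

lemma elliptic_weight:
  fixes g :: "'a mat \<Rightarrow> real"
  assumes I: "monics n \<inter> I = irr n"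
    and g: "\<And>t. t \<in> G \<Longrightarrow> \<bar>g t\<bar> \<le> 1" and gd: "\<And>t t'. t \<in> G \<Longrightarrow> t' \<in> G \<Longrightarrow> \<delta> t = \<delta> t' \<Longrightarrow> g t = g t'"
  shows "\<bar>(\<Sum>t\<in>G. ind I t * g t) - (\<Sum>t\<in>G. g t) / n\<bar> \<le> card G * err"
proof -
  have q1: "real q - 1 > 0" using q2 by simp
  have "(\<Sum>t\<in>G. \<bar>dens I (\<delta> t) - 1 / n\<bar>) \<le> real (card G) * ((2 * real n + real n * 2 ^ n + 2) / (real q - 1))"
  proof -
    have "(real q - 1) * (\<Sum>t\<in>G. \<bar>dens I (\<delta> t) - 1 / n\<bar>) = card G * (\<Sum>c\<in>carrier R - {\<zero>}. \<bar>dens I c - 1 / n\<bar>)"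
      by (rule sum_over_\<delta>)
    also have "\<dots> \<le> real (card G) * (2 * real n + real n * 2 ^ n + 2)"
      using irr_const_asymp[OF n] unfolding dens_def I by (intro mult_left_mono) auto
    finally show ?thesis using q1 by (simp add: field_simps)
  qed
  moreover have "\<bar>\<Sum>t\<in>G. (dens I (\<delta> t) - 1 / n) * g t\<bar> \<le> (\<Sum>t\<in>G. \<bar>dens I (\<delta> t) - 1 / n\<bar>)"
  proof -
    have "\<bar>\<Sum>t\<in>G. (dens I (\<delta> t) - 1 / n) * g t\<bar> \<le> (\<Sum>t\<in>G. \<bar>dens I (\<delta> t) - 1 / n\<bar> * \<bar>g t\<bar>)"
      unfolding abs_mult[symmetric] by (rule sum_abs)
    also have "\<dots> \<le> (\<Sum>t\<in>G. \<bar>dens I (\<delta> t) - 1 / n\<bar> * 1)" using g by (intro sum_mono mult_left_mono) auto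
    finally show ?thesis by simp
  qed
  moreover have "\<bar>\<Sum>t\<in>G. dev I t * g t\<bar> \<le> card G / q" by (rule sum_dev_weight[OF g gd])
  moreover have "(\<Sum>t\<in>G. ind I t * g t) - (\<Sum>t\<in>G. g t) / n =
      (\<Sum>t\<in>G. dev I t * g t) + (\<Sum>t\<in>G. (dens I (\<delta> t) - 1 / n) * g t)"
    by (simp add: dev_def sum_subtractf[symmetric] sum.distrib[symmetric] sum_divide_distrib algebra_simps)
  ultimately show ?thesis unfolding err_def distrib_left by (simp add: abs_le_iff)
qed

end

section \<open>Counting tuples by their product\<close>

context group
begin

text \<open>The \<open>k\<close>-fold convolution of the indicator function of
  \<open>S\<close>.\<close>

definition tuple_count :: "'a set \<Rightarrow> nat \<Rightarrow> 'a \<Rightarrow> nat" where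
  "tuple_count S k h = card {ts. set ts \<subseteq> S \<and> length ts = k \<and> foldr (\<otimes>) ts \<one> = h}"

lemma foldr_closed: "set ts \<subseteq> carrier G \<Longrightarrow> foldr (\<otimes>) ts \<one> \<in> carrier G"
  by (induction ts) auto

lemma sum_tuples:
  fixes f :: "'a \<Rightarrow> real"
  assumes fin: "finite (carrier G)" and S: "S \<subseteq> carrier G"
  shows "(\<Sum>h\<in>carrier G. real (tuple_count S k h) * f h) =
     (\<Sum>ts | set ts \<subseteq> S \<and> length ts = k. f (foldr (\<otimes>) ts \<one>))"
proof -
  let ?L = "{ts. set ts \<subseteq> S \<and> length ts = k}"
  have fL: "finite ?L" using S fin by (intro finite_lists_length_eq) (rule finite_subset)
  have "(\<Sum>ts\<in>?L. f (foldr (\<otimes>) ts \<one>)) =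
     (\<Sum>h\<in>carrier G. \<Sum>ts\<in>{ts \<in> ?L. foldr (\<otimes>) ts \<one> = h}. f (foldr (\<otimes>) ts \<one>))"
    using fL fin S foldr_closed by (intro sum.group[symmetric]) auto
  also have "\<dots> = (\<Sum>h\<in>carrier G. real (tuple_count S k h) * f h)"
    by (intro sum.cong refl) (simp add: tuple_count_def conj_assoc)
  finally show ?thesis ..
qed

lemma sum_tuple_count:
  assumes fin: "finite (carrier G)" and S: "S \<subseteq> carrier G"
  shows "(\<Sum>h\<in>carrier G. real (tuple_count S k h)) = real (card S) ^ k"
proof -
  have "finite S" using S fin by (rule finite_subset)
  then have "card {ts. set ts \<subseteq> S \<and> length ts = k} = card S ^ k" by (rule card_lists_length_eq)
  then show ?thesis using sum_tuples[OF assms, of k "\<lambda>_. 1"] by simp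
qed

text \<open>The remaining entries and the product determine the first entry. This is the uniform
  bound on the weight in the mixing estimate.\<close>

lemma tuple_count_le:
  assumes fin: "finite (carrier G)" and S: "S \<subseteq> carrier G"
  shows "tuple_count S (Suc k) h \<le> card S ^ k"
proof -
  have fS: "finite S" using S fin by (rule finite_subset)
  have "card {ts. set ts \<subseteq> S \<and> length ts = Suc k \<and> foldr (\<otimes>) ts \<one> = h} \<le> card {ts. set ts \<subseteq> S \<and> length ts = k}"
  proof (rule card_inj_on_le[where f=tl])
    show "inj_on tl {ts. set ts \<subseteq> S \<and> length ts = Suc k \<and> foldr (\<otimes>) ts \<one> = h}"
    proof (rule inj_onI)
      fix xs ys assume xs: "xs \<in> {ts. set ts \<subseteq> S \<and> length ts = Suc k \<and> foldr (\<otimes>) ts \<one> = h}"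
        and ys: "ys \<in> {ts. set ts \<subseteq> S \<and> length ts = Suc k \<and> foldr (\<otimes>) ts \<one> = h}" and tl: "tl xs = tl ys"
      obtain x xs' where x: "xs = x # xs'" using xs by (cases xs) auto
      obtain y ys' where y: "ys = y # ys'" using ys by (cases ys) auto
      have yx: "ys' = xs'" using tl x y by simp
      have c: "x \<in> carrier G" "y \<in> carrier G" "foldr (\<otimes>) xs' \<one> \<in> carrier G"
        using xs ys x y S by (auto intro!: foldr_closed)
      have "x \<otimes> foldr (\<otimes>) xs' \<one> = y \<otimes> foldr (\<otimes>) xs' \<one>" using xs ys x y yx by simp
      then have "x = y" using c by simp
      then show "xs = ys" using x y yx by simp
    qed
    show "finite {ts. set ts \<subseteq> S \<and> length ts = k}" by (rule finite_lists_length_eq[OF fS])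
  qed (auto simp: length_Suc_conv)
  then show ?thesis unfolding tuple_count_def using card_lists_length_eq[OF fS] by simp
qed

text \<open>Splitting off the first entry writes the count as a bilinear sum over two group
  elements, the shape in which mixing applies.\<close>

lemma card_tuples_Suc:
  assumes fin: "finite (carrier G)" and S: "S \<subseteq> carrier G"
  shows "real (card {ts. length ts = Suc k \<and> set ts \<subseteq> S \<and> foldr (\<otimes>) ts \<one> \<in> B}) =
    (\<Sum>t\<in>S. \<Sum>h\<in>carrier G. real (tuple_count S k h) * (if t \<otimes> h \<in> B then 1 else 0))"
proof -
  let ?L = "{ts. set ts \<subseteq> S \<and> length ts = k}"
  let ?A = "{ts. length ts = Suc k \<and> set ts \<subseteq> S \<and> foldr (\<otimes>) ts \<one> \<in> B}"
  have fS: "finite S" using S fin by (rule finite_subset)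
  have fL: "finite ?L" by (rule finite_lists_length_eq[OF fS])
  have "?A = (\<lambda>(t, ts). t # ts) ` (SIGMA t:S. {ts \<in> ?L. t \<otimes> foldr (\<otimes>) ts \<one> \<in> B})"
  proof (intro equalityI subsetI)
    fix ts assume "ts \<in> ?A"
    then show "ts \<in> (\<lambda>(t, ts). t # ts) ` (SIGMA t:S. {ts \<in> ?L. t \<otimes> foldr (\<otimes>) ts \<one> \<in> B})"
      by (cases ts) (auto simp: image_iff)
  qed auto
  moreover have "inj_on (\<lambda>(t, ts). t # ts) (SIGMA t:S. {ts \<in> ?L. t \<otimes> foldr (\<otimes>) ts \<one> \<in> B})"
    by (auto simp: inj_on_def)
  ultimately have "card ?A = card (SIGMA t:S. {ts \<in> ?L. t \<otimes> foldr (\<otimes>) ts \<one> \<in> B})" by (simp add: card_image)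
  also have "\<dots> = (\<Sum>t\<in>S. card {ts \<in> ?L. t \<otimes> foldr (\<otimes>) ts \<one> \<in> B})"
    using fS by (intro card_SigmaI) (auto intro: finite_subset[OF _ fL])
  finally have "real (card ?A) = (\<Sum>t\<in>S. real (card {ts \<in> ?L. t \<otimes> foldr (\<otimes>) ts \<one> \<in> B}))" by simp
  also have "\<dots> = (\<Sum>t\<in>S. \<Sum>ts\<in>?L. if t \<otimes> foldr (\<otimes>) ts \<one> \<in> B then 1 else 0)"
    using fL by (intro sum.cong refl) (simp add: sum.inter_filter[symmetric])
  also have "\<dots> = (\<Sum>t\<in>S. \<Sum>h\<in>carrier G. real (tuple_count S k h) * (if t \<otimes> h \<in> B then 1 else 0))"
    by (intro sum.cong refl sum_tuples[OF fin S, symmetric])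
  finally show ?thesis .
qed

end

section \<open>Products of elliptic elements with prescribed type\<close>

context finite_matrix_field
begin

lemma avg_bounds: "0 \<le> avg B" "avg B \<le> 1"
proof -
  have q1: "real q - 1 > 0" using q2 by simp
  show "0 \<le> avg B" unfolding avg_def using q1 by simp
  have "(real q - 1) * avg B = (\<Sum>c\<in>carrier R - {\<zero>}. dens B c)" by (rule sum_dens[symmetric])
  also have "\<dots> \<le> (\<Sum>c\<in>carrier R - {\<zero>}. 1)" using dens_bounds by (intro sum_mono) auto
  also have "\<dots> = (real q - 1) * 1" using card_units by simp
  finally show "avg B \<le> 1" using q1 by (simp only: mult_le_cancel_left_pos)
qed

text \<open>The weight \<open>a\<close> describes the last \<open>k - 1\<close> factors and
  \<open>ind I\<close> the first. In the split \<open>ind B = dev B + dens B\<close>, the deviation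
  is bounded by \<open>dev_mixing\<close>. For fixed \<open>h\<close> the other part depends on
  \<open>t\<close> only through \<open>\<delta> t\<close>, so \<open>elliptic_weight\<close>
  replaces \<open>ind I\<close> by \<open>1 / n\<close>, and translation by \<open>h\<close> drops
  out of the sum over the group.\<close>

lemma product_count_bound:
  assumes I: "monics n \<inter> I = irr n" and k: "k \<ge> 2"
  defines "T \<equiv> {h \<in> G. charpoly_over R h \<in> I}"
  shows "\<bar>real (card {ts. length ts = k \<and> set ts \<subseteq> T \<and> foldr (\<cdot>) ts \<one>\<^bsub>GL R n\<^esub> \<in> {h \<in> G. charpoly_over R h \<in> B}})
      - avg B * real (card T) ^ k\<bar>
     \<le> real (card T) ^ (k - 2) * (real (card G))\<^sup>2 * sqrt (3 / q) + real (card T) ^ (k - 1) * (2 * card G * err)"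
proof -
  define a where "a h = real (GL.tuple_count T (k - 1) h)" for h
  have TG: "T \<subseteq> G" by (auto simp: T_def)
  have cT: "real (card T) = (\<Sum>t\<in>G. ind I t)"
    unfolding T_def ind_def using finite_G by (simp add: sum.inter_filter[symmetric])
  have k1: "Suc (k - 1) = k" "Suc (k - 2) = k - 1" using k by auto
  have aA: "\<bar>a h\<bar> \<le> real (card T) ^ (k - 2)" for h
    using GL.tuple_count_le[OF finite_G TG, of "k - 2" h] unfolding a_def k1
    by (metis abs_of_nat of_nat_le_iff of_nat_power)
  have a_sum: "(\<Sum>h\<in>G. a h) = real (card T) ^ (k - 1)"
    unfolding a_def by (rule GL.sum_tuple_count[OF finite_G TG])
  have "real (card {ts. length ts = k \<and> set ts \<subseteq> T \<and> foldr (\<cdot>) ts \<one>\<^bsub>GL R n\<^esub> \<in> {h \<in> G. charpoly_over R h \<in> B}})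
     = (\<Sum>t\<in>T. \<Sum>h\<in>G. a h * (if t \<cdot> h \<in> {h \<in> G. charpoly_over R h \<in> B} then 1 else 0))"
    using GL.card_tuples_Suc[OF finite_G TG, of "k - 1" "{h \<in> G. charpoly_over R h \<in> B}"] unfolding k1 a_def .
  \<comment> \<open>The products \<open>t h\<close> and \<open>h t\<close> are conjugate; the second
    order is the one used in \<open>dev_mixing\<close>.\<close>
  also have "\<dots> = (\<Sum>t\<in>T. \<Sum>h\<in>G. a h * ind B (h \<cdot> t))"
  proof (intro sum.cong refl arg_cong2[where f=times])
    fix t h assume "t \<in> T" and h: "h \<in> G"
    then have t: "t \<in> G" using TG by auto
    show "(if t \<cdot> h \<in> {h \<in> G. charpoly_over R h \<in> B} then 1 else 0) = ind B (h \<cdot> t)"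
      using GL.class_function_commute[OF class_ind t h, of B] t h by (simp add: ind_def)
  qed
  also have "\<dots> = (\<Sum>t\<in>G. ind I t * (\<Sum>h\<in>G. a h * ind B (h \<cdot> t)))"
  proof -
    have "(\<Sum>t\<in>G. ind I t * (\<Sum>h\<in>G. a h * ind B (h \<cdot> t))) =
        (\<Sum>t\<in>G. if charpoly_over R t \<in> I then (\<Sum>h\<in>G. a h * ind B (h \<cdot> t)) else 0)"
      by (intro sum.cong refl) (simp add: ind_def)
    then show ?thesis unfolding T_def using finite_G by (simp add: sum.inter_filter)
  qed
  also have "\<dots> = (\<Sum>h\<in>G. \<Sum>t\<in>G. a h * ind I t * ind B (h \<cdot> t))"
    unfolding sum_distrib_left by (subst sum.swap) (simp add: ac_simps)
  also have "\<dots> = (\<Sum>h\<in>G. \<Sum>t\<in>G. a h * ind I t * dev B (h \<cdot> t)) +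
      (\<Sum>h\<in>G. a h * (\<Sum>t\<in>G. ind I t * dens B (\<delta> (h \<cdot> t))))"
    by (simp add: dev_def sum_distrib_left sum.distrib[symmetric] algebra_simps)
  finally have num: "real (card {ts. length ts = k \<and> set ts \<subseteq> T \<and> foldr (\<cdot>) ts \<one>\<^bsub>GL R n\<^esub> \<in> {h \<in> G. charpoly_over R h \<in> B}})
     = (\<Sum>h\<in>G. \<Sum>t\<in>G. a h * ind I t * dev B (h \<cdot> t)) +
      (\<Sum>h\<in>G. a h * (\<Sum>t\<in>G. ind I t * dens B (\<delta> (h \<cdot> t))))" (is "_ = ?D + ?S") .
  have D: "\<bar>?D\<bar> \<le> real (card T) ^ (k - 2) * (real (card G))\<^sup>2 * sqrt (3 / q)"
    using dev_mixing[OF class_ind, of I 1 a "real (card T) ^ (k - 2)" B] aA by (simp add: ind_def)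
  have inner: "\<bar>(\<Sum>t\<in>G. ind I t * dens B (\<delta> (h \<cdot> t))) - avg B * card T\<bar> \<le> 2 * card G * err" if h: "h \<in> G" for h
  proof -
    have "\<bar>(\<Sum>t\<in>G. ind I t * dens B (\<delta> (h \<cdot> t))) - (\<Sum>t\<in>G. dens B (\<delta> (h \<cdot> t))) / n\<bar> \<le> card G * err"
    proof (rule elliptic_weight[OF I])
      fix t assume "t \<in> G"
      then have "h \<cdot> t \<in> G" using h by simp
      from \<delta>_closed[OF this] dens_bounds[of "\<delta> (h \<cdot> t)" B]
      show "\<bar>dens B (\<delta> (h \<cdot> t))\<bar> \<le> 1" by auto
    next
      fix t t' assume "t \<in> G" "t' \<in> G" "\<delta> t = \<delta> t'"
      then have "\<delta> (h \<cdot> t) = \<delta> (h \<cdot> t')" by (rule \<delta>_mult_cong[OF h])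
      then show "dens B (\<delta> (h \<cdot> t)) = dens B (\<delta> (h \<cdot> t'))" by (rule arg_cong)
    qed
    moreover have "(\<Sum>t\<in>G. dens B (\<delta> (h \<cdot> t))) = card G * avg B"
      using GL.sum_mult_left[OF h, of "\<lambda>t. dens B (\<delta> t)"] sum_dens_\<delta> by simp
    \<comment> \<open>The second of the two error terms \<open>card G * err\<close>: it trades
      \<open>card G / n\<close> for the actual number of elliptic elements.\<close>
    moreover have "\<bar>avg B * card T - avg B * (card G / n)\<bar> \<le> card G * err"
    proof -
      have e0: "\<bar>card T - card G / n\<bar> \<le> card G * err"
        using elliptic_weight[OF I, of "\<lambda>_. 1"] cT by simp
      have "\<bar>avg B * card T - avg B * (card G / n)\<bar> = avg B * \<bar>card T - card G / n\<bar>"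
        using avg_bounds(1)[of B] by (simp add: right_diff_distrib[symmetric] abs_mult del: times_divide_eq_right)
      also have "\<dots> \<le> 1 * \<bar>card T - card G / n\<bar>" using avg_bounds(2) by (intro mult_right_mono) auto
      finally show ?thesis using e0 by simp
    qed
    ultimately show ?thesis by (simp add: abs_le_iff mult.commute)
  qed
  have "\<bar>?S - avg B * real (card T) ^ k\<bar> = \<bar>\<Sum>h\<in>G. a h * ((\<Sum>t\<in>G. ind I t * dens B (\<delta> (h \<cdot> t))) - avg B * card T)\<bar>"
  proof -
    have "avg B * real (card T) ^ k = (\<Sum>h\<in>G. a h * (avg B * card T))"
      unfolding sum_distrib_right[symmetric] a_sum using k by (cases k) auto
    then show ?thesis by (simp add: right_diff_distrib sum_subtractf)
  qed
  also have "\<dots> \<le> (\<Sum>h\<in>G. a h * (2 * card G * err))"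
  proof (rule order_trans[OF sum_abs sum_mono])
    fix h assume h: "h \<in> G"
    show "\<bar>a h * ((\<Sum>t\<in>G. ind I t * dens B (\<delta> (h \<cdot> t))) - avg B * card T)\<bar> \<le> a h * (2 * card G * err)"
      unfolding abs_mult using inner[OF h] by (simp add: a_def mult_left_mono)
  qed
  also have "\<dots> = real (card T) ^ (k - 1) * (2 * card G * err)"
    unfolding sum_distrib_right[symmetric] a_sum ..
  finally show ?thesis unfolding num using D by linarith
qed

text \<open>The description of the cycle type as a function of the polynomial, so that
  \<open>T_set\<close> becomes a condition on the characteristic polynomial.\<close>

definition ctype :: "'a list \<Rightarrow> nat multiset" where
  "ctype f = (THE \<mu>. \<exists>fs. set fs \<subseteq> carrier (Ring_Divisibility.mult_of (poly_ring R)) \<and>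
                  factors (Ring_Divisibility.mult_of (poly_ring R)) fs f \<and>
                  \<mu> = mset (map (\<lambda>f. degree f) fs))"

lemma cycle_type_ctype: "cycle_type R A = ctype (charpoly_over R A)"
  by (simp add: cycle_type_def ctype_def)

text \<open>Every monic polynomial of degree \<open>n\<close> is the characteristic polynomial of
  its companion matrix, which transfers the statement from matrices.\<close>

lemma ctype_sqfree: "f \<in> monics n \<Longrightarrow> sqfree f \<Longrightarrow> ctype f = fac_type f"
  using cycle_type_sqfree[of "companion f" n] n by (simp add: cycle_type_ctype charpoly_companion)

lemma ctype_irr: "f \<in> monics n \<Longrightarrow> ctype f = {#n#} \<longleftrightarrow> f \<in> irr n"
  using cycle_type_irr[of "companion f" n] n by (simp add: cycle_type_ctype charpoly_companion)

lemma T_set_charpoly: "T_set R n \<mu> = {h \<in> G. charpoly_over R h \<in> {f. ctype f = \<mu>}}"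
  by (simp add: T_set_def cycle_type_ctype)

lemma T_box_set_charpoly: "T_box_set R n \<mu> = {h \<in> G. charpoly_over R h \<in> {f. ctype f = \<mu> \<and> sqfree f}}"
  unfolding T_box_set_def T_set_def by (auto simp: cycle_type_ctype regular_semisimple_sqfree)

text \<open>The bound on \<open>err\<close> guarantees that at least a fraction
  \<open>1 / (2 n)\<close> of the group is elliptic. After division by the number of tuples the
  weights become powers of \<open>N / t\<close>, which is at most \<open>2 * n\<close>; this gives
  the constants \<open>4 * n^2\<close> and \<open>4 * n\<close>.\<close>

lemma product_prob_bound:
  assumes k: "k \<ge> 2" and e: "err \<le> 1 / (2 * n)"
  shows "\<bar>product_prob R n k {h \<in> G. charpoly_over R h \<in> B} - avg B\<bar> \<le> 4 * (real n)\<^sup>2 * sqrt (3 / q) + 4 * n * err"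
proof -
  let ?I = "{f. ctype f = {#n#}}"
  define T where "T = {h \<in> G. charpoly_over R h \<in> ?I}"
  define t where "t = real (card T)"
  define N where "N = real (card G)"
  have N: "N > 0" using N_pos by (simp add: N_def)
  have n0: "real n > 0" using n by simp
  have I: "monics n \<inter> ?I = irr n" using ctype_irr irr_subset by auto
  have "\<bar>t - N / n\<bar> \<le> N * err"
  proof -
    have "t = (\<Sum>h\<in>G. ind ?I h)"
      unfolding t_def T_def ind_def using finite_G by (simp add: sum.inter_filter[symmetric])
    then show ?thesis using elliptic_weight[OF I, of "\<lambda>_. 1"] by (simp add: N_def)
  qed
  moreover have "N * err \<le> N * (1 / (2 * n))" using N e by (intro mult_left_mono) auto
  moreover have "N / n = 2 * (N * (1 / (2 * n)))" using n0 by simp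
  ultimately have "t \<ge> N * (1 / (2 * n))" by linarith
  then have tN: "t \<ge> N / (2 * n)" by simp
  moreover have "N / (2 * n) > 0" using N n0 by simp
  ultimately have t: "t > 0" by linarith
  have Nt: "N / t \<le> 2 * n" "0 \<le> N / t" using tN t N n0 by (auto simp: field_simps)
  have err0: "err \<ge> 0" unfolding err_def using q2 by simp
  define c where "c = real (card {ts. length ts = k \<and> set ts \<subseteq> T \<and> foldr (\<cdot>) ts \<one>\<^bsub>GL R n\<^esub> \<in> {h \<in> G. charpoly_over R h \<in> B}})"
  have pp: "product_prob R n k {h \<in> G. charpoly_over R h \<in> B} = c / t ^ k"
    unfolding product_prob_def T_set_charpoly c_def t_def T_def ..
  have "\<bar>c - avg B * t ^ k\<bar> \<le> t ^ (k - 2) * N\<^sup>2 * sqrt (3 / q) + t ^ (k - 1) * (2 * N * err)"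
    using product_count_bound[OF I k, of B] unfolding c_def t_def N_def T_def by simp
  then have "\<bar>c - avg B * t ^ k\<bar> / t ^ k \<le> (t ^ (k - 2) * N\<^sup>2 * sqrt (3 / q) + t ^ (k - 1) * (2 * N * err)) / t ^ k"
    using t by (intro divide_right_mono) auto
  also have "\<dots> = (N / t)\<^sup>2 * sqrt (3 / q) + 2 * (N / t) * err"
  proof -
    obtain m where m: "k = Suc (Suc m)" using k by (metis Suc_diff_le add_2_eq_Suc le_add_diff_inverse)
    show ?thesis using t by (simp add: m field_simps power2_eq_square)
  qed
  also have "\<dots> \<le> (2 * real n)\<^sup>2 * sqrt (3 / q) + 2 * (2 * real n) * err"
  proof -
    have "(N / t)\<^sup>2 \<le> (2 * real n)\<^sup>2" using Nt by (intro power_mono) auto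
    then show ?thesis using Nt err0 by (intro add_mono mult_right_mono mult_left_mono) auto
  qed
  finally have "\<bar>c - avg B * t ^ k\<bar> / t ^ k \<le> 4 * (real n)\<^sup>2 * sqrt (3 / q) + 4 * n * err"
    by (simp add: power2_eq_square)
  moreover have "\<bar>c / t ^ k - avg B\<bar> = \<bar>c - avg B * t ^ k\<bar> / t ^ k"
  proof -
    have "c / t ^ k - avg B = (c - avg B * t ^ k) / t ^ k" using t by (simp add: field_simps)
    then show ?thesis using t by simp
  qed
  ultimately show ?thesis unfolding pp by simp
qed

text \<open>Both sets of interest agree with the square-free polynomials of type
  \<open>\<mu>\<close> up to polynomials that are not square-free, so they share one estimate. The
  factor \<open>1 - 1 / q\<close> changes the denominator of \<open>avg\<close> into
  \<open>q^n\<close>.\<close>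

lemma avg_type_bound:
  assumes mu: "partition_of n \<mu>"
    and lo: "{f \<in> monics n. sqfree f \<and> fac_type f = \<mu>} \<subseteq> B"
    and up: "monics n \<inter> B \<subseteq> {f \<in> monics n. sqfree f \<and> fac_type f = \<mu>} \<union> {f \<in> monics n. \<not> sqfree f}"
  shows "\<bar>avg B * (1 - 1 / q) - (\<Prod>i\<in>set_mset \<mu>. card (irr i) choose count \<mu> i) / real q ^ n\<bar> \<le> n / q"
proof -
  let ?F = "{f \<in> monics n. sqfree f \<and> fac_type f = \<mu>}" and ?C = "{p \<in> monics n \<inter> B. const_term p \<noteq> \<zero>}"
  define Q where "Q = real q ^ (n - 1)"
  have q0: "real q > 1" using q2 by simp
  have Q: "Q > 0" using q0 unfolding Q_def by simp
  have qQ: "real q ^ n = q * Q" using n unfolding Q_def by (cases n) auto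
  have finC: "finite ?C" and finF: "finite ?F" by auto
  have "card ?C \<le> card (?F \<union> {f \<in> monics n. \<not> sqfree f})" using up by (intro card_mono) auto
  also have "\<dots> \<le> card ?F + card {f \<in> monics n. \<not> sqfree f}" by (rule card_Un_le)
  also have "\<dots> \<le> card ?F + n * q ^ (n - 1)" by (intro add_left_mono card_not_sqfree)
  finally have 1: "card ?C \<le> card ?F + n * q ^ (n - 1)" .
  have "card ?F \<le> card (?C \<union> {p \<in> monics n. const_term p = \<zero>})" using lo by (intro card_mono) auto
  also have "\<dots> \<le> card ?C + card {p \<in> monics n. const_term p = \<zero>}" by (rule card_Un_le)
  also have "card {p \<in> monics n. const_term p = \<zero>} = q ^ (n - 1)" by (rule card_monics_const[OF n zero_closed])
  \<comment> \<open>Weakened so that both inequalities carry the same error.\<close>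
  also have "q ^ (n - 1) \<le> n * q ^ (n - 1)" using n by simp
  finally have 2: "card ?F \<le> card ?C + n * q ^ (n - 1)" by simp
  have 1: "real (card ?C) \<le> real (card ?F) + n * Q"
    using of_nat_mono[OF 1, where ?'a=real] by (simp add: Q_def)
  have 2: "real (card ?F) \<le> real (card ?C) + n * Q"
    using of_nat_mono[OF 2, where ?'a=real] by (simp add: Q_def)
  have "avg B * (1 - 1 / q) = card ?C / (q * Q)"
    unfolding avg_def Q_def[symmetric] using q0 Q by (simp add: field_simps)
  then have "avg B * (1 - 1 / q) - card ?F / real q ^ n = (real (card ?C) - real (card ?F)) / (q * Q)"
    unfolding qQ by (simp add: diff_divide_distrib)
  then have "\<bar>avg B * (1 - 1 / q) - card ?F / real q ^ n\<bar> = \<bar>real (card ?C) - real (card ?F)\<bar> / (q * Q)"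
    using q0 Q by simp
  also have "\<dots> \<le> (n * Q) / (q * Q)" using 1 2 q0 Q by (intro divide_right_mono) auto
  also have "\<dots> = n / q" using Q by simp
  finally show ?thesis unfolding card_sqfree_type[OF mu] .
qed

lemma avg_T_set:
  assumes mu: "partition_of n \<mu>"
  shows "\<bar>avg {f. ctype f = \<mu>} * (1 - 1 / q) - (\<Prod>i\<in>set_mset \<mu>. card (irr i) choose count \<mu> i) / real q ^ n\<bar> \<le> n / q"
  by (rule avg_type_bound[OF mu]) (auto simp: ctype_sqfree)

lemma avg_T_box_set:
  assumes mu: "partition_of n \<mu>"
  shows "\<bar>avg {f. ctype f = \<mu> \<and> sqfree f} * (1 - 1 / q) - (\<Prod>i\<in>set_mset \<mu>. card (irr i) choose count \<mu> i) / real q ^ n\<bar> \<le> n / q"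
  by (rule avg_type_bound[OF mu]) (auto simp: ctype_sqfree)

end

section \<open>Limits along the prime powers\<close>

lemma power_partition:
  fixes x :: real
  assumes "partition_of n \<mu>"
  shows "x ^ n = (\<Prod>i\<in>set_mset \<mu>. (x ^ i) ^ count \<mu> i)"
proof -
  have "x ^ (\<Sum>\<^sub># \<mu>) = prod_mset (image_mset (\<lambda>i. x ^ i) \<mu>)"
    by (induction \<mu>) (auto simp: power_add)
  then show ?thesis using assms by (simp add: partition_of_def image_prod_mset_multiplicity)
qed

lemma eventually_prime_powers:
  assumes "\<And>q. primepow q \<Longrightarrow> P q"
  shows "eventually P prime_powers_at_top"
  unfolding prime_powers_at_top_def eventually_inf_principal using assms by simp

lemma tendsto_zero_comparison:
  fixes f g :: "_ \<Rightarrow> real"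
  assumes g: "(g \<longlongrightarrow> 0) F" and le: "\<forall>\<^sub>F x in F. norm (f x) \<le> g x"
  shows "(f \<longlongrightarrow> 0) F"
proof (rule tendsto_0_le[OF g])
  show "\<forall>\<^sub>F x in F. norm (f x) \<le> norm (g x) * 1"
    using le by (rule eventually_mono) simp
qed

lemma inverse_tendsto_prime_powers: "((\<lambda>q. 1 / real q) \<longlongrightarrow> 0) prime_powers_at_top"
  by (rule tendsto_mono[OF _ lim_1_over_n]) (simp add: prime_powers_at_top_def)

text \<open>The falling factorial in the binomial coefficient has \<open>m\<close> factors; each is
  divided by its own \<open>q^i\<close>, after which the subtracted constants vanish in the
  limit.\<close>

lemma binomial_ratio_tendsto:
  fixes x :: "nat \<Rightarrow> nat" and i m :: nat
  assumes x: "((\<lambda>q. x q / real q ^ i) \<longlongrightarrow> l) F" and q: "((\<lambda>q. 1 / real q) \<longlongrightarrow> 0) F" and i: "i \<ge> 1"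
  shows "((\<lambda>q. (x q choose m) / (real q ^ i) ^ m) \<longlongrightarrow> l ^ m / fact m) F"
proof -
  have z: "((\<lambda>q. 1 / real q ^ i) \<longlongrightarrow> 0) F"
    using tendsto_power[OF q, of i] i by (simp add: power_one_over zero_power)
  have "((\<lambda>q. (\<Prod>j=0..<m. x q / real q ^ i - real j * (1 / real q ^ i)) / fact m) \<longlongrightarrow> (\<Prod>j=0..<m. l - real j * 0) / fact m) F"
    by (intro tendsto_divide tendsto_prod tendsto_diff tendsto_mult tendsto_const x z) simp
  moreover have "(\<Prod>j=0..<m. x q / real q ^ i - real j * (1 / real q ^ i)) / fact m = (x q choose m) / (real q ^ i) ^ m" for q
  proof -
    have "(\<Prod>j=0..<m. x q / real q ^ i - real j * (1 / real q ^ i)) = (\<Prod>j=0..<m. (real (x q) - real j) / real q ^ i)"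
      by (simp add: diff_divide_distrib)
    also have "\<dots> = (\<Prod>j=0..<m. real (x q) - real j) / (real q ^ i) ^ m" by (simp add: prod_dividef)
    finally show ?thesis by (simp add: binomial_gbinomial gbinomial_prod_rev)
  qed
  ultimately show ?thesis by simp
qed

theorem theorem1p7:
  fixes F :: "nat \<Rightarrow> 'a ring"
    and n k :: nat
    and \<mu> :: "nat multiset"
  assumes F: "\<And>q. primepow q \<Longrightarrow> field (F q) \<and> card (carrier (F q)) = q"
    and n: "n \<ge> 1"
    and k: "k \<ge> 2"
    and mu: "partition_of n \<mu>"
  shows "((\<lambda>q. p_prob (F q) n k \<mu>) \<longlongrightarrow> 1 / real (z_part \<mu>)) prime_powers_at_top
       \<and> ((\<lambda>q. p_box_prob (F q) n k \<mu>) \<longlongrightarrow> 1 / real (z_part \<mu>)) prime_powers_at_top"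
proof -
  let ?L = prime_powers_at_top
  have loc: "finite_matrix_field (F q) n" if "primepow q" for q
  proof -
    interpret field "F q" using F[OF that] by simp
    have "q > 0" using that by (rule primepow_gt_0_nat)
    \<comment> \<open>An infinite carrier would have \<open>card\<close> equal to
      \<open>0\<close>.\<close>
    then have "finite (carrier (F q))" using F[OF that] by (metis card.infinite less_irrefl)
    then show ?thesis using n by unfold_locales
  qed
  have cq: "card (carrier (F q)) = q" if "primepow q" for q using F[OF that] by simp
  note inv0 = inverse_tendsto_prime_powers
  define a where "a i q = card (finite_field.irr (F q) i)" for i q
  have a_lim: "((\<lambda>q. a i q / real q ^ i) \<longlongrightarrow> 1 / i) ?L" if i: "i \<ge> 1" for i
  proof -
    have "((\<lambda>q. a i q / real q ^ i - 1 / i) \<longlongrightarrow> 0) ?L"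
    proof (rule tendsto_zero_comparison)
      show "((\<lambda>q. (real i * 2 ^ i) * (1 / real q)) \<longlongrightarrow> 0) ?L" by (rule tendsto_mult_right_zero[OF inv0])
      show "\<forall>\<^sub>F q in ?L. norm (a i q / real q ^ i - 1 / i) \<le> (real i * 2 ^ i) * (1 / real q)"
      proof (rule eventually_prime_powers)
        fix q :: nat assume q: "primepow q"
        interpret finite_matrix_field "F q" n by (rule loc[OF q])
        have q0: "real q > 0" using primepow_gt_0_nat[OF q] by simp
        have i0: "real i > 0" using i by simp
        have qi: "real q ^ i = real q * real q ^ (i - 1)" using i by (cases i) auto
        have "\<bar>real i * a i q - real q ^ i\<bar> \<le> real i ^ 2 * 2 ^ i * real q ^ (i - 1)"
          using irr_count_asymp[OF i] by (simp add: a_def cq[OF q])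
        then have "\<bar>real i * a i q - real q ^ i\<bar> / (i * real q ^ i) \<le> (real i ^ 2 * 2 ^ i * real q ^ (i - 1)) / (i * real q ^ i)"
          using q0 by (intro divide_right_mono) auto
        also have "\<dots> = (real i * 2 ^ i) * (1 / real q)"
          unfolding qi using q0 i0 by (simp add: power2_eq_square)
        also have "\<bar>real i * a i q - real q ^ i\<bar> / (i * real q ^ i) = \<bar>(real i * a i q - real q ^ i) / (i * real q ^ i)\<bar>"
          using q0 by simp
        also have "(real i * a i q - real q ^ i) / (i * real q ^ i) = a i q / real q ^ i - 1 / i"
          using q0 i0 by (simp add: diff_divide_distrib)
        finally show "norm (a i q / real q ^ i - 1 / i) \<le> (real i * 2 ^ i) * (1 / real q)" by simp
      qed
    qed
    then show ?thesis by (rule LIM_zero_cancel)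
  qed
  \<comment> \<open>By \<open>card_sqfree_type\<close> the numerator counts the square-free monic
    polynomials of type \<open>\<mu>\<close>.\<close>
  define r where "r q = real (\<Prod>i\<in>set_mset \<mu>. a i q choose count \<mu> i) / real q ^ n" for q
  have r_lim: "(r \<longlongrightarrow> 1 / real (z_part \<mu>)) ?L"
  proof -
    have "((\<lambda>q. \<Prod>i\<in>set_mset \<mu>. (a i q choose count \<mu> i) / (real q ^ i) ^ count \<mu> i) \<longlongrightarrow>
        (\<Prod>i\<in>set_mset \<mu>. (1 / real i) ^ count \<mu> i / fact (count \<mu> i))) ?L"
    proof (intro tendsto_prod binomial_ratio_tendsto a_lim inv0)
      fix i assume "i \<in># \<mu>"
      then show "1 \<le> i" "1 \<le> i" using mu unfolding partition_of_def by (cases i; force)+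
    qed
    moreover have "(\<Prod>i\<in>set_mset \<mu>. (1 / real i) ^ count \<mu> i / fact (count \<mu> i)) = 1 / real (z_part \<mu>)"
      unfolding z_part_def by (simp add: prod_dividef prod.distrib power_one_over)
    moreover have "(\<Prod>i\<in>set_mset \<mu>. (a i q choose count \<mu> i) / (real q ^ i) ^ count \<mu> i) = r q" for q
      unfolding r_def power_partition[OF mu] by (simp add: prod_dividef)
    ultimately show ?thesis by simp
  qed
  \<comment> \<open>Both limits at once: \<open>S q\<close> may be any set cut out by a set
    \<open>B\<close> of polynomials, depending on \<open>q\<close>, whose average is close to
    \<open>r q\<close>.\<close>
  have main: "((\<lambda>q. product_prob (F q) n k (S q)) \<longlongrightarrow> 1 / real (z_part \<mu>)) ?L"
    if S: "\<And>q. primepow q \<Longrightarrow> \<exists>B. S q = {h \<in> carrier (GL (F q) n). charpoly_over (F q) h \<in> B} \<and>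
        \<bar>finite_matrix_field.avg (F q) n B * (1 - 1 / real q) - r q\<bar> \<le> n / q" for S
  proof -
    \<comment> \<open>A choice of \<open>B\<close> for every \<open>q\<close> makes the average a
      function of \<open>q\<close>, whose limit can be taken.\<close>
    define A where "A q = finite_matrix_field.avg (F q) n (SOME B. S q = {h \<in> carrier (GL (F q) n). charpoly_over (F q) h \<in> B} \<and>
        \<bar>finite_matrix_field.avg (F q) n B * (1 - 1 / real q) - r q\<bar> \<le> n / q)" for q
    have AB: "\<exists>B. S q = {h \<in> carrier (GL (F q) n). charpoly_over (F q) h \<in> B} \<and>
        \<bar>A q * (1 - 1 / real q) - r q\<bar> \<le> n / q \<and> A q = finite_matrix_field.avg (F q) n B" if "primepow q" for q
      using someI_ex[OF S[OF that]] unfolding A_def by blast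
    define e where "e q = 1 / real q + (2 * real n + real n * 2 ^ n + 2) / (real q - 1)" for q :: nat
    have inv1: "((\<lambda>q. (2 * real n + real n * 2 ^ n + 2) / (real q - 1)) \<longlongrightarrow> 0) ?L"
    proof -
      have "filterlim (\<lambda>q. real q) at_top ?L"
        using filterlim_real_sequentially by (rule filterlim_mono) (auto simp: prime_powers_at_top_def)
      then have "filterlim (\<lambda>q. - 1 + real q) at_top ?L" by (rule filterlim_tendsto_add_at_top[OF tendsto_const])
      then have "filterlim (\<lambda>q. real q - 1) at_top ?L" by (simp add: add.commute)
      then show ?thesis by (intro tendsto_divide_0[OF tendsto_const] filterlim_at_top_imp_at_infinity)
    qed
    have e_lim: "(e \<longlongrightarrow> 0) ?L" unfolding e_def using tendsto_add[OF inv0 inv1] by simp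
    have A_lim: "(A \<longlongrightarrow> 1 / real (z_part \<mu>)) ?L"
    proof -
      have "((\<lambda>q. A q * (1 - 1 / real q) - r q) \<longlongrightarrow> 0) ?L"
      proof (rule tendsto_zero_comparison)
        show "((\<lambda>q. real n * (1 / real q)) \<longlongrightarrow> 0) ?L" by (rule tendsto_mult_right_zero[OF inv0])
        show "\<forall>\<^sub>F q in ?L. norm (A q * (1 - 1 / real q) - r q) \<le> real n * (1 / real q)"
          by (rule eventually_prime_powers) (use AB in force)
      qed
      from tendsto_add[OF this r_lim]
      have 1: "((\<lambda>q. A q * (1 - 1 / real q)) \<longlongrightarrow> 1 / real (z_part \<mu>)) ?L" by simp
      have 2: "((\<lambda>q. 1 - 1 / real q) \<longlongrightarrow> 1) ?L" using tendsto_diff[OF tendsto_const inv0, of 1] by simp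
      have "((\<lambda>q. A q * (1 - 1 / real q) / (1 - 1 / real q)) \<longlongrightarrow> 1 / real (z_part \<mu>) / 1) ?L"
        by (rule tendsto_divide[OF 1 2]) simp
      moreover have "\<forall>\<^sub>F q in ?L. A q * (1 - 1 / real q) / (1 - 1 / real q) = A q"
      proof (rule eventually_prime_powers)
        fix q :: nat assume "primepow q"
        then have "q > 1" by (rule primepow_gt_Suc_0[unfolded One_nat_def[symmetric]])
        then have "1 - 1 / real q \<noteq> 0" by simp
        then show "A q * (1 - 1 / real q) / (1 - 1 / real q) = A q" by simp
      qed
      ultimately show ?thesis by (simp add: tendsto_cong)
    qed
    have "((\<lambda>q. product_prob (F q) n k (S q) - A q) \<longlongrightarrow> 0) ?L"
    proof (rule tendsto_zero_comparison)
      have "((\<lambda>q. 4 * (real n)\<^sup>2 * sqrt (3 * (1 / real q)) + 4 * real n * e q) \<longlongrightarrow> 4 * (real n)\<^sup>2 * sqrt (3 * 0) + 4 * real n * 0) ?L"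
        by (intro tendsto_add tendsto_mult tendsto_const tendsto_real_sqrt inv0 e_lim)
      then show "((\<lambda>q. 4 * (real n)\<^sup>2 * sqrt (3 / real q) + 4 * real n * e q) \<longlongrightarrow> 0) ?L" by simp
      \<comment> \<open>Once \<open>q\<close> is large, the smallness condition on
        \<open>err\<close> in \<open>product_prob_bound\<close> is satisfied.\<close>
      have "\<forall>\<^sub>F q in ?L. e q < 1 / (2 * n)"
        using n by (intro order_tendstoD(2)[OF e_lim]) simp
      moreover have "\<forall>\<^sub>F q in ?L. e q < 1 / (2 * n) \<longrightarrow>
          norm (product_prob (F q) n k (S q) - A q) \<le> 4 * (real n)\<^sup>2 * sqrt (3 / real q) + 4 * real n * e q"
      proof (rule eventually_prime_powers, rule impI)
        fix q :: nat assume q: "primepow q" and eq: "e q < 1 / (2 * n)"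
        interpret finite_matrix_field "F q" n by (rule loc[OF q])
        have ee: "err = e q" by (simp add: err_def e_def cq[OF q])
        obtain B where B: "S q = {h \<in> carrier (GL (F q) n). charpoly_over (F q) h \<in> B}" "A q = avg B"
          using AB[OF q] by blast
        show "norm (product_prob (F q) n k (S q) - A q) \<le> 4 * (real n)\<^sup>2 * sqrt (3 / real q) + 4 * real n * e q"
          using product_prob_bound[OF k, of B] eq unfolding ee B by (simp add: cq[OF q])
      qed
      ultimately show "\<forall>\<^sub>F q in ?L. norm (product_prob (F q) n k (S q) - A q) \<le> 4 * (real n)\<^sup>2 * sqrt (3 / real q) + 4 * real n * e q"
        by eventually_elim simp
    qed
    from tendsto_add[OF this A_lim] show ?thesis by simp
  qed
  have "((\<lambda>q. product_prob (F q) n k (T_set (F q) n \<mu>)) \<longlongrightarrow> 1 / real (z_part \<mu>)) ?L"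
  proof (rule main)
    fix q :: nat assume q: "primepow q"
    interpret finite_matrix_field "F q" n by (rule loc[OF q])
    show "\<exists>B. T_set (F q) n \<mu> = {h \<in> carrier (GL (F q) n). charpoly_over (F q) h \<in> B} \<and>
        \<bar>avg B * (1 - 1 / real q) - r q\<bar> \<le> n / q"
      using avg_T_set[OF mu] T_set_charpoly unfolding r_def a_def cq[OF q] by blast
  qed
  moreover have "((\<lambda>q. product_prob (F q) n k (T_box_set (F q) n \<mu>)) \<longlongrightarrow> 1 / real (z_part \<mu>)) ?L"
  proof (rule main)
    fix q :: nat assume q: "primepow q"
    interpret finite_matrix_field "F q" n by (rule loc[OF q])
    show "\<exists>B. T_box_set (F q) n \<mu> = {h \<in> carrier (GL (F q) n). charpoly_over (F q) h \<in> B} \<and>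
        \<bar>avg B * (1 - 1 / real q) - r q\<bar> \<le> n / q"
      using avg_T_box_set[OF mu] T_box_set_charpoly unfolding r_def a_def cq[OF q] by blast
  qed
  ultimately show ?thesis unfolding p_prob_def p_box_prob_def ..
qed

end
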